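(* There is a universal numerical constant $C>0$ (independent of all problem parameters) such that for every $d\ge 1$, all Borel probability measures $\mu,\nu$ on $\mathbb{R}^d$, every cost $c$ satisfying the cost assumption with Lipschitz constant $L>0$, every $\varepsilon>0$ and every $n\ge 1$, $$\mathbb{E}\big[|S_\varepsilon(\hat\mu,\hat\nu)-S_\varepsilon(\mu,\nu)|\big]\le C(1+\varepsilon)\sqrt{\frac{\mathcal{N}(\mu,\frac{\varepsilon}{L})\wedge\mathcal{N}(\nu,\frac{\varepsilon}{L})}{n}}.$$
   Context: Cost assumption: $c$ is Borel measurable with $\|c\|_{L^\infty(\mu\otimes\nu)}\le 1$; $|c(x,y)-c(x',y)|\le L\|x-x'\|$ for all $x,x'\in\mathrm{supp}(\mu)$, $y\in\mathrm{supp}(\nu)$; and $|c(x,y)-c(x,y')|\le L\|y-y'\|$ for all $x\in\mathrm{supp}(\mu)$, $y,y'\in\mathrm{supp}(\nu)$. Here $\|\cdot\|$ is the Euclidean norm. Entropic OT value: for probability measures $P,Q$ on $\mathbb{R}^d$ and $\varepsilon>0$, $S_\varepsilon(P,Q):=\inf_{\pi\in\Pi(P,Q)}\{\int c\,d\pi+\varepsilon\,\mathrm{KL}(\pi\,\|\,P\otimes Q)\}$, where $\Pi(P,Q)$ is the set of couplings of $P$ and $Q$ and $\mathrm{KL}(\pi\|\rho)=\int\ln(\frac{d\pi}{d\rho})\,d\pi$ if $\pi\ll\rho$, $+\infty$ otherwise. Samples: $x_1,\dots,x_n\sim\mu$ iid and $y_1,\dots,y_n\sim\nu$ iid are independent of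 each other, $\hat\mu:=\frac1n\sum_i\delta_{x_i}$, $\hat\nu:=\frac1n\sum_j\delta_{y_j}$, and $\mathbb{E}$ is expectation over both samples. Covering numbers: for $\delta>0$, $\mathcal{N}(\mu,\delta)$ is the minimal number of closed Euclidean balls of radius $\delta$ (with centers in $\mathbb{R}^d$) needed to cover $\mathrm{supp}(\mu)$, and similarly $\mathcal{N}(\nu,\delta)$. $a\wedge b=\min(a,b)$. *)

theory Defs
  imports "HOL-Probability.Probability"
begin

text \<open>
  The constant of the theorem is uniform in the dimension, so the dimension \<open>d\<close> has to be a natural
  number that can be quantified inside a formula, rather than a type.  Points of $d$-space are the
  extensional functions on \<open>{..<d}\<close>; the product sigma-algebra is the Borel sigma-algebra.
\<close>

definition Rd :: "nat \<Rightarrow> (nat \<Rightarrow> real) measure" where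
  "Rd d = Pi\<^sub>M {..<d} (\<lambda>_. borel)"

definition euclid_dist :: "nat \<Rightarrow> (nat \<Rightarrow> real) \<Rightarrow> (nat \<Rightarrow> real) \<Rightarrow> real" where
  "euclid_dist d x y = L2_set (\<lambda>i. x i - y i) {..<d}"

definition borel_prob :: "nat \<Rightarrow> (nat \<Rightarrow> real) measure \<Rightarrow> bool" where
  "borel_prob d P \<longleftrightarrow> prob_space P \<and> sets P = sets (Rd d)"

definition supp :: "nat \<Rightarrow> (nat \<Rightarrow> real) measure \<Rightarrow> (nat \<Rightarrow> real) set" where
  "supp d P = {x \<in> space (Rd d). \<forall>r>0. emeasure P {y \<in> space (Rd d). euclid_dist d x y < r} > 0}"

text \<open>The value is \<open>\<infinity>\<close> (the infimum of the empty set) if no finite cover exists.\<close>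

definition covering_number :: "nat \<Rightarrow> (nat \<Rightarrow> real) measure \<Rightarrow> real \<Rightarrow> enat" where
  "covering_number d P \<delta> =
     (INF F \<in> {F. finite F \<and> F \<subseteq> space (Rd d) \<and>
                  supp d P \<subseteq> (\<Union>a\<in>F. {x \<in> space (Rd d). euclid_dist d a x \<le> \<delta>})}. enat (card F))"

definition cost_assumption ::
  "nat \<Rightarrow> (nat \<Rightarrow> real) measure \<Rightarrow> (nat \<Rightarrow> real) measure \<Rightarrow>
   ((nat \<Rightarrow> real) \<Rightarrow> (nat \<Rightarrow> real) \<Rightarrow> real) \<Rightarrow> real \<Rightarrow> bool" where
  "cost_assumption d \<mu> \<nu> c L \<longleftrightarrow>
     (\<lambda>(x, y). c x y) \<in> borel_measurable (Rd d \<Otimes>\<^sub>M Rd d) \<and>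
     esssup (\<mu> \<Otimes>\<^sub>M \<nu>) (\<lambda>(x, y). ereal \<bar>c x y\<bar>) \<le> 1 \<and>
     (\<forall>x\<in>supp d \<mu>. \<forall>x'\<in>supp d \<mu>. \<forall>y\<in>supp d \<nu>. \<bar>c x y - c x' y\<bar> \<le> L * euclid_dist d x x') \<and>
     (\<forall>x\<in>supp d \<mu>. \<forall>y\<in>supp d \<nu>. \<forall>y'\<in>supp d \<nu>. \<bar>c x y - c x y'\<bar> \<le> L * euclid_dist d y y')"

definition couplings :: "'a measure \<Rightarrow> 'b measure \<Rightarrow> ('a \<times> 'b) measure set" where
  "couplings P Q = {\<pi>. sets \<pi> = sets (P \<Otimes>\<^sub>M Q) \<and> distr \<pi> P fst = P \<and> distr \<pi> Q snd = Q}"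

text \<open>
  \<open>KL_divergence\<close> is a Bochner integral and hence $0$ when the log-density is not integrable.  For
  probability measures \<open>\<pi> \<lless> \<rho>\<close> the negative part of the log-density is always \<open>\<pi>\<close>-integrable, so in
  the non-integrable case the integral is \<open>+\<infinity>\<close>.  The base \<open>exp 1\<close> gives natural logarithms.
\<close>

definition KL :: "'a measure \<Rightarrow> 'a measure \<Rightarrow> ereal" where
  "KL \<pi> \<rho> =
     (if absolutely_continuous \<rho> \<pi> \<and> integrable \<pi> (entropy_density (exp 1) \<rho> \<pi>)
      then ereal (KL_divergence (exp 1) \<rho> \<pi>) else \<infinity>)"

text \<open>
  Where the Bochner integral of the cost is not defined, the KL term is \<open>\<infinity>\<close>: if it is finite then
  \<open>\<pi> \<lless> P \<Otimes> Q\<close>, and the cost is \<open>P \<Otimes> Q\<close>-essentially bounded wherever this definition is used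
  (for empirical measures because they have finite support).
\<close>

definition entropic_OT ::
  "('a \<Rightarrow> 'b \<Rightarrow> real) \<Rightarrow> real \<Rightarrow> 'a measure \<Rightarrow> 'b measure \<Rightarrow> ereal" where
  "entropic_OT c \<epsilon> P Q =
     (INF \<pi> \<in> couplings P Q. ereal (\<integral>(x, y). c x y \<partial>\<pi>) + ereal \<epsilon> * KL \<pi> (P \<Otimes>\<^sub>M Q))"

text \<open>The push-forward of the uniform distribution on the indices is $(1/n) \sum_i \delta_{x_i}$.\<close>

definition empirical :: "nat \<Rightarrow> nat \<Rightarrow> (nat \<Rightarrow> nat \<Rightarrow> real) \<Rightarrow> (nat \<Rightarrow> real) measure" where
  "empirical d n x = distr (uniform_count_measure {..<n}) (Rd d) x"

text \<open>The joint law of two independent iid samples of size \<open>n\<close> from \<open>\<mu>\<close> and from \<open>\<nu>\<close>.\<close>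

definition samples ::
  "nat \<Rightarrow> (nat \<Rightarrow> real) measure \<Rightarrow> (nat \<Rightarrow> real) measure \<Rightarrow>
   ((nat \<Rightarrow> nat \<Rightarrow> real) \<times> (nat \<Rightarrow> nat \<Rightarrow> real)) measure" where
  "samples n \<mu> \<nu> = Pi\<^sub>M {..<n} (\<lambda>_. \<mu>) \<Otimes>\<^sub>M Pi\<^sub>M {..<n} (\<lambda>_. \<nu>)"

definition estimation_error ::
  "nat \<Rightarrow> nat \<Rightarrow> ((nat \<Rightarrow> real) \<Rightarrow> (nat \<Rightarrow> real) \<Rightarrow> real) \<Rightarrow> real \<Rightarrow>
   (nat \<Rightarrow> real) measure \<Rightarrow> (nat \<Rightarrow> real) measure \<Rightarrow>
   (nat \<Rightarrow> nat \<Rightarrow> real) \<times> (nat \<Rightarrow> nat \<Rightarrow> real) \<Rightarrow> ennreal" where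
  "estimation_error d n c \<epsilon> \<mu> \<nu> = (\<lambda>(x, y).
     e2ennreal \<bar>entropic_OT c \<epsilon> (empirical d n x) (empirical d n y) - entropic_OT c \<epsilon> \<mu> \<nu>\<bar>)"

definition ennreal_sqrt :: "ennreal \<Rightarrow> ennreal" where
  "ennreal_sqrt a = (if a = \<infinity> then \<infinity> else ennreal (sqrt (enn2real a)))"

end

theory Submission
  imports Defs
begin

text \<open>
  Let \<open>(f, g)\<close> be optimal dual potentials of the population problem and \<open>p = exp ((f + g - c) / \<epsilon>)\<close>, a
  density with respect to \<open>\<mu> \<otimes> \<nu>\<close> both of whose marginals are 1.  The empirical value is at least the
  empirical dual objective at \<open>(f, g)\<close>; by concavity it exceeds that objective by at most the pairing of
  its gradient at \<open>(f, g)\<close>, i.e. of the empirical marginal errors \<open>1 - \<integral> p d\<nu>\<^sub>n\<close> and \<open>1 - \<integral> p d\<mu>\<^sub>n\<close>,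
  with the difference of the empirical and the population potentials, and these potentials are bounded
  by \<open>2\<close> and \<open>3\<close>.  Hence everything reduces to the sampling variance of \<open>p\<close>, that is to
  \<open>\<integral> p\<^sup>2 d(\<mu> \<otimes> \<nu>) / n\<close>.  Since \<open>p\<close> varies by a factor of at most \<open>exp 4\<close> on a ball of radius \<open>\<epsilon> / L\<close> in one
  variable and its marginals are 1, on a ball \<open>B\<close> it is at most \<open>exp 4 / \<mu> B\<close>; so each ball of a cover
  contributes at most \<open>exp 4\<close> to \<open>\<integral> p\<^sup>2 d(\<mu> \<otimes> \<nu>)\<close>.

  Existence of the potentials, for population and empirical measures alike, comes from the Sinkhorn
  iteration: if two positive functions have ratio oscillation \<open>\<tau>\<close>, a half step with a kernel in
  \<open>[b, 1 / b]\<close> lowers it to \<open>b^4 + (1 - b^4) \<tau>\<close>.  The iterates also show that the empirical value is a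
  measurable function of the sample.
\<close>

section \<open>Sinkhorn iteration\<close>

text \<open>The gradient of the empirical dual objective is taken at the population potentials,
  which do not depend on the sample. So no supremum over a class of potentials has to be controlled,
  and the covering number is needed at the single scale \<open>\<epsilon> / L\<close>. The pairing
  needs potential bounds free of \<epsilon>. The kernel \<open>exp (- c / \<epsilon>)\<close> lies
  in \<open>[b, 1 / b]\<close> with \<open>b = exp (- M / \<epsilon>)\<close>; the normalized
  scalings lie within powers \<open>b^2\<close> and \<open>b^3\<close> of 1, and
  \<open>\<epsilon> * ln\<close> turns these powers into \<open>2 * M\<close> and
  \<open>3 * M\<close>. The contraction rate degenerates as \<epsilon> tends to 0, which is
  harmless: only the limit is used, never the speed. The minimum of the two covering numbers appears
  because the integral of the squared density is symmetric in the two factors, so either support may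
  be covered. The obstacle on the side of the cost is that it is only essentially bounded, while the
  kernel estimates want bounds at every pair. The cost is therefore truncated to
  \<open>[-1, 1]\<close>, which leaves the population value unchanged, and the empirical value
  almost surely.\<close>

definition bdd_pos :: "'a measure \<Rightarrow> ('a \<Rightarrow> real) \<Rightarrow> bool" where
  "bdd_pos N w \<longleftrightarrow> w \<in> borel_measurable N \<and> (\<exists>l>0. \<exists>h. \<forall>x\<in>space N. l \<le> w x \<and> w x \<le> h)"

lemma bdd_posI:
  assumes "w \<in> borel_measurable N" "0 < l" "\<And>x. x \<in> space N \<Longrightarrow> l \<le> w x"
    "\<And>x. x \<in> space N \<Longrightarrow> w x \<le> h"
  shows "bdd_pos N w"
  using assms unfolding bdd_pos_def by blast

lemma bdd_pos_measurable: "bdd_pos N w \<Longrightarrow> w \<in> borel_measurable N"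
  by (simp add: bdd_pos_def)

lemma bdd_pos_pos: "bdd_pos N w \<Longrightarrow> x \<in> space N \<Longrightarrow> 0 < w x"
  unfolding bdd_pos_def by force

lemma bdd_pos_mult:
  assumes "bdd_pos N v" "bdd_pos N w"
  shows "bdd_pos N (\<lambda>x. v x * w x)"
proof -
  obtain l h where 1: "l > 0" "\<And>x. x \<in> space N \<Longrightarrow> l \<le> v x \<and> v x \<le> h"
    using assms(1) unfolding bdd_pos_def by blast
  obtain l' h' where 2: "l' > 0" "\<And>x. x \<in> space N \<Longrightarrow> l' \<le> w x \<and> w x \<le> h'"
    using assms(2) unfolding bdd_pos_def by blast
  have [measurable]: "v \<in> borel_measurable N" "w \<in> borel_measurable N"
    using assms by (auto simp: bdd_pos_def)
  show ?thesis
  proof (rule bdd_posI)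
    fix x assume "x \<in> space N"
    then show "l * l' \<le> v x * w x" "v x * w x \<le> h * h'"
      using 1 2 by (smt (verit) mult_mono)+
  qed (use 1 2 in auto)
qed

lemma bdd_pos_divide:
  assumes "bdd_pos N w" "(c::real) > 0"
  shows "bdd_pos N (\<lambda>x. w x / c)"
proof -
  have "bdd_pos N (\<lambda>x. 1 / c)"
    using assms(2) by (intro bdd_posI[where l="1/c" and h="1/c"]) auto
  from bdd_pos_mult[OF assms(1) this] show ?thesis by simp
qed

context prob_space
begin

lemma integrable_bounded:
  assumes "f \<in> borel_measurable M" "\<And>x. x \<in> space M \<Longrightarrow> \<bar>f x\<bar> \<le> B"
  shows "integrable M (f :: _ \<Rightarrow> real)"
  using assms by (intro integrable_const_bound[where B=B]) auto

lemma integral_bounds: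
  fixes f :: "'a \<Rightarrow> real"
  assumes "f \<in> borel_measurable M" "\<And>x. x \<in> space M \<Longrightarrow> l \<le> f x" "\<And>x. x \<in> space M \<Longrightarrow> f x \<le> h"
  shows "l \<le> integral\<^sup>L M f" "integral\<^sup>L M f \<le> h"
proof -
  have "integrable M f"
    using assms by (intro integrable_bounded[where B="max \<bar>l\<bar> \<bar>h\<bar>"]) fastforce+
  then show "l \<le> integral\<^sup>L M f" "integral\<^sup>L M f \<le> h"
    using assms by (auto intro!: integral_ge_const integral_le_const)
qed

lemma integral_abs_le:
  fixes f :: "'a \<Rightarrow> real"
  assumes "f \<in> borel_measurable M" "\<And>x. x \<in> space M \<Longrightarrow> \<bar>f x\<bar> \<le> B"
  shows "\<bar>integral\<^sup>L M f\<bar> \<le> B"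
  using integral_bounds[OF assms(1), of "-B" B] assms(2) by (fastforce simp: abs_le_iff)

lemma bdd_pos_integrable: "bdd_pos M w \<Longrightarrow> integrable M w"
  unfolding bdd_pos_def by (fastforce intro: integrable_bounded)

lemma bdd_pos_integral_pos:
  assumes "bdd_pos M w"
  shows "0 < integral\<^sup>L M w"
proof -
  obtain l h where 1: "l > 0" "\<And>x. x \<in> space M \<Longrightarrow> l \<le> w x \<and> w x \<le> h"
    and "w \<in> borel_measurable M"
    using assms(1) unfolding bdd_pos_def by blast
  then show ?thesis using integral_bounds(1)[of w l h] by force
qed

text \<open>Doeblin's argument. The quotients of the integrals are averages of
  \<open>w1 / w2\<close> under the probability densities \<open>k * w2 / Z\<close> and
  \<open>k' * w2 / Z'\<close>. The first density dominates \<open>b^4\<close> times the second; on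
  that common part the averages agree, and only the remaining mass \<open>1 - b^4\<close> pays the
  factor \<tau>.\<close>

lemma average_ratio_contraction:
  assumes b: "0 < b"
    and k: "k \<in> borel_measurable M" "\<And>y. y \<in> space M \<Longrightarrow> b \<le> k y" "\<And>y. y \<in> space M \<Longrightarrow> k y \<le> 1 / b"
    and k': "k' \<in> borel_measurable M" "\<And>y. y \<in> space M \<Longrightarrow> b \<le> k' y" "\<And>y. y \<in> space M \<Longrightarrow> k' y \<le> 1 / b"
    and w: "bdd_pos M w1" "bdd_pos M w2"
    and ratio: "\<And>y y'. y \<in> space M \<Longrightarrow> y' \<in> space M \<Longrightarrow> w1 y * w2 y' \<le> \<tau> * (w1 y' * w2 y)"
  shows "(\<integral>y. k y * w1 y \<partial>M) * (\<integral>y. k' y * w2 y \<partial>M)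
     \<le> (b^4 + (1 - b^4) * \<tau>) * ((\<integral>y. k' y * w1 y \<partial>M) * (\<integral>y. k y * w2 y \<partial>M))"
proof -
  have kp: "bdd_pos M k" "bdd_pos M k'"
    using b k k' by (auto intro!: bdd_posI[of _ _ b "1/b"])
  note int = bdd_pos_integrable[OF bdd_pos_mult[OF kp(1) w(1)]] bdd_pos_integrable[OF bdd_pos_mult[OF kp(1) w(2)]]
    bdd_pos_integrable[OF bdd_pos_mult[OF kp(2) w(1)]] bdd_pos_integrable[OF bdd_pos_mult[OF kp(2) w(2)]]
  define I Z I' Z' where "I = (\<integral>y. k y * w1 y \<partial>M)" and "Z = (\<integral>y. k y * w2 y \<partial>M)"
    and "I' = (\<integral>y. k' y * w1 y \<partial>M)" and "Z' = (\<integral>y. k' y * w2 y \<partial>M)"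
  have pos: "0 < Z" "0 < Z'" "0 < I'"
    unfolding Z_def Z'_def I'_def by (intro bdd_pos_integral_pos bdd_pos_mult kp w)+
  have kk': "b^2 * k' y \<le> k y" "b^2 * k y \<le> k' y" if "y \<in> space M" for y
  proof -
    have "b^2 * (1/b) = b" by (simp add: power2_eq_square)
    moreover have "b^2 * k' y \<le> b^2 * (1/b)" "b^2 * k y \<le> b^2 * (1/b)"
      using k(3) k'(3) that by (auto intro!: mult_left_mono simp del: times_divide_eq_right)
    ultimately show "b^2 * k' y \<le> k y" "b^2 * k y \<le> k' y"
      using k(2)[OF that] k'(2)[OF that] by linarith+
  qed
  have "(\<integral>y. b^2 * (k y * w2 y) \<partial>M) \<le> Z'"
    unfolding Z'_def
  proof (rule integral_mono)
    show "b^2 * (k y * w2 y) \<le> k' y * w2 y" if "y \<in> space M" for y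
      using mult_right_mono[OF kk'(2)[OF that] less_imp_le[OF bdd_pos_pos[OF w(2) that]]]
      by (simp add: mult.assoc)
  qed (use int in auto)
  then have ZZ': "b^2 * Z \<le> Z'" by (simp add: Z_def)
  have w1le: "w1 y * Z' \<le> \<tau> * I' * w2 y" if y: "y \<in> space M" for y
  proof -
    have "(\<integral>y'. w1 y * (k' y' * w2 y') \<partial>M) \<le> (\<integral>y'. (\<tau> * w2 y) * (k' y' * w1 y') \<partial>M)"
    proof (rule integral_mono)
      show "w1 y * (k' y' * w2 y') \<le> (\<tau> * w2 y) * (k' y' * w1 y')" if y': "y' \<in> space M" for y'
        using mult_right_mono[OF ratio[OF y y'] less_imp_le[OF bdd_pos_pos[OF kp(2) y']]]
        by (simp add: mult_ac)
    qed (use int in auto)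
    then have "w1 y * Z' \<le> (\<tau> * w2 y) * I'"
      unfolding Z'_def I'_def integral_mult_right_zero .
    then show ?thesis by (simp add: mult_ac)
  qed
  \<comment> \<open>The minorization: one factor \<open>b^2\<close> compares \<open>k\<close> with
    \<open>k'\<close>, the other compares the normalizations \<open>Z\<close> and
    \<open>Z'\<close>.\<close>
  have nonneg: "0 \<le> k y * Z' - b^4 * k' y * Z" if y: "y \<in> space M" for y
  proof -
    have "(b^2 * k' y) * (b^2 * Z) \<le> k y * Z'"
      using kk'(1)[OF y] ZZ' pos b k'(2)[OF y] by (intro mult_mono) (auto intro: less_imp_le[OF bdd_pos_pos[OF kp(1) y]])
    then show ?thesis by (simp add: mult_ac power4_eq_xxxx power2_eq_square)
  qed
  have "(\<integral>y. (k y * Z' - b^4 * k' y * Z) * (w1 y * Z') \<partial>M) \<le>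
      (\<integral>y. (k y * Z' - b^4 * k' y * Z) * (\<tau> * I' * w2 y) \<partial>M)"
  proof (rule integral_mono)
    have "integrable M (\<lambda>y. Z'*Z' * (k y * w1 y) - (b^4 * Z * Z') * (k' y * w1 y))"
      "integrable M (\<lambda>y. (Z'*\<tau>*I') * (k y * w2 y) - (b^4 * Z * \<tau>*I') * (k' y * w2 y))"
      using int by auto
    then show "integrable M (\<lambda>y. (k y * Z' - b^4 * k' y * Z) * (w1 y * Z'))"
       "integrable M (\<lambda>y. (k y * Z' - b^4 * k' y * Z) * (\<tau> * I' * w2 y))"
      by (simp_all add: algebra_simps)
  qed (intro mult_left_mono w1le nonneg, auto)
  moreover have "(\<integral>y. (k y * Z' - b^4 * k' y * Z) * (w1 y * Z') \<partial>M)
      = (\<integral>y. Z'*Z' * (k y * w1 y) - (b^4 * Z * Z') * (k' y * w1 y) \<partial>M)"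
    by (simp add: algebra_simps)
  moreover have "\<dots> = Z' * Z' * I - b^4 * Z * Z' * I'"
    using int by (subst Bochner_Integration.integral_diff) (auto simp: I_def I'_def)
  moreover have "(\<integral>y. (k y * Z' - b^4 * k' y * Z) * (\<tau> * I' * w2 y) \<partial>M)
      = (\<integral>y. (Z'*\<tau>*I') * (k y * w2 y) - (b^4 * Z * \<tau>*I') * (k' y * w2 y) \<partial>M)"
    by (simp add: algebra_simps)
  moreover have "\<dots> = (Z'*\<tau>*I') * Z - (b^4 * Z * \<tau>*I') * Z'"
    using int by (subst Bochner_Integration.integral_diff) (auto simp: Z_def Z'_def)
  ultimately have "Z' * (Z' * I) \<le> Z' * ((b^4 + (1 - b^4) * \<tau>) * (I' * Z))"
    by (simp add: algebra_simps)
  then have "Z' * I \<le> (b^4 + (1 - b^4) * \<tau>) * (I' * Z)"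
    using pos by simp
  then show ?thesis by (simp add: I_def I'_def Z_def Z'_def mult.commute)
qed

end

text \<open>The scaling of the second variable that makes the marginal of \<open>u K v\<close> on
  that factor exact. The two spaces have separate types, so the same definition with
  \<open>K\<close> flipped serves as the other half.\<close>

definition half_step :: "'a measure \<Rightarrow> ('a \<Rightarrow> 'b \<Rightarrow> real) \<Rightarrow> ('a \<Rightarrow> real) \<Rightarrow> 'b \<Rightarrow> real" where
  "half_step P K u y = 1 / (\<integral>x. K x y * u x \<partial>P)"

text \<open>For positive functions this bounds Hilbert's projective metric between \<open>u\<close>
  and \<open>u'\<close> by \<open>ln \<tau>\<close>, written without quotients. It is insensitive to
  rescaling either function.\<close>

definition ratio_le :: "'c set \<Rightarrow> real \<Rightarrow> ('c \<Rightarrow> real) \<Rightarrow> ('c \<Rightarrow> real) \<Rightarrow> bool" where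
  "ratio_le S \<tau> u u' \<longleftrightarrow> (\<forall>x\<in>S. \<forall>x'\<in>S. u' x * u x' \<le> \<tau> * (u' x' * u x))"

text \<open>The contraction controls the iterates only up to a scalar. Dividing by the value at
  \<open>x0\<close> removes this freedom and turns projective convergence into pointwise
  convergence.\<close>

primrec sinkhorn ::
  "'a measure \<Rightarrow> 'b measure \<Rightarrow> ('a \<Rightarrow> 'b \<Rightarrow> real) \<Rightarrow> 'a \<Rightarrow> nat \<Rightarrow> 'a \<Rightarrow> real" where
  "sinkhorn P Q K x0 0 = (\<lambda>x. 1)"
| "sinkhorn P Q K x0 (Suc k) =
     (let w = half_step Q (\<lambda>y x. K x y) (half_step P K (sinkhorn P Q K x0 k)) in (\<lambda>x. w x / w x0))"

locale kernel = P: prob_space P + Q: prob_space Q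
  for P :: "'a measure" and Q :: "'b measure" +
  fixes K :: "'a \<Rightarrow> 'b \<Rightarrow> real" and b :: real
  assumes measurable_K: "case_prod K \<in> borel_measurable (P \<Otimes>\<^sub>M Q)"
    and b_pos: "0 < b" and K_ge: "b \<le> K x y" and K_le: "K x y \<le> 1 / b"

lemma (in kernel) flip: "kernel Q P (\<lambda>y x. K x y) b"
proof -
  have [measurable]: "case_prod K \<in> borel_measurable (P \<Otimes>\<^sub>M Q)" by (rule measurable_K)
  show ?thesis
    by unfold_locales (use b_pos K_ge K_le in \<open>auto simp: split_beta'\<close>)
qed

context kernel
begin

lemma b_le_1: "b \<le> 1"
proof -
  have "b \<le> 1 / b" using K_ge K_le by (rule order_trans)
  then have "\<not> 1 < b" using divide_less_eq_1_pos[OF b_pos, of 1] by linarith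
  then show ?thesis by simp
qed

lemma K_ratio: "b\<^sup>2 * K x y \<le> K x' y'"
proof -
  have "b\<^sup>2 * K x y \<le> b\<^sup>2 * (1/b)" using K_le by (intro mult_left_mono) auto
  also have "\<dots> = b" by (simp add: power2_eq_square)
  finally show ?thesis using K_ge[of x' y'] by simp
qed

lemma K_pos: "0 < K x y"
  using K_ge b_pos by (meson order.strict_trans2)

lemma measurable_K_compose [measurable (raw)]:
  assumes "f \<in> measurable N P" "g \<in> measurable N Q"
  shows "(\<lambda>z. K (f z) (g z)) \<in> borel_measurable N"
  using measurable_compose[OF measurable_Pair[OF assms] measurable_K] by simp

lemma bdd_pos_K: "y \<in> space Q \<Longrightarrow> bdd_pos P (\<lambda>x. K x y)"
  using b_pos K_ge K_le by (intro bdd_posI[of _ _ b "1/b"]) auto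

lemma integral_K_pos: "y \<in> space Q \<Longrightarrow> bdd_pos P u \<Longrightarrow> 0 < (\<integral>x. K x y * u x \<partial>P)"
  by (intro P.bdd_pos_integral_pos bdd_pos_mult bdd_pos_K)

lemma half_step_pos: "y \<in> space Q \<Longrightarrow> bdd_pos P u \<Longrightarrow> 0 < half_step P K u y"
  using integral_K_pos by (auto simp: half_step_def)

lemma half_step_eq:
  "y \<in> space Q \<Longrightarrow> bdd_pos P u \<Longrightarrow> (\<integral>x. K x y * u x \<partial>P) * half_step P K u y = 1"
  using integral_K_pos[of y u] by (auto simp: half_step_def)

lemma measurable_half_step:
  assumes [measurable]: "u \<in> borel_measurable P"
  shows "half_step P K u \<in> borel_measurable Q"
  unfolding half_step_def by measurable

lemma half_step_bounds:
  assumes u: "bdd_pos P u" and y: "y \<in> space Q"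
    and "0 < l" "\<And>x. x \<in> space P \<Longrightarrow> l \<le> u x" "\<And>x. x \<in> space P \<Longrightarrow> u x \<le> h"
  shows "b / h \<le> half_step P K u y" "half_step P K u y \<le> 1 / (b * l)"
proof -
  have [measurable]: "u \<in> borel_measurable P" using u by (rule bdd_pos_measurable)
  have lh: "0 < h" using assms(3-5) P.not_empty by fastforce
  have "b * l \<le> K x y * u x" "K x y * u x \<le> h / b" if "x \<in> space P" for x
    using mult_mono[OF K_ge[of x y] assms(4)[OF that]] mult_mono[OF K_le[of x y] assms(5)[OF that]] b_pos \<open>0<l\<close>
      K_pos[of x y] assms(4)[OF that] by simp_all
  then have "b * l \<le> (\<integral>x. K x y * u x \<partial>P)" "(\<integral>x. K x y * u x \<partial>P) \<le> h / b"
    using y by (intro P.integral_bounds[where l="b * l" and h="h/b"]; measurable)+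
  moreover have "0 < b * l" using b_pos \<open>0 < l\<close> by simp
  ultimately show "b / h \<le> half_step P K u y" "half_step P K u y \<le> 1 / (b * l)"
    using frac_le[of 1 1 "\<integral>x. K x y * u x \<partial>P" "h/b"] frac_le[of 1 1 "b*l"] unfolding half_step_def
    by simp_all
qed

lemma bdd_pos_half_step:
  assumes u: "bdd_pos P u"
  shows "bdd_pos Q (half_step P K u)"
proof -
  obtain l h where lh: "l > 0" "\<And>x. x \<in> space P \<Longrightarrow> l \<le> u x" "\<And>x. x \<in> space P \<Longrightarrow> u x \<le> h"
    using assms unfolding bdd_pos_def by blast
  moreover have "0 < h" using lh P.not_empty by fastforce
  ultimately show ?thesis
    using b_pos half_step_bounds[OF u _ lh] measurable_half_step bdd_pos_measurable[OF u]
    by (intro bdd_posI[of _ _ "b/h" "1/(b*l)"]) auto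
qed

text \<open>Holds whatever \<open>u\<close> is: any two kernel values differ by a factor of at most
  \<open>1 / b^2\<close>, and this survives integration. It provides the uniform bounds on the
  iterates and the start of the contraction.\<close>

lemma half_step_ratio:
  assumes u: "bdd_pos P u" and y: "y \<in> space Q" "y' \<in> space Q"
  shows "b\<^sup>2 * half_step P K u y \<le> half_step P K u y'"
proof -
  have "(\<integral>x. b\<^sup>2 * (K x y' * u x) \<partial>P) \<le> (\<integral>x. K x y * u x \<partial>P)"
  proof (rule integral_mono)
    show "b\<^sup>2 * (K x y' * u x) \<le> K x y * u x" if "x \<in> space P" for x
      using mult_right_mono[OF K_ratio[of x y' x y] less_imp_le[OF bdd_pos_pos[OF u that]]]
      by (simp add: mult.assoc)
  qed (auto intro!: P.bdd_pos_integrable bdd_pos_mult bdd_pos_K u y)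
  then have "b\<^sup>2 * (\<integral>x. K x y' * u x \<partial>P) \<le> (\<integral>x. K x y * u x \<partial>P)" by simp
  then show ?thesis
    using integral_K_pos[OF y(1) u] integral_K_pos[OF y(2) u] by (simp add: half_step_def field_simps)
qed

text \<open>Reciprocals exchange the two points, so the contraction for averages applies with the
  kernel sections at \<open>y'\<close> and \<open>y\<close>.\<close>

lemma half_step_contraction:
  assumes u: "bdd_pos P u" "bdd_pos P u'" and r: "ratio_le (space P) \<tau> u u'"
  shows "ratio_le (space Q) (b^4 + (1 - b^4) * \<tau>) (half_step P K u) (half_step P K u')"
  unfolding ratio_le_def
proof (intro ballI)
  fix y y' assume y: "y \<in> space Q" "y' \<in> space Q"
  have *: "(\<integral>x. K x y' * u' x \<partial>P) * (\<integral>x. K x y * u x \<partial>P)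
     \<le> (b^4 + (1 - b^4) * \<tau>) * ((\<integral>x. K x y * u' x \<partial>P) * (\<integral>x. K x y' * u x \<partial>P))"
    using y r by (intro P.average_ratio_contraction b_pos K_ge K_le u) (auto simp: ratio_le_def)
  have frac: "(1 / a) * (1 / d) \<le> t * ((1 / a') * (1 / d'))"
    if "a' * d' \<le> t * (a * d)" "0 < a" "0 < d" "0 < a'" "0 < d'" for a d a' d' t :: real
    using that by (simp add: field_simps)
  show "half_step P K u' y * half_step P K u y' \<le> (b^4 + (1 - b^4) * \<tau>) * (half_step P K u' y' * half_step P K u y)"
    unfolding half_step_def
    by (rule frac[OF *]) (intro integral_K_pos y u)+
qed

lemma half_step_limit:
  assumes u: "\<And>k. bdd_pos P (u k)" and lh: "0 < l" "\<And>k x. x \<in> space P \<Longrightarrow> l \<le> u k x"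
    "\<And>k x. x \<in> space P \<Longrightarrow> u k x \<le> h"
    and U: "bdd_pos P U"
    and lim: "\<And>x. x \<in> space P \<Longrightarrow> (\<lambda>k. u k x) \<longlonglongrightarrow> U x" and y: "y \<in> space Q"
  shows "(\<lambda>k. half_step P K (u k) y) \<longlonglongrightarrow> half_step P K U y"
  unfolding half_step_def
proof (intro tendsto_intros)
  have [measurable]: "U \<in> borel_measurable P" "\<And>k. u k \<in> borel_measurable P"
    using U u by (auto intro: bdd_pos_measurable)
  show "(\<lambda>k. \<integral>x. K x y * u k x \<partial>P) \<longlonglongrightarrow> (\<integral>x. K x y * U x \<partial>P)"
  proof (rule integral_dominated_convergence[where w="\<lambda>x. 1 / b * h"])
    show "AE x in P. norm (K x y * u k x) \<le> 1 / b * h" for k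
    proof (rule AE_I2)
      fix x assume "x \<in> space P"
      then show "norm (K x y * u k x) \<le> 1 / b * h"
        unfolding real_norm_def abs_mult
        using lh(2,3)[of x k] lh(1) b_pos K_pos[of x y] K_le[of x y] by (intro mult_mono) auto
    qed
  qed (use y lim in \<open>auto intro!: tendsto_intros\<close>)
  show "(\<integral>x. K x y * U x \<partial>P) \<noteq> 0"
    using integral_K_pos[OF y U] by simp
qed

end

section \<open>Convergence of the Sinkhorn iterates and the Schroedinger system\<close>

context kernel
begin

text \<open>The value at \<open>x0\<close> is 1 and a half step has oscillation at most
  \<open>1 / b^2\<close>, so the bounds do not deteriorate with \<open>k\<close>. They later give
  the bound \<open>2 * M\<close> on the first potential.\<close>

lemma bdd_pos_sinkhorn_aux:
  assumes x0: "x0 \<in> space P"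
  shows "bdd_pos P (sinkhorn P Q K x0 k) \<and>
    (\<forall>x\<in>space P. b\<^sup>2 \<le> sinkhorn P Q K x0 k x \<and> sinkhorn P Q K x0 k x \<le> 1 / b\<^sup>2)"
proof (induction k)
  case 0
  have "b\<^sup>2 \<le> 1" using b_le_1 b_pos by (simp add: power_le_one)
  then show ?case using b_pos by (auto intro!: bdd_posI[of _ _ 1 1])
next
  case (Suc k)
  interpret T: kernel Q P "\<lambda>y x. K x y" b by (rule flip)
  define w where "w = half_step Q (\<lambda>y x. K x y) (half_step P K (sinkhorn P Q K x0 k))"
  have V: "bdd_pos Q (half_step P K (sinkhorn P Q K x0 k))"
    using Suc bdd_pos_half_step by simp
  have w: "bdd_pos P w" unfolding w_def by (rule T.bdd_pos_half_step[OF V])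
  have w0: "0 < w x0" using bdd_pos_pos[OF w x0] .
  have "b\<^sup>2 * w x0 \<le> w x" "b\<^sup>2 * w x \<le> w x0" if "x \<in> space P" for x
    unfolding w_def using T.half_step_ratio[OF V] x0 that by auto
  then have "b\<^sup>2 \<le> w x / w x0 \<and> w x / w x0 \<le> 1 / b\<^sup>2" if "x \<in> space P" for x
    using that b_pos w0 by (simp add: field_simps)
  then show ?case
    using bdd_pos_divide[OF w w0] by (simp add: w_def Let_def)
qed

lemma bdd_pos_sinkhorn: "x0 \<in> space P \<Longrightarrow> bdd_pos P (sinkhorn P Q K x0 k)"
  using bdd_pos_sinkhorn_aux by blast

lemma sinkhorn_bounds:
  assumes "x0 \<in> space P" "x \<in> space P"
  shows "b\<^sup>2 \<le> sinkhorn P Q K x0 k x" "sinkhorn P Q K x0 k x \<le> 1 / b\<^sup>2"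
  using bdd_pos_sinkhorn_aux assms by blast+

text \<open>The map sending \<tau> to \<open>b^4 + (1 - b^4) * \<tau>\<close> fixes 1 and shrinks
  the excess over 1 by \<open>1 - b^4\<close>; a full iteration applies it twice. The iteration
  starts from the constant 1, so the first ratio is just the oscillation of the next
  iterate.\<close>

lemma sinkhorn_ratio:
  assumes x0: "x0 \<in> space P"
  shows "ratio_le (space P) (1 + ((1 - b^4)\<^sup>2)^k * (1 / b\<^sup>2 - 1))
    (sinkhorn P Q K x0 k) (sinkhorn P Q K x0 (Suc k))"
proof (induction k)
  case 0
  have "sinkhorn P Q K x0 1 x \<le> 1 / b\<^sup>2 * sinkhorn P Q K x0 1 x'"
    if "x \<in> space P" "x' \<in> space P" for x x'
  proof -
    interpret T: kernel Q P "\<lambda>y x. K x y" b by (rule flip)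
    define w where "w = half_step Q (\<lambda>y x. K x y) (half_step P K (sinkhorn P Q K x0 0))"
    have V: "bdd_pos Q (half_step P K (sinkhorn P Q K x0 0))"
      by (intro bdd_pos_half_step bdd_pos_sinkhorn x0)
    have "b\<^sup>2 * w x \<le> w x'" unfolding w_def using T.half_step_ratio[OF V that] .
    moreover have "0 < w x0"
      unfolding w_def by (rule T.half_step_pos[OF x0 V])
    moreover have *: "sinkhorn P Q K x0 1 z = w z / w x0" for z by (simp add: w_def Let_def)
    ultimately show ?thesis unfolding * using b_pos by (simp add: field_simps)
  qed
  then show ?case by (simp add: ratio_le_def del: sinkhorn.simps(2))
next
  case (Suc k)
  interpret T: kernel Q P "\<lambda>y x. K x y" b by (rule flip)
  define w where "w k = half_step Q (\<lambda>y x. K x y) (half_step P K (sinkhorn P Q K x0 k))" for k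
  define \<tau> where "\<tau> = 1 + ((1 - b^4)\<^sup>2)^k * (1 / b\<^sup>2 - 1)"
  have V: "bdd_pos Q (half_step P K (sinkhorn P Q K x0 k))" for k
    by (intro bdd_pos_half_step bdd_pos_sinkhorn x0)
  have *: "b^4 + (1 - b^4) * (b^4 + (1 - b^4) * \<tau>) = 1 + ((1 - b^4)\<^sup>2)^(Suc k) * (1 / b\<^sup>2 - 1)"
  proof -
    have "b^4 + (1 - b^4) * (b^4 + (1 - b^4) * (1 + e)) = 1 + (1 - b^4)\<^sup>2 * e" for e
      by (simp add: algebra_simps power2_eq_square)
    then show ?thesis by (simp only: \<tau>_def power_Suc mult.assoc)
  qed
  have "ratio_le (space P) (b^4 + (1 - b^4) * (b^4 + (1 - b^4) * \<tau>)) (w k) (w (Suc k))"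
    unfolding w_def
    by (intro T.half_step_contraction half_step_contraction V bdd_pos_sinkhorn x0 Suc[folded \<tau>_def])
  then have r: "ratio_le (space P) (1 + ((1 - b^4)\<^sup>2)^(Suc k) * (1 / b\<^sup>2 - 1)) (w k) (w (Suc k))"
    unfolding * .
  have w0: "0 < w k x0" for k unfolding w_def by (rule T.half_step_pos[OF x0 V])
  have "ratio_le (space P) t (\<lambda>x. w k x / c) (\<lambda>x. w (Suc k) x / c')"
    if "ratio_le (space P) t (w k) (w (Suc k))" "0 < c" "0 < c'" for t c c'
    using that by (auto simp: ratio_le_def field_simps)
  from this[OF r w0[of k] w0[of "Suc k"]] show ?case
    unfolding w_def sinkhorn.simps Let_def .
qed

text \<open>Both iterates equal 1 at \<open>x0\<close>, so the ratio bound between \<open>x\<close>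
  and \<open>x0\<close> compares their values at \<open>x\<close> in both directions; the uniform
  bound \<open>1 / b^2\<close> turns the relative error into an absolute one.\<close>

lemma sinkhorn_step:
  assumes x0: "x0 \<in> space P" and x: "x \<in> space P"
  shows "\<bar>sinkhorn P Q K x0 (Suc k) x - sinkhorn P Q K x0 k x\<bar>
    \<le> ((1 - b^4)\<^sup>2)^k * (1 / b\<^sup>2 - 1) * (1 / b\<^sup>2)"
proof -
  define e where "e = ((1 - b^4)\<^sup>2)^k * (1 / b\<^sup>2 - 1)"
  have "b\<^sup>2 \<le> 1" using b_le_1 b_pos by (simp add: power_le_one)
  then have e: "0 \<le> e" using b_pos by (auto simp: e_def intro!: mult_nonneg_nonneg)
  have norm1: "sinkhorn P Q K x0 k x0 = 1" for k
  proof (cases k)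
    case (Suc j)
    interpret T: kernel Q P "\<lambda>y x. K x y" b by (rule flip)
    have "0 < half_step Q (\<lambda>y x. K x y) (half_step P K (sinkhorn P Q K x0 j)) x0"
      by (intro T.half_step_pos bdd_pos_half_step bdd_pos_sinkhorn x0)
    then show ?thesis by (simp add: Suc Let_def)
  qed simp
  let ?u = "sinkhorn P Q K x0 k x" and ?u' = "sinkhorn P Q K x0 (Suc k) x"
  have "?u' \<le> (1 + e) * ?u" "?u \<le> (1 + e) * ?u'"
    using sinkhorn_ratio[OF x0, of k] x x0 norm1[of k] norm1[of "Suc k"]
    unfolding ratio_le_def e_def[symmetric]
    by (metis mult.left_neutral mult.right_neutral)+
  moreover have "e * ?u \<le> e * (1 / b\<^sup>2)" "e * ?u' \<le> e * (1 / b\<^sup>2)"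
    using e by (intro mult_left_mono sinkhorn_bounds x0 x; simp)+
  ultimately show ?thesis unfolding e_def[symmetric] by (simp add: algebra_simps abs_le_iff)
qed

lemma sinkhorn_converges:
  assumes x0: "x0 \<in> space P" and x: "x \<in> space P"
  shows "convergent (\<lambda>k. sinkhorn P Q K x0 k x)"
proof -
  have b4: "0 < b^4" "b^4 \<le> 1" using b_pos b_le_1 by (auto intro: power_le_one)
  have "(1 - b^4)\<^sup>2 < 1" using b4 by (simp add: power_less_one_iff)
  then have "summable (\<lambda>k. ((1 - b^4)\<^sup>2)^k * ((1 / b\<^sup>2 - 1) * (1 / b\<^sup>2)))"
    by (intro summable_mult2 summable_geometric) simp
  then have "summable (\<lambda>k. sinkhorn P Q K x0 (Suc k) x - sinkhorn P Q K x0 k x)"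
    by (rule summable_comparison_test')
      (use sinkhorn_step[OF x0 x] in \<open>simp add: mult.assoc del: sinkhorn.simps\<close>)
  then show ?thesis
    unfolding summable_iff_convergent
      sum_lessThan_telescope[where f="\<lambda>k. sinkhorn P Q K x0 k x"]
    by (simp add: convergent_diff_const_right_iff)
qed

definition potential_u :: "'a \<Rightarrow> 'a \<Rightarrow> real" where
  "potential_u x0 x = lim (\<lambda>k. sinkhorn P Q K x0 k x)"

lemma sinkhorn_tendsto:
  assumes "x0 \<in> space P" "x \<in> space P"
  shows "(\<lambda>k. sinkhorn P Q K x0 k x) \<longlonglongrightarrow> potential_u x0 x"
  unfolding potential_u_def using sinkhorn_converges[OF assms] by (simp add: convergent_LIMSEQ_iff)

lemma potential_u_bounds:
  assumes "x0 \<in> space P" "x \<in> space P"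
  shows "b\<^sup>2 \<le> potential_u x0 x" "potential_u x0 x \<le> 1 / b\<^sup>2"
  using sinkhorn_tendsto[OF assms] sinkhorn_bounds[OF assms]
  by (auto intro: LIMSEQ_le_const LIMSEQ_le_const2)

lemma measurable_potential_u:
  assumes x0: "x0 \<in> space P"
  shows "potential_u x0 \<in> borel_measurable P"
  by (rule borel_measurable_LIMSEQ_real[OF sinkhorn_tendsto[OF x0]])
     (auto intro: bdd_pos_measurable bdd_pos_sinkhorn x0)

lemma bdd_pos_potential_u: "x0 \<in> space P \<Longrightarrow> bdd_pos P (potential_u x0)"
  using b_pos by (intro bdd_posI[of _ _ "b\<^sup>2" "1/b\<^sup>2"] measurable_potential_u potential_u_bounds) auto

definition potential_v :: "'a \<Rightarrow> 'b \<Rightarrow> real" where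
  "potential_v x0 = half_step P K (potential_u x0)"

lemma bdd_pos_potential_v: "x0 \<in> space P \<Longrightarrow> bdd_pos Q (potential_v x0)"
  unfolding potential_v_def by (intro bdd_pos_half_step bdd_pos_potential_u)

lemma measurable_potential_v: "x0 \<in> space P \<Longrightarrow> potential_v x0 \<in> borel_measurable Q"
  by (intro bdd_pos_measurable bdd_pos_potential_v)

text \<open>The half step from \<open>u\<close> to \<open>v\<close> costs one more factor
  \<open>b\<close> than the bounds on \<open>u\<close>, which is why the second potential is bounded
  by \<open>3 * M\<close> and not by \<open>2 * M\<close>.\<close>

lemma potential_v_bounds:
  assumes "x0 \<in> space P" "y \<in> space Q"
  shows "b ^ 3 \<le> potential_v x0 y" "potential_v x0 y \<le> 1 / b ^ 3"
  using half_step_bounds[OF bdd_pos_potential_u[OF assms(1)] assms(2) _ potential_u_bounds[OF assms(1)]] b_pos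
  by (simp_all add: potential_v_def power2_eq_square power3_eq_cube)

lemma integral_potential_left:
  assumes "x0 \<in> space P" "y \<in> space Q"
  shows "(\<integral>x. K x y * potential_u x0 x \<partial>P) * potential_v x0 y = 1"
  unfolding potential_v_def by (intro half_step_eq bdd_pos_potential_u assms)

text \<open>The limit is a fixed point up to a scalar; the scalar is 1 because both marginal conditions
  compute the total mass of \<open>u K v\<close>.\<close>

lemma integral_potential_right:
  assumes x0: "x0 \<in> space P" and x: "x \<in> space P"
  shows "(\<integral>y. K x y * potential_v x0 y \<partial>Q) * potential_u x0 x = 1"
proof -
  interpret T: kernel Q P "\<lambda>y x. K x y" b by (rule flip)
  interpret PQ: pair_prob_space P Q ..
  let ?u = "sinkhorn P Q K x0" and ?U = "potential_u x0" and ?V = "potential_v x0"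
  define w where "w = half_step Q (\<lambda>y x. K x y) ?V"
  have V_lim: "(\<lambda>k. half_step P K (?u k) y) \<longlonglongrightarrow> ?V y" if "y \<in> space Q" for y
    unfolding potential_v_def using b_pos that
    by (intro half_step_limit[where l="b\<^sup>2" and h="1/b\<^sup>2"] bdd_pos_sinkhorn bdd_pos_potential_u
        sinkhorn_bounds sinkhorn_tendsto x0) auto
  have V_bounds: "b / (1 / b\<^sup>2) \<le> half_step P K (?u k) y \<and> half_step P K (?u k) y \<le> 1 / (b * b\<^sup>2)"
    if "y \<in> space Q" for k y
    using b_pos half_step_bounds[OF bdd_pos_sinkhorn[OF x0] that _ sinkhorn_bounds[OF x0]] by auto
  have w_lim: "(\<lambda>k. half_step Q (\<lambda>y x. K x y) (half_step P K (?u k)) z) \<longlonglongrightarrow> w z" if "z \<in> space P" for z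
    unfolding w_def using b_pos that V_bounds
    by (intro T.half_step_limit[where l="b / (1 / b\<^sup>2)" and h="1 / (b * b\<^sup>2)"] V_lim
        bdd_pos_half_step bdd_pos_sinkhorn bdd_pos_potential_v x0) auto
  have w_pos: "0 < w z" if "z \<in> space P" for z
    unfolding w_def by (intro T.half_step_pos bdd_pos_potential_v x0 that)
  \<comment> \<open>The recursion divides by the value at \<open>x0\<close>, so its limit solves the
    fixed point equation only up to the constant \<open>w x0\<close>.\<close>
  have U_eq: "?U z * w x0 = w z" if z: "z \<in> space P" for z
  proof -
    have "(\<lambda>k. ?u (Suc k) z) \<longlonglongrightarrow> w z / w x0"
      unfolding sinkhorn.simps Let_def using w_pos[OF x0]
      by (intro tendsto_divide w_lim z x0) simp
    moreover have "(\<lambda>k. ?u (Suc k) z) \<longlonglongrightarrow> ?U z"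
      by (rule LIMSEQ_Suc[OF sinkhorn_tendsto[OF x0 z]])
    ultimately have "?U z = w z / w x0" by (metis LIMSEQ_unique)
    then show ?thesis using w_pos[OF x0] by simp
  qed
  have right: "(\<integral>y. K z y * ?V y \<partial>Q) * ?U z = 1 / w x0" if z: "z \<in> space P" for z
  proof -
    have "(\<integral>y. K z y * ?V y \<partial>Q) * (?U z * w x0) = 1"
      unfolding U_eq[OF z] unfolding w_def by (intro T.half_step_eq bdd_pos_potential_v x0 z)
    then show ?thesis using w_pos[OF x0] by (simp add: field_simps)
  qed
  have [measurable]: "?U \<in> borel_measurable P" "?V \<in> borel_measurable Q"
    by (intro measurable_potential_u measurable_potential_v x0)+
  have "integrable (P \<Otimes>\<^sub>M Q) (\<lambda>(x, y). K x y * ?U x * ?V y)"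
  proof (rule PQ.integrable_bounded)
    fix z assume "z \<in> space (P \<Otimes>\<^sub>M Q)"
    then obtain x y where z: "z = (x, y)" "x \<in> space P" "y \<in> space Q" by (auto simp: space_pair_measure)
    have "0 < ?U x" "0 < ?V y"
      using z by (auto intro: bdd_pos_pos bdd_pos_potential_u bdd_pos_potential_v x0)
    then show "\<bar>case z of (x, y) \<Rightarrow> K x y * ?U x * ?V y\<bar> \<le> 1 / b * (1 / b\<^sup>2) * (1 / b^3)"
      using z K_pos[of x y] K_le[of x y] potential_u_bounds(2)[OF x0 z(2)] potential_v_bounds(2)[OF x0 z(3)] b_pos
      unfolding z(1) prod.case abs_mult by (intro mult_mono) auto
  qed measurable
  then have "(\<integral>y. (\<integral>x. K x y * ?U x * ?V y \<partial>P) \<partial>Q) = (\<integral>x. (\<integral>y. K x y * ?U x * ?V y \<partial>Q) \<partial>P)"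
    by (rule PQ.Fubini_integral)
  moreover have "(\<integral>y. (\<integral>x. K x y * ?U x * ?V y \<partial>P) \<partial>Q) = (\<integral>y. 1 \<partial>Q)"
    by (intro Bochner_Integration.integral_cong) (use integral_potential_left[OF x0] in auto)
  moreover have "(\<integral>x. (\<integral>y. K x y * ?U x * ?V y \<partial>Q) \<partial>P) = (\<integral>x. 1 / w x0 \<partial>P)"
  proof (intro Bochner_Integration.integral_cong refl)
    fix z assume "z \<in> space P"
    have "(\<lambda>y. K z y * ?U z * ?V y) = (\<lambda>y. (K z y * ?V y) * ?U z)" by auto
    then show "(\<integral>y. K z y * ?U z * ?V y \<partial>Q) = 1 / w x0" using right[OF \<open>z \<in> space P\<close>] by simp
  qed
  ultimately have "w x0 = 1" using w_pos[OF x0] by (simp add: P.prob_space Q.prob_space)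
  then show ?thesis using right[OF x] by simp
qed

end

section \<open>Entropic duality\<close>

text \<open>The Fenchel-Young inequality for \<open>h * ln h - h\<close>, whose convex conjugate is
  \<open>exp\<close>.\<close>

lemma xlnx_ge_young:
  fixes h a :: real
  assumes "0 \<le> h"
  shows "h * a - exp a + h \<le> h * ln h"
proof (cases "h = 0")
  case False
  then have h: "0 < h" using assms by simp
  have "a - ln h = ln (exp a / h)" using h by (simp add: ln_div)
  also have "\<dots> \<le> exp a / h - 1" using h by (intro ln_le_minus_one) simp
  finally have "h * (a - ln h) \<le> h * (exp a / h - 1)" using h by (intro mult_left_mono) auto
  then show ?thesis using h by (simp add: algebra_simps)
qed simp

text \<open>A coupling that is absolutely continuous does not see the exceptional null set; any
  other coupling has infinite value for either cost, since \<epsilon> is positive.\<close>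

lemma entropic_OT_cong_AE:
  assumes [measurable]: "case_prod c \<in> borel_measurable (P \<Otimes>\<^sub>M Q)" "case_prod c' \<in> borel_measurable (P \<Otimes>\<^sub>M Q)"
    and eq: "AE z in P \<Otimes>\<^sub>M Q. case_prod c z = case_prod c' z" and eps: "\<epsilon> > 0"
  shows "entropic_OT c \<epsilon> P Q = entropic_OT c' \<epsilon> P Q"
  unfolding entropic_OT_def
proof (rule INF_cong[OF refl])
  fix \<pi> assume "\<pi> \<in> couplings P Q"
  then have sets [measurable_cong]: "sets \<pi> = sets (P \<Otimes>\<^sub>M Q)" by (simp add: couplings_def)
  show "ereal (\<integral>(x, y). c x y \<partial>\<pi>) + ereal \<epsilon> * KL \<pi> (P \<Otimes>\<^sub>M Q)
      = ereal (\<integral>(x, y). c' x y \<partial>\<pi>) + ereal \<epsilon> * KL \<pi> (P \<Otimes>\<^sub>M Q)"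
  proof (cases "absolutely_continuous (P \<Otimes>\<^sub>M Q) \<pi>")
    case True
    have "AE z in \<pi>. case_prod c z = case_prod c' z"
      by (rule absolutely_continuous_AE[OF sets True eq])
    then have "(\<integral>(x, y). c x y \<partial>\<pi>) = (\<integral>(x, y). c' x y \<partial>\<pi>)"
      by (intro integral_cong_AE) auto
    then show ?thesis by simp
  qed (use eps in \<open>simp add: KL_def\<close>)
qed

text \<open>The cost bound is required at every pair of points, null sets included, so that the
  kernel bounds hold pointwise and the same cost can be used with empirical measures.\<close>

locale entropic_problem = P: prob_space P + Q: prob_space Q
  for P :: "'a measure" and Q :: "'b measure" +
  fixes c :: "'a \<Rightarrow> 'b \<Rightarrow> real" and M \<epsilon> :: real
  assumes measurable_c: "case_prod c \<in> borel_measurable (P \<Otimes>\<^sub>M Q)"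
    and c_le: "\<bar>c x y\<bar> \<le> M" and eps_pos: "0 < \<epsilon>"
begin

sublocale PQ: pair_prob_space P Q ..

definition gibbs :: "('a \<Rightarrow> real) \<Rightarrow> ('b \<Rightarrow> real) \<Rightarrow> 'a \<Rightarrow> 'b \<Rightarrow> real" where
  "gibbs f g x y = exp ((f x + g y - c x y) / \<epsilon>)"

lemma measurable_c_compose [measurable (raw)]:
  assumes "f \<in> measurable N P" "g \<in> measurable N Q"
  shows "(\<lambda>z. c (f z) (g z)) \<in> borel_measurable N"
  using measurable_compose[OF measurable_Pair[OF assms] measurable_c] by simp

lemma measurable_gibbs:
  assumes [measurable]: "f \<in> borel_measurable P" "g \<in> borel_measurable Q"
  shows "case_prod (gibbs f g) \<in> borel_measurable (P \<Otimes>\<^sub>M Q)"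
  unfolding gibbs_def by measurable

lemma gibbs_le:
  assumes "\<bar>f x\<bar> \<le> A" "\<bar>g y\<bar> \<le> B"
  shows "gibbs f g x y \<le> exp ((A + B + M) / \<epsilon>)"
  unfolding gibbs_def using assms c_le[of x y] eps_pos by (auto simp: divide_simps)

lemma coupling_integral:
  assumes pi: "\<pi> \<in> couplings P Q"
    and [measurable]: "f \<in> borel_measurable P" "g \<in> borel_measurable Q"
    and A: "\<And>x. x \<in> space P \<Longrightarrow> \<bar>f x\<bar> \<le> A" and B: "\<And>y. y \<in> space Q \<Longrightarrow> \<bar>g y\<bar> \<le> B"
  shows "prob_space \<pi>" "integrable \<pi> (\<lambda>(x, y). (f x + g y - c x y) / \<epsilon>)"
    "(\<integral>(x, y). (f x + g y - c x y) / \<epsilon> \<partial>\<pi>) =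
      ((\<integral>x. f x \<partial>P) + (\<integral>y. g y \<partial>Q) - (\<integral>(x, y). c x y \<partial>\<pi>)) / \<epsilon>"
proof -
  have sets [measurable_cong]: "sets \<pi> = sets (P \<Otimes>\<^sub>M Q)"
    and fst: "distr \<pi> P fst = P" and snd: "distr \<pi> Q snd = Q"
    using pi by (auto simp: couplings_def)
  have sp: "space \<pi> = space P \<times> space Q" using sets_eq_imp_space_eq[OF sets] by (simp add: space_pair_measure)
  show "prob_space \<pi>"
    by (rule prob_space_distrD[of fst \<pi> P]) (auto simp: fst P.prob_space_axioms)
  then interpret \<pi>: prob_space \<pi> .
  have 1: "integrable \<pi> (\<lambda>z. f (fst z))"
    by (rule \<pi>.integrable_bounded[of _ A]) (auto simp: sp A)
  have 2: "integrable \<pi> (\<lambda>z. g (snd z))"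
    by (rule \<pi>.integrable_bounded[of _ B]) (auto simp: sp B)
  have 3: "integrable \<pi> (\<lambda>z. c (fst z) (snd z))"
    by (rule \<pi>.integrable_bounded[of _ M]) (auto simp: c_le)
  have i1: "(\<integral>z. f (fst z) \<partial>\<pi>) = (\<integral>x. f x \<partial>P)"
    using integral_distr[of fst \<pi> P f] by (simp add: fst)
  have i2: "(\<integral>z. g (snd z) \<partial>\<pi>) = (\<integral>x. g x \<partial>Q)"
    using integral_distr[of snd \<pi> Q g] by (simp add: snd)
  show "integrable \<pi> (\<lambda>(x, y). (f x + g y - c x y) / \<epsilon>)"
    using 1 2 3 by (simp add: split_beta')
  show "(\<integral>(x, y). (f x + g y - c x y) / \<epsilon> \<partial>\<pi>) =
      ((\<integral>x. f x \<partial>P) + (\<integral>y. g y \<partial>Q) - (\<integral>(x, y). c x y \<partial>\<pi>)) / \<epsilon>"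
    using 1 2 3 i1 i2 by (simp add: split_beta')
qed

text \<open>Weak duality: Fenchel-Young is applied pointwise to the density \<open>h\<close> of
  \<pi> and to \<open>a = (f + g - c) / \<epsilon>\<close>, then integrated. The marginals of \<pi>
  split the integral of \<open>f + g\<close>, and the total mass 1 of \<open>h\<close> produces the
  \<open>- 1\<close>. Only couplings of finite divergence matter.\<close>

lemma entropic_OT_ge_dual:
  assumes [measurable]: "f \<in> borel_measurable P" "g \<in> borel_measurable Q"
    and A: "\<And>x. x \<in> space P \<Longrightarrow> \<bar>f x\<bar> \<le> A" and B: "\<And>y. y \<in> space Q \<Longrightarrow> \<bar>g y\<bar> \<le> B"
  shows "ereal ((\<integral>x. f x \<partial>P) + (\<integral>y. g y \<partial>Q) - \<epsilon> * ((\<integral>(x, y). gibbs f g x y \<partial>(P \<Otimes>\<^sub>M Q)) - 1))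
    \<le> entropic_OT c \<epsilon> P Q"
  unfolding entropic_OT_def
proof (rule INF_greatest)
  let ?R = "P \<Otimes>\<^sub>M Q"
  fix \<pi> assume pi: "\<pi> \<in> couplings P Q"
  then have sets [measurable_cong]: "sets \<pi> = sets ?R" by (auto simp: couplings_def)
  note ci = coupling_integral[OF pi assms]
  interpret \<pi>: prob_space \<pi> by (rule ci(1))
  show "ereal ((\<integral>x. f x \<partial>P) + (\<integral>y. g y \<partial>Q) - \<epsilon> * ((\<integral>(x, y). gibbs f g x y \<partial>?R) - 1))
    \<le> ereal (\<integral>(x, y). c x y \<partial>\<pi>) + ereal \<epsilon> * KL \<pi> ?R"
  proof (cases "absolutely_continuous ?R \<pi> \<and> integrable \<pi> (entropy_density (exp 1) ?R \<pi>)")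
    case True
    define h where "h z = enn2real (RN_deriv ?R \<pi> z)" for z
    define a where "a z = (case z of (x, y) \<Rightarrow> (f x + g y - c x y) / \<epsilon>)" for z
    have [measurable]: "h \<in> borel_measurable ?R" "a \<in> borel_measurable ?R"
      unfolding h_def a_def by measurable
    have ent: "entropy_density (exp 1) ?R \<pi> = (\<lambda>z. ln (h z))"
      by (auto simp: entropy_density_def h_def log_def)
    note rn = PQ.RN_deriv_integrable[OF \<pi>.sigma_finite_measure_axioms conjunct1[OF True] sets, folded h_def]
      PQ.RN_deriv_integral[OF \<pi>.sigma_finite_measure_axioms conjunct1[OF True] sets, folded h_def]
    have ia: "integrable \<pi> a" using ci(2) by (simp add: a_def[abs_def])
    have ih: "integrable ?R h" using rn(1)[of "\<lambda>_. 1"] by simp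
    have h1: "(\<integral>z. h z \<partial>?R) = 1" using rn(2)[of "\<lambda>_. 1"] by (simp add: \<pi>.prob_space)
    have iexp: "integrable ?R (\<lambda>z. exp (a z))"
    proof (rule PQ.integrable_bounded)
      fix z assume "z \<in> space ?R"
      then show "\<bar>exp (a z)\<bar> \<le> exp ((A + B + M) / \<epsilon>)"
        using gibbs_le[OF A B] by (auto simp: space_pair_measure a_def gibbs_def)
    qed measurable
    have "(\<integral>z. h z * a z - exp (a z) + h z \<partial>?R) \<le> (\<integral>z. h z * ln (h z) \<partial>?R)"
    proof (rule integral_mono)
      show "integrable ?R (\<lambda>z. h z * a z - exp (a z) + h z)"
        using rn(1)[of a] ia ih iexp by simp
      show "integrable ?R (\<lambda>z. h z * ln (h z))"
        using rn(1)[of "\<lambda>z. ln (h z)"] True by (simp add: ent)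
      show "h z * a z - exp (a z) + h z \<le> h z * ln (h z)" for z
        by (rule xlnx_ge_young) (simp add: h_def)
    qed
    also have "(\<integral>z. h z * a z - exp (a z) + h z \<partial>?R) = (\<integral>z. a z \<partial>\<pi>) - (\<integral>z. exp (a z) \<partial>?R) + 1"
      using rn(1)[of a] rn(2)[of a] ia ih iexp h1 by simp
    also have "(\<integral>z. h z * ln (h z) \<partial>?R) = KL_divergence (exp 1) ?R \<pi>"
      unfolding KL_divergence_def ent using rn(2)[of "\<lambda>z. ln (h z)"] by simp
    finally have "\<epsilon> * ((\<integral>z. a z \<partial>\<pi>) - (\<integral>z. exp (a z) \<partial>?R) + 1) \<le> \<epsilon> * KL_divergence (exp 1) ?R \<pi>"
      using eps_pos by simp
    moreover have "\<epsilon> * (\<integral>z. a z \<partial>\<pi>) = (\<integral>x. f x \<partial>P) + (\<integral>y. g y \<partial>Q) - (\<integral>(x, y). c x y \<partial>\<pi>)"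
      using ci(3) eps_pos by (simp add: a_def)
    moreover have "(\<integral>z. exp (a z) \<partial>?R) = (\<integral>(x, y). gibbs f g x y \<partial>?R)"
      by (simp add: a_def gibbs_def split_beta')
    ultimately show ?thesis
      using True by (simp add: KL_def algebra_simps)
  next
    case False
    then have "KL \<pi> ?R = \<infinity>" by (auto simp: KL_def)
    then show ?thesis using eps_pos by simp
  qed
qed

text \<open>Strong duality: the marginal equations make \<open>gibbs f g\<close> the density of a
  coupling whose log-density is exactly \<open>(f + g - c) / \<epsilon>\<close>. In its primal value
  the cost cancels, which gives the upper bound; in weak duality the penalty vanishes because the
  mass is 1, which gives the lower bound.\<close>

lemma entropic_OT_eq_dual:
  assumes [measurable]: "f \<in> borel_measurable P" "g \<in> borel_measurable Q"
    and A: "\<And>x. x \<in> space P \<Longrightarrow> \<bar>f x\<bar> \<le> A" and B: "\<And>y. y \<in> space Q \<Longrightarrow> \<bar>g y\<bar> \<le> B"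
    and left: "\<And>y. y \<in> space Q \<Longrightarrow> (\<integral>x. gibbs f g x y \<partial>P) = 1"
    and right: "\<And>x. x \<in> space P \<Longrightarrow> (\<integral>y. gibbs f g x y \<partial>Q) = 1"
  shows "entropic_OT c \<epsilon> P Q = ereal ((\<integral>x. f x \<partial>P) + (\<integral>y. g y \<partial>Q))"
proof (rule antisym)
  let ?R = "P \<Otimes>\<^sub>M Q"
  define p where "p = gibbs f g"
  have [measurable]: "case_prod p \<in> borel_measurable ?R"
    unfolding p_def by (rule measurable_gibbs) measurable
  have p_pos: "0 < p x y" for x y by (simp add: p_def gibbs_def)
  have p_le: "p x y \<le> exp ((A + B + M) / \<epsilon>)" if "x \<in> space P" "y \<in> space Q" for x y
    unfolding p_def by (intro gibbs_le A B that)
  have [measurable]: "(\<lambda>x. p x y) \<in> borel_measurable P" if "y \<in> space Q" for y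
    using that by measurable
  have [measurable]: "p x \<in> borel_measurable Q" if "x \<in> space P" for x
    using that by measurable
  have L: "(\<integral>\<^sup>+x. ennreal (p x y) \<partial>P) = 1" if "y \<in> space Q" for y
  proof (subst nn_integral_eq_integral)
    show "integrable P (\<lambda>x. p x y)"
      using that p_le p_pos by (intro P.integrable_bounded[where B="exp ((A + B + M) / \<epsilon>)"]) (auto simp: abs_of_pos)
  qed (use that left p_pos in \<open>auto simp: p_def less_imp_le\<close>)
  have R: "(\<integral>\<^sup>+y. ennreal (p x y) \<partial>Q) = 1" if "x \<in> space P" for x
  proof (subst nn_integral_eq_integral)
    show "integrable Q (p x)"
      using that p_le p_pos by (intro Q.integrable_bounded[where B="exp ((A + B + M) / \<epsilon>)"]) (auto simp: abs_of_pos)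
  qed (use that right p_pos in \<open>auto simp: p_def less_imp_le\<close>)
  define \<pi> where "\<pi> = density ?R (\<lambda>(x, y). ennreal (p x y))"
  have sets [measurable_cong]: "sets \<pi> = sets ?R" by (simp add: \<pi>_def)
  have "distr \<pi> P fst = P"
  proof (rule measure_eqI)
    fix X assume X: "X \<in> sets (distr \<pi> P fst)"
    then have [measurable]: "X \<in> sets P" by simp
    have "emeasure (distr \<pi> P fst) X = (\<integral>\<^sup>+z. (case z of (x, y) \<Rightarrow> ennreal (p x y)) * indicator (fst -` X \<inter> space \<pi>) z \<partial>?R)"
      by (subst emeasure_distr) (auto simp: \<pi>_def emeasure_density)
    also have "\<dots> = (\<integral>\<^sup>+z. ennreal (p (fst z) (snd z)) * indicator X (fst z) \<partial>?R)"
      by (intro nn_integral_cong) (auto simp: \<pi>_def split: split_indicator)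
    also have "\<dots> = (\<integral>\<^sup>+x. \<integral>\<^sup>+y. ennreal (p x y) * indicator X x \<partial>Q \<partial>P)"
      by (subst Q.nn_integral_fst[symmetric]) auto
    also have "\<dots> = (\<integral>\<^sup>+x. indicator X x \<partial>P)"
      by (intro nn_integral_cong) (simp add: nn_integral_multc R)
    finally show "emeasure (distr \<pi> P fst) X = emeasure P X" by simp
  qed simp
  moreover have "distr \<pi> Q snd = Q"
  proof (rule measure_eqI)
    fix X assume X: "X \<in> sets (distr \<pi> Q snd)"
    then have [measurable]: "X \<in> sets Q" by simp
    have "emeasure (distr \<pi> Q snd) X = (\<integral>\<^sup>+z. (case z of (x, y) \<Rightarrow> ennreal (p x y)) * indicator (snd -` X \<inter> space \<pi>) z \<partial>?R)"
      by (subst emeasure_distr) (auto simp: \<pi>_def emeasure_density)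
    also have "\<dots> = (\<integral>\<^sup>+z. ennreal (p (fst z) (snd z)) * indicator X (snd z) \<partial>?R)"
      by (intro nn_integral_cong) (auto simp: \<pi>_def split: split_indicator)
    also have "\<dots> = (\<integral>\<^sup>+y. \<integral>\<^sup>+x. ennreal (p x y) * indicator X y \<partial>P \<partial>Q)"
      by (subst PQ.nn_integral_snd[symmetric]) auto
    also have "\<dots> = (\<integral>\<^sup>+x. indicator X x \<partial>Q)"
      by (intro nn_integral_cong) (simp add: nn_integral_multc L)
    finally show "emeasure (distr \<pi> Q snd) X = emeasure Q X" by simp
  qed simp
  ultimately have pi: "\<pi> \<in> couplings P Q" by (simp add: couplings_def sets)
  note ci = coupling_integral[OF pi assms(1-4)]
  interpret \<pi>: prob_space \<pi> by (rule ci(1))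
  have ac: "absolutely_continuous ?R \<pi>"
    unfolding \<pi>_def by (rule absolutely_continuousI_density) measurable
  \<comment> \<open>The divergence is defined through the Radon-Nikodym derivative, fixed only up to
    null sets. Uniqueness identifies it with the explicit density, and absolute continuity carries
    this over to \<pi>.\<close>
  have "AE z in ?R. (case z of (x, y) \<Rightarrow> ennreal (p x y)) = RN_deriv ?R \<pi> z"
    by (rule PQ.RN_deriv_unique) (auto simp: \<pi>_def)
  then have "AE z in \<pi>. (case z of (x, y) \<Rightarrow> ennreal (p x y)) = RN_deriv ?R \<pi> z"
    by (rule absolutely_continuous_AE[OF sets ac])
  then have ent: "AE z in \<pi>. (case z of (x, y) \<Rightarrow> (f x + g y - c x y) / \<epsilon>) = entropy_density (exp 1) ?R \<pi> z"
  proof eventually_elim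
    case (elim z)
    show ?case unfolding entropy_density_def comp_def elim[symmetric]
      by (auto simp: log_def p_def gibbs_def split: prod.split)
  qed
  have "integrable \<pi> (entropy_density (exp 1) ?R \<pi>)"
    by (subst integrable_cong_AE[symmetric, OF _ _ ent]) (use ci(2) in measurable)
  moreover have "KL_divergence (exp 1) ?R \<pi> = (\<integral>(x, y). (f x + g y - c x y) / \<epsilon> \<partial>\<pi>)"
    unfolding KL_divergence_def
    by (subst integral_cong_AE[OF _ _ ent]) measurable
  ultimately have KL: "KL \<pi> ?R = ereal ((\<integral>(x, y). (f x + g y - c x y) / \<epsilon> \<partial>\<pi>))"
    using ac by (simp add: KL_def)
  have "entropic_OT c \<epsilon> P Q \<le> ereal (\<integral>(x, y). c x y \<partial>\<pi>) + ereal \<epsilon> * KL \<pi> ?R"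
    unfolding entropic_OT_def by (rule INF_lower[OF pi])
  also have "\<dots> = ereal ((\<integral>x. f x \<partial>P) + (\<integral>y. g y \<partial>Q))"
    using eps_pos ci(3) unfolding KL by simp
  finally show "entropic_OT c \<epsilon> P Q \<le> ereal ((\<integral>x. f x \<partial>P) + (\<integral>y. g y \<partial>Q))" .
  have "(\<integral>(x, y). gibbs f g x y \<partial>?R) = 1"
  proof -
    have "integrable ?R (\<lambda>(x, y). p x y)"
      using p_le p_pos by (intro PQ.integrable_bounded[where B="exp ((A + B + M) / \<epsilon>)"])
        (auto simp: space_pair_measure abs_of_pos)
    then have "(\<integral>(x, y). p x y \<partial>?R) = (\<integral>x. (\<integral>y. p x y \<partial>Q) \<partial>P)"
      by (subst PQ.integral_fst) auto
    also have "\<dots> = (\<integral>x. 1 \<partial>P)"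
      by (intro Bochner_Integration.integral_cong) (use right in \<open>auto simp: p_def\<close>)
    finally show ?thesis by (simp add: p_def P.prob_space)
  qed
  then show "ereal ((\<integral>x. f x \<partial>P) + (\<integral>y. g y \<partial>Q)) \<le> entropic_OT c \<epsilon> P Q"
    using entropic_OT_ge_dual[OF assms(1-4)] by simp
qed

sublocale kernel P Q "\<lambda>x y. exp (- c x y / \<epsilon>)" "exp (- M / \<epsilon>)"
proof unfold_locales
  show "(\<lambda>(x, y). exp (- c x y / \<epsilon>)) \<in> borel_measurable (P \<Otimes>\<^sub>M Q)" by measurable
  show "exp (- M / \<epsilon>) \<le> exp (- c x y / \<epsilon>)" "exp (- c x y / \<epsilon>) \<le> 1 / exp (- M / \<epsilon>)" for x y
    using c_le[of x y] eps_pos by (auto simp: divide_simps abs_le_iff simp flip: exp_add)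
qed simp

definition potential_f :: "'a \<Rightarrow> 'a \<Rightarrow> real" where
  "potential_f x0 x = \<epsilon> * ln (potential_u x0 x)"

definition potential_g :: "'a \<Rightarrow> 'b \<Rightarrow> real" where
  "potential_g x0 y = \<epsilon> * ln (potential_v x0 y)"

text \<open>Here \<epsilon> cancels: the kernel bound is exponential in
  \<open>M / \<epsilon>\<close>, and \<open>\<epsilon> * ln\<close> reads off the exponent. Hence
  the potentials are bounded independently of \<epsilon>.\<close>

lemma abs_eps_ln_le:
  assumes "exp (- M / \<epsilon>) ^ k \<le> z" "z \<le> 1 / exp (- M / \<epsilon>) ^ k"
  shows "\<bar>\<epsilon> * ln z\<bar> \<le> real k * M"
proof -
  have z: "0 < z" using assms(1) by (rule order.strict_trans2[rotated]) simp
  have e: "exp (- M / \<epsilon>) ^ k = exp (- (real k * M) / \<epsilon>)"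
    by (simp add: exp_of_nat_mult[symmetric])
  have "- (real k * M) / \<epsilon> \<le> ln z" using assms(1) unfolding e ln_ge_iff[OF z] .
  moreover have "ln z \<le> (real k * M) / \<epsilon>"
    using ln_mono[OF assms(2) z] unfolding e by (simp add: ln_div)
  ultimately show ?thesis using eps_pos by (simp add: abs_le_iff field_simps)
qed

context
  fixes x0 assumes x0: "x0 \<in> space P"
begin

lemma measurable_potentials [measurable]:
  "potential_f x0 \<in> borel_measurable P" "potential_g x0 \<in> borel_measurable Q"
  using measurable_potential_u[OF x0] measurable_potential_v[OF x0]
  unfolding potential_f_def potential_g_def by measurable

lemma potential_f_bound: "x \<in> space P \<Longrightarrow> \<bar>potential_f x0 x\<bar> \<le> 2 * M"
  unfolding potential_f_def using abs_eps_ln_le[of 2] potential_u_bounds[OF x0] by simp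

lemma potential_g_bound: "y \<in> space Q \<Longrightarrow> \<bar>potential_g x0 y\<bar> \<le> 3 * M"
  unfolding potential_g_def using abs_eps_ln_le[of 3] potential_v_bounds[OF x0] by simp

lemma gibbs_potentials:
  assumes "x \<in> space P" "y \<in> space Q"
  shows "gibbs (potential_f x0) (potential_g x0) x y = exp (- c x y / \<epsilon>) * potential_u x0 x * potential_v x0 y"
proof -
  have pos: "0 < potential_u x0 x" "0 < potential_v x0 y"
    using bdd_pos_pos[OF bdd_pos_potential_u[OF x0]] bdd_pos_pos[OF bdd_pos_potential_v[OF x0]] assms by auto
  have "(\<epsilon> * a + \<epsilon> * a' - r) / \<epsilon> = - r / \<epsilon> + a + a'" for a a' r
    using eps_pos by (simp add: field_simps)
  then show ?thesis
    using pos by (simp only: gibbs_def potential_f_def potential_g_def exp_add exp_ln)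
qed

lemma gibbs_potentials_marginals:
  "y \<in> space Q \<Longrightarrow> (\<integral>x. gibbs (potential_f x0) (potential_g x0) x y \<partial>P) = 1"
  "x \<in> space P \<Longrightarrow> (\<integral>y. gibbs (potential_f x0) (potential_g x0) x y \<partial>Q) = 1"
proof -
  assume y: "y \<in> space Q"
  have "(\<integral>x. gibbs (potential_f x0) (potential_g x0) x y \<partial>P)
      = (\<integral>x. (exp (- c x y / \<epsilon>) * potential_u x0 x) * potential_v x0 y \<partial>P)"
    by (intro Bochner_Integration.integral_cong refl gibbs_potentials y)
  then show "(\<integral>x. gibbs (potential_f x0) (potential_g x0) x y \<partial>P) = 1"
    using integral_potential_left[OF x0 y] by simp
next
  assume x: "x \<in> space P"
  have "(\<integral>y. gibbs (potential_f x0) (potential_g x0) x y \<partial>Q)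
      = (\<integral>y. (exp (- c x y / \<epsilon>) * potential_v x0 y) * potential_u x0 x \<partial>Q)"
    by (intro Bochner_Integration.integral_cong refl) (simp add: gibbs_potentials x)
  then show "(\<integral>y. gibbs (potential_f x0) (potential_g x0) x y \<partial>Q) = 1"
    using integral_potential_right[OF x0 x] by simp
qed

lemma entropic_OT_eq_potentials:
  "entropic_OT c \<epsilon> P Q = ereal ((\<integral>x. potential_f x0 x \<partial>P) + (\<integral>y. potential_g x0 y \<partial>Q))"
  by (intro entropic_OT_eq_dual[where A="2 * M" and B="3 * M"] potential_f_bound potential_g_bound
      gibbs_potentials_marginals measurable_potentials)

end

end

section \<open>Stability of the value at approximate potentials\<close>

context entropic_problem
begin

text \<open>The potentials \<open>f\<close>, \<open>g\<close> need not be optimal for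
  \<open>P\<close>, \<open>Q\<close>; in use they are optimal for the population, while
  \<open>P\<close>, \<open>Q\<close> are empirical. The coefficients \<open>4 * M\<close> and
  \<open>6 * M\<close> bound the distance to the optimal potentials, twice \<open>2 * M\<close> and
  twice \<open>3 * M\<close>; the extra \<epsilon> pays for the total mass of
  \<open>gibbs f g\<close> differing from 1.\<close>

lemma entropic_OT_stability:
  assumes f [measurable]: "f \<in> borel_measurable P" and g [measurable]: "g \<in> borel_measurable Q"
    and A: "\<And>x. x \<in> space P \<Longrightarrow> \<bar>f x\<bar> \<le> 2 * M" and B: "\<And>y. y \<in> space Q \<Longrightarrow> \<bar>g y\<bar> \<le> 3 * M"
  obtains S where "entropic_OT c \<epsilon> P Q = ereal S"
    "\<bar>S - ((\<integral>x. f x \<partial>P) + (\<integral>y. g y \<partial>Q))\<bar>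
      \<le> (4 * M + \<epsilon>) * (\<integral>x. \<bar>(\<integral>y. gibbs f g x y \<partial>Q) - 1\<bar> \<partial>P)
        + 6 * M * (\<integral>y. \<bar>(\<integral>x. gibbs f g x y \<partial>P) - 1\<bar> \<partial>Q)"
proof -
  obtain x0 where x0: "x0 \<in> space P" using P.not_empty by auto
  let ?R = "P \<Otimes>\<^sub>M Q"
  define f' g' where "f' = potential_f x0" and "g' = potential_g x0"
  define p p' where "p = gibbs f g" and "p' = gibbs f' g'"
  define H where "H = exp ((2 * M + 3 * M + M) / \<epsilon>)"
  have [measurable]: "f' \<in> borel_measurable P" "g' \<in> borel_measurable Q"
    unfolding f'_def g'_def by (intro measurable_potentials x0)+
  have A': "\<bar>f' x\<bar> \<le> 2 * M" if "x \<in> space P" for x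
    unfolding f'_def by (intro potential_f_bound x0 that)
  have B': "\<bar>g' y\<bar> \<le> 3 * M" if "y \<in> space Q" for y
    unfolding g'_def by (intro potential_g_bound x0 that)
  have M: "0 \<le> M" using c_le[of undefined undefined] by simp
  have pp [measurable]: "case_prod p \<in> borel_measurable ?R" "case_prod p' \<in> borel_measurable ?R"
    unfolding p_def p'_def by (intro measurable_gibbs; measurable)+
  have [measurable (raw)]: "(\<lambda>z. p (F z) (G z)) \<in> borel_measurable N" "(\<lambda>z. p' (F z) (G z)) \<in> borel_measurable N"
    if "F \<in> measurable N P" "G \<in> measurable N Q" for F G and N :: "'d measure"
    using measurable_compose[OF measurable_Pair[OF that] pp(1)] measurable_compose[OF measurable_Pair[OF that] pp(2)]
    by simp_all
  have nn: "0 \<le> p x y" "0 \<le> p' x y" for x y by (auto simp: p_def p'_def gibbs_def)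
  have pH: "p x y \<le> H" "p' x y \<le> H" if "x \<in> space P" "y \<in> space Q" for x y
    unfolding p_def p'_def H_def by (intro gibbs_le A B A' B' that)+
  have iR: "integrable ?R h" if [measurable]: "h \<in> borel_measurable ?R"
    and "\<And>x y. x \<in> space P \<Longrightarrow> y \<in> space Q \<Longrightarrow> \<bar>h (x, y)\<bar> \<le> w" for h :: "'a \<times> 'b \<Rightarrow> real" and w
    using that by (intro PQ.integrable_bounded[where B=w]) (auto simp: space_pair_measure)
  have ip: "integrable ?R (\<lambda>(x, y). p x y)" "integrable ?R (\<lambda>(x, y). p' x y)"
    using nn pH by (auto intro!: iR[of _ H])
  define a where "a x = (\<integral>y. p x y \<partial>Q)" for x
  define b where "b y = (\<integral>x. p x y \<partial>P)" for y
  have [measurable]: "a \<in> borel_measurable P" "b \<in> borel_measurable Q"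
    unfolding a_def b_def by measurable
  have aH: "0 \<le> a x" "a x \<le> H" if "x \<in> space P" for x
    unfolding a_def using nn pH that by (auto intro!: Q.integral_bounds(2)[where l=0])
  have bH: "0 \<le> b x" "b x \<le> H" if "x \<in> space Q" for x
    unfolding b_def using nn pH that by (auto intro!: P.integral_bounds(2)[where l=0])
  have mass: "(\<integral>(x, y). p x y \<partial>?R) = (\<integral>x. a x \<partial>P)"
    unfolding a_def using PQ.integral_fst[OF ip(1)] by simp
  have mass': "(\<integral>(x, y). p' x y \<partial>?R) = 1"
  proof -
    have "(\<integral>(x, y). p' x y \<partial>?R) = (\<integral>x. (\<integral>y. p' x y \<partial>Q) \<partial>P)"
      using PQ.integral_fst[OF ip(2)] by simp
    also have "\<dots> = (\<integral>x. 1 \<partial>P)"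
      by (intro Bochner_Integration.integral_cong) (use gibbs_potentials_marginals(2)[OF x0] in \<open>auto simp: p'_def f'_def g'_def\<close>)
    finally show ?thesis by (simp add: P.prob_space)
  qed
  have ia: "integrable P a" "integrable P (\<lambda>x. \<bar>a x - 1\<bar>)" "integrable Q (\<lambda>y. \<bar>b y - 1\<bar>)"
  proof -
    have "\<bar>a x\<bar> \<le> H" "\<bar>\<bar>a x - 1\<bar>\<bar> \<le> H + 1" if "x \<in> space P" for x using aH[OF that] by auto
    then show "integrable P a" "integrable P (\<lambda>x. \<bar>a x - 1\<bar>)"
      by (intro P.integrable_bounded[where B=H] P.integrable_bounded[where B="H + 1"]; simp)+
    have "\<bar>\<bar>b x - 1\<bar>\<bar> \<le> H + 1" if "x \<in> space Q" for x using bH[OF that] by auto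
    then show "integrable Q (\<lambda>y. \<bar>b y - 1\<bar>)"
      by (intro Q.integrable_bounded[where B="H + 1"]; simp)
  qed
  have ifs: "integrable P f" "integrable P f'" "integrable Q g" "integrable Q g'"
    using A B A' B' by (auto intro!: P.integrable_bounded[where B="2 * M"] Q.integrable_bounded[where B="3 * M"])
  define S where "S = (\<integral>x. f' x \<partial>P) + (\<integral>y. g' y \<partial>Q)"
  define I where "I = (\<integral>x. f x \<partial>P) + (\<integral>y. g y \<partial>Q)"
  define Ea where "Ea = (\<integral>x. \<bar>a x - 1\<bar> \<partial>P)"
  define Eb where "Eb = (\<integral>y. \<bar>b y - 1\<bar> \<partial>Q)"
  have S: "entropic_OT c \<epsilon> P Q = ereal S"
    unfolding S_def f'_def g'_def by (rule entropic_OT_eq_potentials[OF x0])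
  have Ea: "\<bar>(\<integral>x. a x \<partial>P) - 1\<bar> \<le> Ea"
  proof -
    have "\<bar>(\<integral>x. a x - 1 \<partial>P)\<bar> \<le> Ea"
      unfolding Ea_def by (rule integral_abs_bound)
    then show ?thesis using ia by (simp add: P.prob_space)
  qed
  have "ereal (I - \<epsilon> * ((\<integral>x. a x \<partial>P) - 1)) \<le> ereal S"
    using entropic_OT_ge_dual[OF f g A B] unfolding S mass[symmetric] by (simp add: I_def p_def)
  then have lower: "I - \<epsilon> * ((\<integral>x. a x \<partial>P) - 1) \<le> S" by simp
  text \<open>Upper bound: the dual objective at the optimal potentials lies below its tangent at \<open>(f, g)\<close>.\<close>
  have i2: "integrable ?R (\<lambda>(x, y). p x y * (f' x - f x))" "integrable ?R (\<lambda>(x, y). p x y * (g' y - g y))"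
  proof -
    have "\<bar>p x y * (f' x - f x)\<bar> \<le> H * (4 * M)" if "x \<in> space P" "y \<in> space Q" for x y
      unfolding abs_mult using pH[OF that] nn[of x y] A[OF that(1)] A'[OF that(1)] by (intro mult_mono) auto
    then show "integrable ?R (\<lambda>(x, y). p x y * (f' x - f x))" by (intro iR[of _ "H * (4 * M)"]) auto
    have "\<bar>p x y * (g' y - g y)\<bar> \<le> H * (6 * M)" if "x \<in> space P" "y \<in> space Q" for x y
      unfolding abs_mult using pH[OF that] nn[of x y] B[OF that(2)] B'[OF that(2)] by (intro mult_mono) auto
    then show "integrable ?R (\<lambda>(x, y). p x y * (g' y - g y))" by (intro iR[of _ "H * (6 * M)"]) auto
  qed
  \<comment> \<open>This is \<open>1 + t \<le> exp t\<close> at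
    \<open>t = (f' - f + g' - g) / \<epsilon>\<close>, multiplied by
    \<open>\<epsilon> * p\<close>.\<close>
  have "\<epsilon> * p x y + p x y * (f' x - f x) + p x y * (g' y - g y) \<le> \<epsilon> * p' x y" for x y
  proof -
    have p': "p' x y = p x y * exp ((f' x - f x + (g' y - g y)) / \<epsilon>)"
      unfolding p_def p'_def gibbs_def by (simp add: exp_add[symmetric] add_divide_distrib[symmetric])
    have "p x y * (1 + (f' x - f x + (g' y - g y)) / \<epsilon>) \<le> p' x y"
      unfolding p' by (intro mult_left_mono exp_ge_add_one_self nn)
    then have "\<epsilon> * (p x y * (1 + (f' x - f x + (g' y - g y)) / \<epsilon>)) \<le> \<epsilon> * p' x y"
      using eps_pos by simp
    moreover have "\<epsilon> * (r * (1 + (t + t') / \<epsilon>)) = \<epsilon> * r + r * t + r * t'" for r t t'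
      using eps_pos by (simp add: field_simps)
    ultimately show ?thesis by simp
  qed
  then have "(\<integral>(x, y). \<epsilon> * p x y + p x y * (f' x - f x) + p x y * (g' y - g y) \<partial>?R) \<le> (\<integral>(x, y). \<epsilon> * p' x y \<partial>?R)"
    using ip i2 by (intro integral_mono) (auto simp: split_beta')
  also have "(\<integral>(x, y). \<epsilon> * p' x y \<partial>?R) = \<epsilon>" using mass' by (simp add: split_beta')
  also have "(\<integral>(x, y). \<epsilon> * p x y + p x y * (f' x - f x) + p x y * (g' y - g y) \<partial>?R)
      = \<epsilon> * (\<integral>x. a x \<partial>P) + (\<integral>(x, y). p x y * (f' x - f x) \<partial>?R) + (\<integral>(x, y). p x y * (g' y - g y) \<partial>?R)"
    using ip i2 mass by (simp add: split_beta')
  also have "(\<integral>(x, y). p x y * (f' x - f x) \<partial>?R) = (\<integral>x. a x * (f' x - f x) \<partial>P)"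
    using PQ.integral_fst[OF i2(1)] by (simp add: a_def)
  also have "(\<integral>(x, y). p x y * (g' y - g y) \<partial>?R) = (\<integral>y. b y * (g' y - g y) \<partial>Q)"
    using PQ.integral_snd[OF i2(2)] by (simp add: b_def)
  finally have tangent: "\<epsilon> * (\<integral>x. a x \<partial>P) + (\<integral>x. a x * (f' x - f x) \<partial>P) + (\<integral>y. b y * (g' y - g y) \<partial>Q) \<le> \<epsilon>" .
  \<comment> \<open>Next, the marginal error \<open>1 - a\<close> is paired with
    \<open>f' - f\<close>, whose absolute value is at most \<open>4 * M\<close>.\<close>
  have "integrable P (\<lambda>x. a x * (f' x - f x))"
  proof (rule P.integrable_bounded[where B="H * (4 * M)"])
    show "\<bar>a x * (f' x - f x)\<bar> \<le> H * (4 * M)" if "x \<in> space P" for x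
      unfolding abs_mult using aH[OF that] A[OF that] A'[OF that] by (intro mult_mono) auto
  qed measurable
  then have "(\<integral>x. f' x \<partial>P) - (\<integral>x. f x \<partial>P) - (\<integral>x. a x * (f' x - f x) \<partial>P) = (\<integral>x. (f' x - f x) - a x * (f' x - f x) \<partial>P)"
    using ifs by simp
  also have "\<dots> \<le> (\<integral>x. 4 * M * \<bar>a x - 1\<bar> \<partial>P)"
  proof (rule integral_mono)
    show "integrable P (\<lambda>x. (f' x - f x) - a x * (f' x - f x))" using ifs \<open>integrable P (\<lambda>x. a x * (f' x - f x))\<close> by simp
    show "(f' x - f x) - a x * (f' x - f x) \<le> 4 * M * \<bar>a x - 1\<bar>" if x: "x \<in> space P" for x
    proof -
      have "(f' x - f x) - a x * (f' x - f x) = (f' x - f x) * (1 - a x)" by (simp add: algebra_simps)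
      also have "\<dots> \<le> \<bar>f' x - f x\<bar> * \<bar>a x - 1\<bar>" by (metis abs_ge_self abs_minus_commute abs_mult)
      also have "\<dots> \<le> 4 * M * \<bar>a x - 1\<bar>" using A[OF x] A'[OF x] by (intro mult_right_mono) auto
      finally show ?thesis .
    qed
  qed (use ia in auto)
  also have "\<dots> = 4 * M * Ea" by (simp add: Ea_def)
  finally have 1: "(\<integral>x. f' x \<partial>P) - (\<integral>x. f x \<partial>P) - (\<integral>x. a x * (f' x - f x) \<partial>P) \<le> 4 * M * Ea" .
  have "integrable Q (\<lambda>x. b x * (g' x - g x))"
  proof (rule Q.integrable_bounded[where B="H * (6 * M)"])
    show "\<bar>b x * (g' x - g x)\<bar> \<le> H * (6 * M)" if "x \<in> space Q" for x
      unfolding abs_mult using bH[OF that] B[OF that] B'[OF that] by (intro mult_mono) auto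
  qed measurable
  then have "(\<integral>x. g' x \<partial>Q) - (\<integral>x. g x \<partial>Q) - (\<integral>x. b x * (g' x - g x) \<partial>Q) = (\<integral>x. (g' x - g x) - b x * (g' x - g x) \<partial>Q)"
    using ifs by simp
  also have "\<dots> \<le> (\<integral>x. 6 * M * \<bar>b x - 1\<bar> \<partial>Q)"
  proof (rule integral_mono)
    show "integrable Q (\<lambda>x. (g' x - g x) - b x * (g' x - g x))" using ifs \<open>integrable Q (\<lambda>x. b x * (g' x - g x))\<close> by simp
    show "(g' x - g x) - b x * (g' x - g x) \<le> 6 * M * \<bar>b x - 1\<bar>" if x: "x \<in> space Q" for x
    proof -
      have "(g' x - g x) - b x * (g' x - g x) = (g' x - g x) * (1 - b x)" by (simp add: algebra_simps)
      also have "\<dots> \<le> \<bar>g' x - g x\<bar> * \<bar>b x - 1\<bar>" by (metis abs_ge_self abs_minus_commute abs_mult)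
      also have "\<dots> \<le> 6 * M * \<bar>b x - 1\<bar>" using B[OF x] B'[OF x] by (intro mult_right_mono) auto
      finally show ?thesis .
    qed
  qed (use ia in auto)
  also have "\<dots> = 6 * M * Eb" by (simp add: Eb_def)
  finally have 2: "(\<integral>x. g' x \<partial>Q) - (\<integral>x. g x \<partial>Q) - (\<integral>x. b x * (g' x - g x) \<partial>Q) \<le> 6 * M * Eb" .
  have eEa: "\<epsilon> * \<bar>(\<integral>x. a x \<partial>P) - 1\<bar> \<le> \<epsilon> * Ea" using Ea eps_pos by simp
  have "0 \<le> Ea" "0 \<le> Eb" by (simp_all add: Ea_def Eb_def)
  then have nn': "0 \<le> M * Ea" "0 \<le> M * Eb" using M by auto
  have "\<epsilon> * ((\<integral>x. a x \<partial>P) - 1) \<le> \<epsilon> * \<bar>(\<integral>x. a x \<partial>P) - 1\<bar>" "- (\<epsilon> * ((\<integral>x. a x \<partial>P) - 1)) \<le> \<epsilon> * \<bar>(\<integral>x. a x \<partial>P) - 1\<bar>"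
    using mult_left_mono[OF abs_ge_self less_imp_le[OF eps_pos]] mult_left_mono[OF abs_ge_minus_self less_imp_le[OF eps_pos]]
    by simp_all
  then have "\<bar>S - I\<bar> \<le> (4 * M + \<epsilon>) * Ea + 6 * M * Eb"
    using lower tangent 1 2 eEa nn' unfolding S_def I_def abs_le_iff by (simp add: algebra_simps)
  then show thesis
    using that[OF S] by (simp add: I_def Ea_def Eb_def a_def b_def p_def)
qed

end

section \<open>Regularity of the potentials inherited from the cost\<close>

context kernel
begin

text \<open>The marginal equation writes \<open>u\<close> as the reciprocal of an average of the
  kernel, so \<open>u\<close> varies in \<open>x\<close> no more than the kernel does. The
  comparison is integrated over \<open>y\<close>, hence almost every \<open>y\<close>
  suffices.\<close>

lemma potential_u_le:
  assumes x0: "x0 \<in> space P" and x: "x \<in> space P" "x' \<in> space P"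
    and K: "AE y in Q. K x' y \<le> \<kappa> * K x y"
  shows "potential_u x0 x \<le> \<kappa> * potential_u x0 x'"
proof -
  interpret T: kernel Q P "\<lambda>y x. K x y" b by (rule flip)
  let ?I = "\<lambda>x. \<integral>y. K x y * potential_v x0 y \<partial>Q"
  note bp = bdd_pos_mult[OF T.bdd_pos_K bdd_pos_potential_v[OF x0]]
  have int: "integrable Q (\<lambda>y. K z y * potential_v x0 y)" if "z \<in> space P" for z
    using bp[OF that] by (rule Q.bdd_pos_integrable)
  have pos: "0 < ?I z" if "z \<in> space P" for z using bp[OF that] by (rule Q.bdd_pos_integral_pos)
  have "?I x' \<le> (\<integral>y. \<kappa> * (K x y * potential_v x0 y) \<partial>Q)"
  proof (rule integral_mono_AE)
    show "AE y in Q. K x' y * potential_v x0 y \<le> \<kappa> * (K x y * potential_v x0 y)"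
      using K AE_space
    proof eventually_elim
      case (elim y)
      then show ?case
        using mult_right_mono[OF elim(1) less_imp_le[OF bdd_pos_pos[OF bdd_pos_potential_v[OF x0] elim(2)]]]
        by (simp add: mult.assoc)
    qed
  qed (use int x in auto)
  then have "?I x' \<le> \<kappa> * ?I x" by simp
  moreover have "potential_u x0 z = 1 / ?I z" if "z \<in> space P" for z
    using integral_potential_right[OF x0 that] pos[OF that] by (simp add: field_simps)
  ultimately show ?thesis using pos x by (simp add: field_simps)
qed

lemma potential_v_le:
  assumes x0: "x0 \<in> space P" and y: "y \<in> space Q" "y' \<in> space Q"
    and K: "AE x in P. K x y' \<le> \<kappa> * K x y"
  shows "potential_v x0 y \<le> \<kappa> * potential_v x0 y'"
proof -
  let ?I = "\<lambda>y. \<integral>x. K x y * potential_u x0 x \<partial>P"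
  note bp = bdd_pos_mult[OF bdd_pos_K bdd_pos_potential_u[OF x0]]
  have int: "integrable P (\<lambda>x. K x z * potential_u x0 x)" if "z \<in> space Q" for z
    using bp[OF that] by (rule P.bdd_pos_integrable)
  have pos: "0 < ?I z" if "z \<in> space Q" for z using bp[OF that] by (rule P.bdd_pos_integral_pos)
  have "?I y' \<le> (\<integral>x. \<kappa> * (K x y * potential_u x0 x) \<partial>P)"
  proof (rule integral_mono_AE)
    show "AE x in P. K x y' * potential_u x0 x \<le> \<kappa> * (K x y * potential_u x0 x)"
      using K AE_space
    proof eventually_elim
      case (elim x)
      then show ?case
        using mult_right_mono[OF elim(1) less_imp_le[OF bdd_pos_pos[OF bdd_pos_potential_u[OF x0] elim(2)]]]
        by (simp add: mult.assoc)
    qed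
  qed (use int y in auto)
  then have "?I y' \<le> \<kappa> * ?I y" by simp
  then show ?thesis using pos y by (simp add: potential_v_def half_step_def field_simps)
qed

end

context entropic_problem
begin

lemma exp_cost_le:
  assumes "\<bar>c x y - c x' y'\<bar> \<le> \<delta>"
  shows "exp (- c x' y' / \<epsilon>) \<le> exp (\<delta> / \<epsilon>) * exp (- c x y / \<epsilon>)"
  using assms eps_pos by (simp add: exp_add[symmetric] divide_simps abs_le_iff)

text \<open>One factor \<open>exp (\<delta> / \<epsilon>)\<close> comes from the kernel, another
  from \<open>u\<close>; \<open>v\<close> stays the same because \<open>y\<close> does. The
  potential needs the cost comparison at almost every second point, the kernel only at the given
  \<open>y\<close>.\<close>

lemma gibbs_potentials_le_left:
  assumes x0: "x0 \<in> space P" and xy: "x \<in> space P" "x' \<in> space P" "y \<in> space Q"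
    and c: "AE y in Q. \<bar>c x y - c x' y\<bar> \<le> \<delta>" and cy: "\<bar>c x y - c x' y\<bar> \<le> \<delta>"
  shows "gibbs (potential_f x0) (potential_g x0) x y
    \<le> exp (2 * \<delta> / \<epsilon>) * gibbs (potential_f x0) (potential_g x0) x' y"
proof -
  have u: "potential_u x0 x \<le> exp (\<delta> / \<epsilon>) * potential_u x0 x'"
    by (intro potential_u_le x0 xy eventually_mono[OF c exp_cost_le])
  have k: "exp (- c x y / \<epsilon>) \<le> exp (\<delta> / \<epsilon>) * exp (- c x' y / \<epsilon>)"
    using cy by (intro exp_cost_le) (simp add: abs_minus_commute)
  have pos: "0 < potential_u x0 x" "0 < potential_v x0 y"
    using bdd_pos_pos[OF bdd_pos_potential_u[OF x0]] bdd_pos_pos[OF bdd_pos_potential_v[OF x0]] xy by auto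
  have "exp (- c x y / \<epsilon>) * potential_u x0 x * potential_v x0 y
     \<le> (exp (\<delta> / \<epsilon>) * exp (- c x' y / \<epsilon>)) * (exp (\<delta> / \<epsilon>) * potential_u x0 x') * potential_v x0 y"
    using u k pos by (intro mult_right_mono mult_mono) auto
  also have "\<dots> = exp (2 * \<delta> / \<epsilon>) * (exp (- c x' y / \<epsilon>) * potential_u x0 x' * potential_v x0 y)"
    using exp_add[of "\<delta> / \<epsilon>" "\<delta> / \<epsilon>"] by simp
  finally show ?thesis by (simp add: gibbs_potentials[OF x0] xy)
qed

lemma gibbs_potentials_le_right:
  assumes x0: "x0 \<in> space P" and xy: "x \<in> space P" "y \<in> space Q" "y' \<in> space Q"
    and c: "AE x in P. \<bar>c x y - c x y'\<bar> \<le> \<delta>" and cx: "\<bar>c x y - c x y'\<bar> \<le> \<delta>"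
  shows "gibbs (potential_f x0) (potential_g x0) x y
    \<le> exp (2 * \<delta> / \<epsilon>) * gibbs (potential_f x0) (potential_g x0) x y'"
proof -
  have v: "potential_v x0 y \<le> exp (\<delta> / \<epsilon>) * potential_v x0 y'"
    by (intro potential_v_le x0 xy eventually_mono[OF c exp_cost_le])
  have k: "exp (- c x y / \<epsilon>) \<le> exp (\<delta> / \<epsilon>) * exp (- c x y' / \<epsilon>)"
    using cx by (intro exp_cost_le) (simp add: abs_minus_commute)
  have pos: "0 < potential_u x0 x" "0 < potential_v x0 y"
    using bdd_pos_pos[OF bdd_pos_potential_u[OF x0]] bdd_pos_pos[OF bdd_pos_potential_v[OF x0]] xy by auto
  have "exp (- c x y / \<epsilon>) * potential_u x0 x * potential_v x0 y
     \<le> (exp (\<delta> / \<epsilon>) * exp (- c x y' / \<epsilon>)) * potential_u x0 x * (exp (\<delta> / \<epsilon>) * potential_v x0 y')"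
    using v k pos by (intro mult_right_mono mult_mono) auto
  also have "\<dots> = exp (2 * \<delta> / \<epsilon>) * (exp (- c x y' / \<epsilon>) * potential_u x0 x * potential_v x0 y')"
    using exp_add[of "\<delta> / \<epsilon>" "\<delta> / \<epsilon>"] by simp
  finally show ?thesis by (simp add: gibbs_potentials[OF x0] xy)
qed

end

section \<open>Sampling estimates\<close>

text \<open>The arithmetic-geometric mean inequality in place of Cauchy-Schwarz. The bound is linear
  in \<open>v\<close>, so it can be averaged again over an outer sample before \<open>t\<close> is
  tuned; \<open>t = sqrt v\<close> gives \<open>sqrt v\<close>.\<close>

lemma (in prob_space) integral_abs_le_of_square:
  fixes X :: "'a \<Rightarrow> real"
  assumes [measurable]: "X \<in> borel_measurable M" and B: "\<And>x. x \<in> space M \<Longrightarrow> \<bar>X x\<bar> \<le> B"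
    and sq: "(\<integral>x. (X x)\<^sup>2 \<partial>M) \<le> v" and t: "t > 0"
  shows "(\<integral>x. \<bar>X x\<bar> \<partial>M) \<le> (v / t + t) / 2"
proof -
  have int: "integrable M (\<lambda>x. (X x)\<^sup>2)"
    using B by (intro integrable_bounded[where B="B\<^sup>2"]) (auto intro: abs_le_square_iff[THEN iffD1] order_trans[OF _ abs_ge_self])
  have int1: "integrable M (\<lambda>x. \<bar>X x\<bar>)"
    using B by (intro integrable_bounded[where B=B]) auto
  have "\<bar>X x\<bar> \<le> ((X x)\<^sup>2 / t + t) / 2" for x
  proof -
    have "0 \<le> (\<bar>X x\<bar> - t)\<^sup>2" by simp
    then show ?thesis using t by (simp add: field_simps power2_eq_square)
  qed
  then have "(\<integral>x. \<bar>X x\<bar> \<partial>M) \<le> (\<integral>x. ((X x)\<^sup>2 / t + t) / 2 \<partial>M)"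
    using int int1 by (intro integral_mono) auto
  also have "\<dots> = ((\<integral>x. (X x)\<^sup>2 \<partial>M) / t + t) / 2"
    using int by (simp add: prob_space)
  also have "\<dots> \<le> (v / t + t) / 2" using sq t by (simp add: divide_right_mono)
  finally show ?thesis .
qed

lemma integral_PiM_component:
  fixes h :: "'a \<Rightarrow> real"
  assumes "prob_space N" "finite I" "i \<in> I" "h \<in> borel_measurable N"
  shows "(\<integral>s. h (s i) \<partial>Pi\<^sub>M I (\<lambda>_. N)) = (\<integral>x. h x \<partial>N)"
proof -
  have "distr (Pi\<^sub>M I (\<lambda>_. N)) N (\<lambda>s. s i) = N"
    by (rule distr_PiM_component) (use assms in auto)
  then show ?thesis
    using assms integral_distr[of "\<lambda>s. s i" "Pi\<^sub>M I (\<lambda>_. N)" N h] by simp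
qed

context prob_space
begin

lemma sample_mean_variance:
  fixes h :: "'a \<Rightarrow> real" and n :: nat
  assumes [measurable]: "h \<in> borel_measurable M" and B: "\<And>x. x \<in> space M \<Longrightarrow> \<bar>h x\<bar> \<le> B"
    and n: "n \<ge> 1"
  shows "(\<integral>s. ((\<Sum>j<n. h (s j)) / n - integral\<^sup>L M h)\<^sup>2 \<partial>Pi\<^sub>M {..<n} (\<lambda>_. M)) \<le> (\<integral>x. (h x)\<^sup>2 \<partial>M) / n"
proof -
  interpret product_sigma_finite "\<lambda>_::nat. M" ..
  let ?\<Pi> = "Pi\<^sub>M {..<n} (\<lambda>_. M)"
  interpret \<Pi>: prob_space ?\<Pi> by (intro prob_space_PiM prob_space_axioms)
  define m where "m = integral\<^sup>L M h"
  define k where "k x = h x - m" for x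
  have [measurable]: "k \<in> borel_measurable M" unfolding k_def by measurable
  have m: "\<bar>m\<bar> \<le> B" unfolding m_def by (intro integral_abs_le B) auto
  have kB: "\<bar>k x\<bar> \<le> 2 * B" if "x \<in> space M" for x using B[OF that] m by (auto simp: k_def)
  have ih: "integrable M h" by (intro integrable_bounded[where B=B] B) auto
  have ih2: "integrable M (\<lambda>x. (h x)\<^sup>2)"
    using B by (intro integrable_bounded[where B="B\<^sup>2"]) (auto intro: abs_le_square_iff[THEN iffD1] order_trans[OF _ abs_ge_self])
  have ik: "integrable M k" using ih by (simp add: k_def[abs_def])
  have k0: "(\<integral>x. k x \<partial>M) = 0" using ih by (simp add: k_def m_def prob_space)
  have k2: "(\<integral>x. k x * k x \<partial>M) \<le> (\<integral>x. (h x)\<^sup>2 \<partial>M)"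
  proof -
    have "(\<integral>x. k x * k x \<partial>M) = (\<integral>x. (h x)\<^sup>2 - 2 * m * h x + m\<^sup>2 \<partial>M)"
      by (intro Bochner_Integration.integral_cong) (auto simp: k_def power2_eq_square algebra_simps)
    also have "\<dots> = (\<integral>x. (h x)\<^sup>2 \<partial>M) - m\<^sup>2"
      using ih ih2 by (simp add: prob_space m_def[symmetric] power2_eq_square)
    finally show ?thesis by simp
  qed
  have cross: "(\<integral>s. k (s i) * k (s j) \<partial>?\<Pi>) = (if i = j then \<integral>x. k x * k x \<partial>M else 0)"
    if ij: "i < n" "j < n" for i j
  proof (cases "i = j")
    case True
    then show ?thesis using ij integral_PiM_component[OF prob_space_axioms, of "{..<n}" i "\<lambda>x. k x * k x"] by simp
  next
    case False
    \<comment> \<open>Padding with the constant 1 in the other coordinates makes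
      \<open>k (s i) * k (s j)\<close> a product over all coordinates, so that its integral
      factorizes; the factor at \<open>i\<close> is the mean of \<open>k\<close>, which is
      0.\<close>
    define f where "f l x = (if l = i then k x else 1) * (if l = j then k x else 1)" for l x
    have "(\<integral>s. k (s i) * k (s j) \<partial>?\<Pi>) = (\<integral>s. (\<Prod>l<n. f l (s l)) \<partial>?\<Pi>)"
      using ij by (simp add: f_def prod.distrib prod.delta)
    also have "\<dots> = (\<Prod>l<n. integral\<^sup>L M (f l))"
    proof (intro product_integral_prod)
      show "integrable M (f l)" for l
        using False ik by (cases "l = i"; cases "l = j") (auto simp: f_def[abs_def])
    qed simp
    also have "\<dots> = 0"
      using ij False k0 by (intro prod_zero) (auto simp: f_def[abs_def] intro!: bexI[of _ i])
    finally show ?thesis using False by simp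
  qed
  have ikk: "integrable ?\<Pi> (\<lambda>s. k (s i) * k (s j))" if ij: "i < n" "j < n" for i j
  proof (rule \<Pi>.integrable_bounded)
    fix s assume "s \<in> space ?\<Pi>"
    then have "s i \<in> space M" "s j \<in> space M" using ij by (auto simp: space_PiM PiE_iff)
    then show "\<bar>k (s i) * k (s j)\<bar> \<le> 2 * B * (2 * B)"
      unfolding abs_mult using kB order_trans[OF abs_ge_zero m] by (intro mult_mono) auto
  qed (use ij in auto)
  have "(\<integral>s. ((\<Sum>j<n. h (s j)) / n - m)\<^sup>2 \<partial>?\<Pi>) = (\<integral>s. (\<Sum>i<n. \<Sum>j<n. k (s i) * k (s j)) / (real n)\<^sup>2 \<partial>?\<Pi>)"
  proof (rule Bochner_Integration.integral_cong[OF refl])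
    fix s
    have "(\<Sum>j<n. h (s j)) / n - m = (\<Sum>j<n. k (s j)) / n"
      using n by (simp add: k_def sum_subtractf field_simps)
    then show "((\<Sum>j<n. h (s j)) / n - m)\<^sup>2 = (\<Sum>i<n. \<Sum>j<n. k (s i) * k (s j)) / (real n)\<^sup>2"
      by (simp add: power_divide power2_eq_square sum_product)
  qed
  also have "\<dots> = (\<Sum>i<n. \<Sum>j<n. \<integral>s. k (s i) * k (s j) \<partial>?\<Pi>) / (real n)\<^sup>2"
  proof -
    have "(\<integral>s. (\<Sum>i<n. \<Sum>j<n. k (s i) * k (s j)) \<partial>?\<Pi>) = (\<Sum>i<n. \<integral>s. (\<Sum>j<n. k (s i) * k (s j)) \<partial>?\<Pi>)"
      using ikk by (intro Bochner_Integration.integral_sum Bochner_Integration.integrable_sum) auto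
    also have "\<dots> = (\<Sum>i<n. \<Sum>j<n. \<integral>s. k (s i) * k (s j) \<partial>?\<Pi>)"
      using ikk by (intro sum.cong Bochner_Integration.integral_sum) auto
    finally show ?thesis by simp
  qed
  also have "\<dots> = (\<Sum>i<n. \<Sum>j<n. if i = j then \<integral>x. k x * k x \<partial>M else 0) / (real n)\<^sup>2"
    using cross by simp
  also have "\<dots> = (\<integral>x. k x * k x \<partial>M) / n"
    using n by (simp add: power2_eq_square)
  also have "\<dots> \<le> (\<integral>x. (h x)\<^sup>2 \<partial>M) / n"
    using k2 by (simp add: divide_right_mono)
  finally show ?thesis by (simp add: m_def)
qed

lemma sample_mean_abs_deviation:
  fixes h :: "'a \<Rightarrow> real" and n :: nat
  assumes h[measurable]: "h \<in> borel_measurable M" and B: "\<And>x. x \<in> space M \<Longrightarrow> \<bar>h x\<bar> \<le> B"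
    and n: "n \<ge> 1" and t: "t > 0"
  shows "(\<integral>s. \<bar>(\<Sum>j<n. h (s j)) / n - integral\<^sup>L M h\<bar> \<partial>Pi\<^sub>M {..<n} (\<lambda>_. M))
    \<le> ((\<integral>x. (h x)\<^sup>2 \<partial>M) / n / t + t) / 2"
proof -
  interpret \<Pi>: prob_space "Pi\<^sub>M {..<n} (\<lambda>_. M)" by (intro prob_space_PiM prob_space_axioms)
  show ?thesis
  proof (rule \<Pi>.integral_abs_le_of_square[OF _ _ sample_mean_variance[OF h B n] t])
    fix s assume s: "s \<in> space (Pi\<^sub>M {..<n} (\<lambda>_. M))"
    have "\<bar>\<Sum>j<n. h (s j)\<bar> \<le> (\<Sum>j<n. B)"
      using s B by (intro order_trans[OF sum_abs] sum_mono) (auto simp: space_PiM PiE_iff)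
    then have "\<bar>(\<Sum>j<n. h (s j)) / n\<bar> \<le> B" using n by (simp add: field_simps)
    moreover have "\<bar>integral\<^sup>L M h\<bar> \<le> B" by (intro integral_abs_le B h)
    ultimately show "\<bar>(\<Sum>j<n. h (s j)) / n - integral\<^sup>L M h\<bar> \<le> 2 * B" by linarith
  qed measurable
qed

end

section \<open>Second moment of the density and sampling error of its marginals\<close>

context pair_prob_space
begin

text \<open>The sets \<open>B a\<close> may overlap, since summing over them only overestimates.
  \<open>X\<close> and \<open>Y\<close> are sets of full measure on which the ratio bound holds
  pointwise, in use the two supports. The bound \<open>H\<close> enters only integrability and null
  balls, never the conclusion.\<close>

lemma integral_square_le_cover:
  fixes p :: "'a \<Rightarrow> 'b \<Rightarrow> real"
  assumes p [measurable]: "case_prod p \<in> borel_measurable (M1 \<Otimes>\<^sub>M M2)"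
    and nn: "\<And>x y. 0 \<le> p x y" and H: "\<And>x y. x \<in> space M1 \<Longrightarrow> y \<in> space M2 \<Longrightarrow> p x y \<le> H"
    and left: "\<And>y. y \<in> space M2 \<Longrightarrow> (\<integral>x. p x y \<partial>M1) = 1"
    and right: "\<And>x. x \<in> space M1 \<Longrightarrow> (\<integral>y. p x y \<partial>M2) = 1"
    and F: "finite F" "\<And>a. a \<in> F \<Longrightarrow> B a \<in> sets M1"
    and cover: "AE x in M1. x \<in> X \<and> (\<exists>a\<in>F. x \<in> B a)" and Y: "AE y in M2. y \<in> Y"
    and \<kappa>: "0 \<le> \<kappa>" "\<And>a x x' y. a \<in> F \<Longrightarrow> x \<in> X \<inter> B a \<Longrightarrow> x' \<in> X \<inter> B a \<Longrightarrow> y \<in> Y \<Longrightarrow> p x y \<le> \<kappa> * p x' y"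
  shows "(\<integral>x. \<integral>y. (p x y)\<^sup>2 \<partial>M2 \<partial>M1) \<le> \<kappa> * card F"
proof -
  have [measurable]: "p x \<in> borel_measurable M2" if "x \<in> space M1" for x using that by measurable
  have [measurable]: "(\<lambda>x. p x y) \<in> borel_measurable M1" if "y \<in> space M2" for y using that by measurable
  define V where "V x = (\<integral>y. (p x y)\<^sup>2 \<partial>M2)" for x
  have [measurable]: "V \<in> borel_measurable M1" unfolding V_def by measurable
  have p2: "\<bar>(p x y)\<^sup>2\<bar> \<le> H\<^sup>2" if "x \<in> space M1" "y \<in> space M2" for x y
    using H[OF that] nn[of x y] by (simp add: power_mono)
  have V: "0 \<le> V x" "V x \<le> H\<^sup>2" if "x \<in> space M1" for x
    unfolding V_def using p2[OF that] that by (auto intro!: M2.integral_bounds(2)[where l=0])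
  have ind: "(\<integral>x. indicator (B a) x * V x \<partial>M1) \<le> \<kappa>" if a: "a \<in> F" for a
  proof -
    let ?m = "measure M1 (B a)"
    have [measurable]: "B a \<in> sets M1" using F a by auto
    have int: "integrable M1 (\<lambda>x. indicator (B a) x * V x)"
      by (rule M1.integrable_bounded[where B="H\<^sup>2"]) (use V in \<open>auto simp: indicator_def\<close>)
    have iB: "integrable M1 (indicator (B a) :: 'a \<Rightarrow> real)"
      by (rule M1.integrable_bounded[where B=1]) (auto simp: indicator_def)
    \<comment> \<open>Compare \<open>p x y\<close> with \<open>p x' y\<close> for almost every
      \<open>x'\<close> in the ball and integrate over \<open>x'\<close>: the left marginal caps the
      result at \<kappa>.\<close>
    have pm: "p x y * ?m \<le> \<kappa>" if x: "x \<in> X \<inter> B a" and y: "y \<in> space M2" "y \<in> Y" for x y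
    proof -
      have ip: "integrable M1 (\<lambda>x'. p x' y)"
        using y H nn by (intro M1.integrable_bounded[where B=H]) auto
      have "p x y * ?m = (\<integral>x'. p x y * indicator (B a) x' \<partial>M1)" by simp
      also have "\<dots> \<le> (\<integral>x'. \<kappa> * p x' y \<partial>M1)"
      proof (rule integral_mono_AE)
        show "AE x' in M1. p x y * indicator (B a) x' \<le> \<kappa> * p x' y"
          using cover
        proof eventually_elim
          case (elim x')
          then show ?case using \<kappa> x y a nn by (auto simp: indicator_def)
        qed
        show "integrable M1 (\<lambda>x'. p x y * indicator (B a) x')" using iB by simp
      qed (use ip in simp)
      also have "\<dots> = \<kappa>" using left y by simp
      finally show ?thesis .
    qed
    \<comment> \<open>One factor of the square is at most \<kappa> over the mass of the ball; the
      other integrates to 1 in \<open>y\<close>.\<close>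
    have Vm: "V x * ?m \<le> \<kappa>" if x: "x \<in> X \<inter> B a" "x \<in> space M1" for x
    proof -
      have "V x * ?m = (\<integral>y. (p x y)\<^sup>2 * ?m \<partial>M2)" by (simp add: V_def)
      also have "\<dots> \<le> (\<integral>y. \<kappa> * p x y \<partial>M2)"
      proof (rule integral_mono_AE)
        show "AE y in M2. (p x y)\<^sup>2 * ?m \<le> \<kappa> * p x y"
          using Y AE_space
        proof eventually_elim
          case (elim y)
          show ?case using mult_left_mono[OF pm[OF x(1) elim(2,1)] nn[of x y]]
            by (simp add: power2_eq_square mult_ac)
        qed
        show "integrable M2 (\<lambda>y. (p x y)\<^sup>2 * ?m)" "integrable M2 (\<lambda>y. \<kappa> * p x y)"
          using x p2 H nn
          by (auto intro!: integrable_mult_left integrable_mult_right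
              intro: M2.integrable_bounded[where B="H\<^sup>2"] M2.integrable_bounded[where B=H])
      qed
      also have "\<dots> = \<kappa>" using right x by simp
      finally show ?thesis .
    qed
    show ?thesis
    proof (cases "?m = 0")
      case True
      have "(\<integral>x. indicator (B a) x * V x \<partial>M1) \<le> (\<integral>x. H\<^sup>2 * indicator (B a) x \<partial>M1)"
      proof (intro integral_mono int)
        show "integrable M1 (\<lambda>x. H\<^sup>2 * indicator (B a) x)" using iB by simp
      qed (use V in \<open>auto simp: indicator_def\<close>)
      also have "\<dots> = 0" using True by simp
      finally show ?thesis using \<kappa> by simp
    next
      case False
      then have m: "0 < ?m" by (simp add: less_le)
      have "(\<integral>x. indicator (B a) x * V x \<partial>M1) \<le> (\<integral>x. \<kappa> / ?m * indicator (B a) x \<partial>M1)"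
      proof (rule integral_mono_AE)
        show "AE x in M1. indicator (B a) x * V x \<le> \<kappa> / ?m * indicator (B a) x"
          using cover AE_space
        proof eventually_elim
          case (elim x)
          then show ?case using Vm[of x] m by (auto simp: indicator_def pos_le_divide_eq)
        qed
        show "integrable M1 (\<lambda>x. \<kappa> / ?m * indicator (B a) x)"
          using iB by (rule integrable_mult_right)
      qed (rule int)
      also have "\<dots> = \<kappa>" using m by simp
      finally show ?thesis .
    qed
  qed
  have int: "integrable M1 (\<lambda>x. indicator (B a) x * V x)" if "a \<in> F" for a
    by (rule M1.integrable_bounded[where B="H\<^sup>2"]) (use V F that in \<open>auto simp: indicator_def\<close>)
  have "(\<integral>x. V x \<partial>M1) \<le> (\<integral>x. (\<Sum>a\<in>F. indicator (B a) x * V x) \<partial>M1)"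
  proof (rule integral_mono_AE)
    show "AE x in M1. V x \<le> (\<Sum>a\<in>F. indicator (B a) x * V x)"
      using cover AE_space
    proof eventually_elim
      case (elim x)
      then obtain a where a: "a \<in> F" "x \<in> B a" by auto
      have "V x = indicator (B a) x * V x" using a by simp
      also have "\<dots> \<le> (\<Sum>a\<in>F. indicator (B a) x * V x)"
        by (rule member_le_sum) (use a F V elim in \<open>auto simp: indicator_def\<close>)
      finally show ?case .
    qed
    show "integrable M1 V" by (rule M1.integrable_bounded[where B="H\<^sup>2"]) (use V in auto)
  qed (use int in auto)
  also have "\<dots> = (\<Sum>a\<in>F. \<integral>x. indicator (B a) x * V x \<partial>M1)"
    using int by (intro Bochner_Integration.integral_sum) auto
  also have "\<dots> \<le> (\<Sum>a\<in>F. \<kappa>)" by (intro sum_mono ind)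
  finally show ?thesis by (simp add: V_def mult.commute)
qed

text \<open>The two samples are independent: once \<open>s\<close> is fixed, each
  \<open>p (s i)\<close> is a fixed function with mean exactly 1 under \<open>M2\<close>, and each
  summand is the deviation of a sample mean. Averaging the second moments over \<open>s\<close>
  gives at most \<open>v\<close>. Exchanging the factors covers the other marginal.\<close>

lemma sample_marginal_error:
  fixes p :: "'a \<Rightarrow> 'b \<Rightarrow> real" and n :: nat
  assumes p [measurable]: "case_prod p \<in> borel_measurable (M1 \<Otimes>\<^sub>M M2)"
    and H: "\<And>x y. x \<in> space M1 \<Longrightarrow> y \<in> space M2 \<Longrightarrow> \<bar>p x y\<bar> \<le> H"
    and right: "\<And>x. x \<in> space M1 \<Longrightarrow> (\<integral>y. p x y \<partial>M2) = 1"
    and sq: "(\<integral>x. \<integral>y. (p x y)\<^sup>2 \<partial>M2 \<partial>M1) \<le> v" and v: "v > 0" and n: "n \<ge> 1"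
  shows "(\<integral>s. \<integral>t. (\<Sum>i<n. \<bar>(\<Sum>j<n. p (s i) (t j)) / n - 1\<bar>) / n \<partial>Pi\<^sub>M {..<n} (\<lambda>_. M2) \<partial>Pi\<^sub>M {..<n} (\<lambda>_. M1))
    \<le> sqrt (v / n)"
proof -
  let ?S = "Pi\<^sub>M {..<n} (\<lambda>_. M1)" and ?T = "Pi\<^sub>M {..<n} (\<lambda>_. M2)"
  interpret S: prob_space ?S by (intro prob_space_PiM M1.prob_space_axioms)
  interpret T: prob_space ?T by (intro prob_space_PiM M2.prob_space_axioms)
  have [measurable (raw)]: "(\<lambda>z. p (f z) (g z)) \<in> borel_measurable N"
    if "f \<in> measurable N M1" "g \<in> measurable N M2" for f g N
    using measurable_compose[OF measurable_Pair[OF that] p] by simp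
  define V where "V x = (\<integral>y. (p x y)\<^sup>2 \<partial>M2)" for x
  have [measurable]: "V \<in> borel_measurable M1" unfolding V_def by measurable
  have p2: "\<bar>(p x y)\<^sup>2\<bar> \<le> H\<^sup>2" if "x \<in> space M1" "y \<in> space M2" for x y
    using H[OF that] by (metis abs_power2 abs_le_square_iff abs_of_nonneg abs_ge_zero order_trans)
  have V: "\<bar>V x\<bar> \<le> H\<^sup>2" if "x \<in> space M1" for x
    unfolding V_def using p2 that by (intro M2.integral_abs_le) auto
  \<comment> \<open>This value balances the two terms of \<open>(v / n / r + r) / 2\<close>. It does
    not depend on \<open>s\<close>, so the conditional bound stays linear in
    \<open>V (s i)\<close>.\<close>
  define r where "r = sqrt (v / n)"
  have r: "r > 0" "r * r = v / n" using v n by (auto simp: r_def)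
  have D: "\<bar>(\<Sum>j<n. p x (t j)) / n - 1\<bar> \<le> H + 1" if "x \<in> space M1" "t \<in> space ?T" for x t
  proof -
    have "\<bar>\<Sum>j<n. p x (t j)\<bar> \<le> (\<Sum>j<n. H)"
      using that H by (intro order_trans[OF sum_abs] sum_mono) (auto simp: space_PiM PiE_iff)
    then have "\<bar>(\<Sum>j<n. p x (t j)) / n\<bar> \<le> H" using n by (simp add: field_simps)
    then show ?thesis by linarith
  qed
  have mem: "s i \<in> space M1" if "s \<in> space ?S" "i < n" for s i
    using that by (auto simp: space_PiM PiE_iff)
  have inner: "(\<integral>t. (\<Sum>i<n. \<bar>(\<Sum>j<n. p (s i) (t j)) / n - 1\<bar>) / n \<partial>?T) \<le> (\<Sum>i<n. (V (s i) / n / r + r) / 2) / n"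
    if s: "s \<in> space ?S" for s
  proof -
    have "integrable ?T (\<lambda>t. \<bar>(\<Sum>j<n. p (s i) (t j)) / n - 1\<bar>)" if "i < n" for i
      using mem[OF s that] D by (intro T.integrable_bounded[where B="H+1"]) auto
    then have "(\<integral>t. (\<Sum>i<n. \<bar>(\<Sum>j<n. p (s i) (t j)) / n - 1\<bar>) / n \<partial>?T)
      = (\<Sum>i<n. \<integral>t. \<bar>(\<Sum>j<n. p (s i) (t j)) / n - 1\<bar> \<partial>?T) / n"
      by (simp add: Bochner_Integration.integral_sum)
    also have "\<dots> \<le> (\<Sum>i<n. (V (s i) / n / r + r) / 2) / n"
    proof (intro divide_right_mono sum_mono)
      fix i assume "i \<in> {..<n}"
      then have i: "s i \<in> space M1" using mem s by auto
      then have "(\<lambda>y. p (s i) y) \<in> borel_measurable M2" by measurable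
      from M2.sample_mean_abs_deviation[OF this H[OF i] n r(1)]
      show "(\<integral>t. \<bar>(\<Sum>j<n. p (s i) (t j)) / n - 1\<bar> \<partial>?T) \<le> (V (s i) / n / r + r) / 2"
        unfolding right[OF i] V_def .
    qed simp
    finally show ?thesis .
  qed
  have iV: "integrable ?S (\<lambda>s. V (s i))" if "i < n" for i
    using V mem that by (intro S.integrable_bounded[where B="H\<^sup>2"]) auto
  have "(\<integral>s. \<integral>t. (\<Sum>i<n. \<bar>(\<Sum>j<n. p (s i) (t j)) / n - 1\<bar>) / n \<partial>?T \<partial>?S)
    \<le> (\<integral>s. (\<Sum>i<n. (V (s i) / n / r + r) / 2) / n \<partial>?S)"
  proof (rule integral_mono[OF _ _ inner])
    show "integrable ?S (\<lambda>s. \<integral>t. (\<Sum>i<n. \<bar>(\<Sum>j<n. p (s i) (t j)) / n - 1\<bar>) / n \<partial>?T)"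
    proof (rule S.integrable_bounded)
      fix s assume s: "s \<in> space ?S"
      show "\<bar>\<integral>t. (\<Sum>i<n. \<bar>(\<Sum>j<n. p (s i) (t j)) / n - 1\<bar>) / n \<partial>?T\<bar> \<le> H + 1"
      proof (rule T.integral_abs_le)
        show "(\<lambda>t. (\<Sum>i<n. \<bar>(\<Sum>j<n. p (s i) (t j)) / n - 1\<bar>) / n) \<in> borel_measurable ?T"
          using s mem by (auto intro!: borel_measurable_sum borel_measurable_divide borel_measurable_abs borel_measurable_diff) 
        fix t assume t: "t \<in> space ?T"
        have "(\<Sum>i<n. \<bar>(\<Sum>j<n. p (s i) (t j)) / n - 1\<bar>) \<le> (\<Sum>i<n. H + 1)"
          using s t mem by (intro sum_mono D) auto
        then show "\<bar>(\<Sum>i<n. \<bar>(\<Sum>j<n. p (s i) (t j)) / n - 1\<bar>) / n\<bar> \<le> H + 1"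
          using n by (simp add: field_simps sum_nonneg)
      qed
    qed measurable
    show "integrable ?S (\<lambda>s. (\<Sum>i<n. (V (s i) / n / r + r) / 2) / n)"
      using iV by (intro integrable_divide_zero Bochner_Integration.integrable_sum Bochner_Integration.integrable_add) auto
  qed
  also have "\<dots> = (\<Sum>i<n. ((\<integral>s. V (s i) \<partial>?S) / n / r + r) / 2) / n"
    using iV by (simp add: Bochner_Integration.integral_sum S.prob_space)
  also have "\<dots> = ((\<integral>x. V x \<partial>M1) / n / r + r) / 2"
    using n by (simp add: integral_PiM_component M1.prob_space_axioms)
  also have "\<dots> \<le> (v / n / r + r) / 2"
    using sq r by (simp add: V_def divide_right_mono)
  also have "\<dots> = r" using r by (simp flip: r(2))
  finally show ?thesis by (simp add: r_def)
qed

end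

section \<open>Supports, coverings and empirical measures\<close>

lemma measurable_euclid_dist [measurable (raw)]:
  assumes [measurable]: "f \<in> measurable N (Rd d)" "g \<in> measurable N (Rd d)"
  shows "(\<lambda>z. euclid_dist d (f z) (g z)) \<in> borel_measurable N"
proof -
  have [measurable]: "(\<lambda>z. f z i) \<in> borel_measurable N" "(\<lambda>z. g z i) \<in> borel_measurable N" if "i < d" for i
    using that assms unfolding Rd_def by (auto intro: measurable_PiM_component_rev)
  show ?thesis unfolding euclid_dist_def L2_set_def by measurable
qed

lemma euclid_dist_triangle: "euclid_dist d x z \<le> euclid_dist d x y + euclid_dist d y z"
  unfolding euclid_dist_def
  using L2_set_triangle_ineq[of "\<lambda>i. x i - y i" "\<lambda>i. y i - z i" "{..<d}"] by simp

lemma euclid_dist_commute: "euclid_dist d x y = euclid_dist d y x"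
  unfolding euclid_dist_def L2_set_def by (simp add: power2_commute)

lemma rational_point_near:
  assumes x: "x \<in> space (Rd d)" and e: "e > 0"
  shows "\<exists>q \<in> {..<d} \<rightarrow>\<^sub>E \<rat>. euclid_dist d q x < e"
proof -
  \<comment> \<open>Dividing by \<open>d + 1\<close> keeps the sum of the \<open>d\<close>
    coordinate errors strictly below \<open>e\<close> and is safe for \<open>d = 0\<close>.\<close>
  have "\<exists>q\<in>\<rat>. \<bar>q - x i\<bar> < e / (d + 1)" for i
  proof -
    obtain q where "q \<in> \<rat>" "x i < q" "q < x i + e / (d + 1)"
      using Rats_dense_in_real[of "x i" "x i + e / (d + 1)"] e by auto
    then show ?thesis by (intro bexI[of _ q]) auto
  qed
  then obtain q where q: "\<And>i. q i \<in> \<rat>" "\<And>i. \<bar>q i - x i\<bar> < e / (d + 1)" by metis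
  have "euclid_dist d (restrict q {..<d}) x \<le> (\<Sum>i<d. \<bar>restrict q {..<d} i - x i\<bar>)"
    unfolding euclid_dist_def by (rule L2_set_le_sum_abs)
  also have "\<dots> \<le> (\<Sum>i<d. e / (d + 1))"
    using q(2) by (intro sum_mono) (auto intro: less_imp_le)
  also have "\<dots> < e" using e by (simp add: field_simps)
  finally show ?thesis using q(1) by (intro bexI[of _ "restrict q {..<d}"]) auto
qed

text \<open>A Lindeloef argument: every point outside the support lies in a null ball with rational
  centre and radius, and there are only countably many such balls.\<close>

lemma AE_supp:
  assumes P: "borel_prob d P"
  shows "AE x in P. x \<in> supp d P"
proof -
  have sets [measurable_cong]: "sets P = sets (Rd d)" using P by (simp add: borel_prob_def)
  have sp: "space P = space (Rd d)" using sets by (rule sets_eq_imp_space_eq)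
  define B where "B q s = {y \<in> space (Rd d). euclid_dist d q y < s}" for q s
  define I where "I = {(q, s). q \<in> {..<d} \<rightarrow>\<^sub>E \<rat> \<and> s \<in> \<rat> \<and> B q s \<in> null_sets P}"
  have "countable (({..<d} \<rightarrow>\<^sub>E (\<rat> :: real set)) \<times> (\<rat> :: real set))"
    by (intro countable_SIGMA countable_PiE countable_rat) auto
  then have "countable I"
    by (rule countable_subset[rotated]) (auto simp: I_def)
  moreover have "B (fst z) (snd z) \<in> null_sets P" if "z \<in> I" for z
    using that by (simp add: I_def split_beta)
  ultimately have "(\<Union>z\<in>I. B (fst z) (snd z)) \<in> null_sets P" by (rule null_sets_UN')
  moreover have "{x \<in> space P. x \<notin> supp d P} \<subseteq> (\<Union>z\<in>I. B (fst z) (snd z))"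
  proof clarify
    fix x assume x: "x \<in> space P" "x \<notin> supp d P"
    then have "\<not> (\<forall>r>0. 0 < emeasure P (B x r))" by (simp add: supp_def sp B_def)
    then obtain r where r: "r > 0" "emeasure P (B x r) = 0" by (auto simp: not_gr_zero)
    have [measurable]: "x \<in> space (Rd d)" using x sp by simp
    \<comment> \<open>The ball about \<open>q\<close> must contain \<open>x\<close>, so its radius
      \<open>s\<close> exceeds \<open>r / 3\<close>, and must stay inside the null ball about
      \<open>x\<close>, which holds as \<open>r / 3 + r / 2 < r\<close>.\<close>
    obtain q where q: "q \<in> {..<d} \<rightarrow>\<^sub>E \<rat>" "euclid_dist d q x < r / 3"
      using rational_point_near[of x d "r / 3"] x r by (auto simp: sp)
    obtain s where s: "s \<in> \<rat>" "r / 3 < s" "s < r / 2"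
      using Rats_dense_in_real[of "r / 3" "r / 2"] r by auto
    have sub: "B q s \<subseteq> B x r"
    proof
      fix y assume y: "y \<in> B q s"
      then have "euclid_dist d x y < r / 3 + r / 2"
        using euclid_dist_triangle[of d x y q] q(2) s(3) euclid_dist_commute[of d q x]
        by (simp add: B_def)
      then show "y \<in> B x r" using y r(1) by (simp add: B_def)
    qed
    have [measurable]: "q \<in> space (Rd d)" using q(1) by (auto simp: Rd_def space_PiM PiE_iff)
    have meas: "B z t \<in> sets P" if [measurable]: "z \<in> space (Rd d)" for z t
      unfolding B_def sets by measurable
    have "B x r \<in> null_sets P" using r(2) meas by (auto intro: null_setsI)
    then have "B q s \<in> null_sets P"
      by (rule null_sets_subset) (use sub meas in simp_all)
    then have "(q, s) \<in> I" using q(1) s(1) by (simp add: I_def)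
    moreover have "x \<in> B q s" using q(2) s(2) x(1) by (simp add: B_def sp)
    ultimately show "x \<in> (\<Union>z\<in>I. B (fst z) (snd z))" by force
  qed
  ultimately show ?thesis by (auto intro: AE_I')
qed

lemma
  assumes x: "x \<in> space (Pi\<^sub>M {..<n} (\<lambda>_. Rd d))" and n: "n \<ge> 1"
  shows prob_space_empirical: "prob_space (empirical d n x)"
    and integral_empirical: "h \<in> borel_measurable (Rd d) \<Longrightarrow> (\<integral>z. h z \<partial>empirical d n x) = (\<Sum>i<n. h (x i)) / n"
    and AE_empirical: "{z \<in> space (Rd d). \<Phi> z} \<in> sets (Rd d) \<Longrightarrow> (\<And>i. i < n \<Longrightarrow> \<Phi> (x i)) \<Longrightarrow>
      AE z in empirical d n x. \<Phi> z"
proof -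
  have "x \<in> {..<n} \<rightarrow> space (Rd d)" using x by (auto simp: space_PiM)
  then have m: "x \<in> measurable (uniform_count_measure {..<n}) (Rd d)"
    by (simp add: uniform_count_measure_def)
  show "prob_space (empirical d n x)" unfolding empirical_def
    using n by (intro prob_space.prob_space_distr[OF _ m] prob_space_uniform_count_measure) (auto simp: lessThan_empty_iff)
  show "(\<integral>z. h z \<partial>empirical d n x) = (\<Sum>i<n. h (x i)) / n" if "h \<in> borel_measurable (Rd d)" for h :: "_ \<Rightarrow> real"
    unfolding empirical_def using that m by (subst integral_distr) (auto simp: integral_uniform_count_measure)
  show "AE z in empirical d n x. \<Phi> z" if "{z \<in> space (Rd d). \<Phi> z} \<in> sets (Rd d)" "\<And>i. i < n \<Longrightarrow> \<Phi> (x i)"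
    unfolding empirical_def using that
    by (subst AE_distr_iff[OF m]) (auto intro!: AE_I2 simp: space_uniform_count_measure)
qed

lemma sets_empirical [simp, measurable_cong]: "sets (empirical d n x) = sets (Rd d)"
  by (simp add: empirical_def)

lemma space_empirical [simp]: "space (empirical d n x) = space (Rd d)"
  by (simp add: empirical_def)

text \<open>A finite value means that some finite cover exists, and a nonempty set in the well-order
  \<open>enat\<close> contains its infimum.\<close>

lemma covering_number_attained:
  assumes "covering_number d P \<delta> \<noteq> \<infinity>"
  obtains F where "finite F" "F \<subseteq> space (Rd d)"
    "supp d P \<subseteq> (\<Union>a\<in>F. {x \<in> space (Rd d). euclid_dist d a x \<le> \<delta>})"
    "covering_number d P \<delta> = enat (card F)"
proof -
  let ?A = "{F. finite F \<and> F \<subseteq> space (Rd d) \<and>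
                  supp d P \<subseteq> (\<Union>a\<in>F. {x \<in> space (Rd d). euclid_dist d a x \<le> \<delta>})}"
  have "?A \<noteq> {}"
  proof
    assume "?A = {}"
    then have "covering_number d P \<delta> = top" unfolding covering_number_def by (simp only: image_empty Inf_empty)
    then show False using assms by (simp add: top_enat_def)
  qed
  then obtain F0 where "F0 \<in> ?A" by blast
  then have "Inf ((\<lambda>F. enat (card F)) ` ?A) \<in> (\<lambda>F. enat (card F)) ` ?A"
    by (intro wellorder_InfI[of "enat (card F0)"]) blast
  then obtain F where F: "F \<in> ?A" "covering_number d P \<delta> = enat (card F)"
    unfolding covering_number_def by blast
  show thesis by (rule that[of F]) (use F in blast)+
qed

text \<open>A support of full measure is nonempty, so no cover is empty. This lets the rate
  \<open>1 / sqrt n\<close> of the potential means be absorbed into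
  \<open>sqrt (N / n)\<close>.\<close>

lemma covering_number_pos:
  assumes "borel_prob d P" "covering_number d P \<delta> = enat N"
  shows "N \<ge> 1"
proof -
  interpret prob_space P using assms(1) by (simp add: borel_prob_def)
  obtain F where F: "finite F" "supp d P \<subseteq> (\<Union>a\<in>F. {x \<in> space (Rd d). euclid_dist d a x \<le> \<delta>})"
    "covering_number d P \<delta> = enat (card F)"
    by (rule covering_number_attained[of d P \<delta>]) (use assms(2) in auto)
  have "supp d P \<noteq> {}"
  proof
    assume "supp d P = {}"
    then have "AE x in P. False" using AE_supp[OF assms(1)] by simp
    then show False by simp
  qed
  then have "F \<noteq> {}" using F(2) by auto
  then show ?thesis using F assms(2) by (simp add: Suc_le_eq card_gt_0_iff)
qed

section \<open>Measurability of the empirical value\<close>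

lemma borel_measurable_kernel_compose:
  assumes "case_prod K \<in> borel_measurable (A \<Otimes>\<^sub>M B)" "f \<in> measurable N A" "g \<in> measurable N B"
  shows "(\<lambda>z. K (f z) (g z)) \<in> borel_measurable N"
  using measurable_compose[OF measurable_Pair[OF assms(2,3)] assms(1)] by simp

text \<open>The measure of integration itself varies with \<open>s\<close>. Since it is empirical,
  the integral is a finite sum over the sample points, and joint measurability can be read
  off.\<close>

lemma measurable_half_step_empirical:
  fixes K :: "(nat \<Rightarrow> real) \<Rightarrow> (nat \<Rightarrow> real) \<Rightarrow> real"
  assumes K: "case_prod K \<in> borel_measurable (Rd d \<Otimes>\<^sub>M Rd d)" and n: "n \<ge> 1"
    and X [measurable]: "X \<in> measurable N (Pi\<^sub>M {..<n} (\<lambda>_. Rd d))"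
    and G: "case_prod G \<in> borel_measurable (N \<Otimes>\<^sub>M Rd d)"
  shows "(\<lambda>(s, w). half_step (empirical d n (X s)) K (G s) w) \<in> borel_measurable (N \<Otimes>\<^sub>M Rd d)"
proof -
  note [measurable (raw)] = borel_measurable_kernel_compose[OF K] borel_measurable_kernel_compose[OF G]
  have [measurable]: "(\<lambda>s. X s i) \<in> measurable N (Rd d)" if "i < n" for i
    using measurable_compose[OF X measurable_component_singleton[of i]] that by simp
  have "half_step (empirical d n (X s)) K (G s) w = 1 / ((\<Sum>i<n. K (X s i) w * G s (X s i)) / n)"
    if [measurable]: "s \<in> space N" "w \<in> space (Rd d)" for s w
  proof -
    have "X s \<in> space (Pi\<^sub>M {..<n} (\<lambda>_. Rd d))" using X that(1) by (rule measurable_space)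
    then show ?thesis unfolding half_step_def by (subst integral_empirical[OF _ n]) measurable
  qed
  then have "(\<lambda>(s, w). half_step (empirical d n (X s)) K (G s) w) \<in> borel_measurable (N \<Otimes>\<^sub>M Rd d) \<longleftrightarrow>
     (\<lambda>(s, w). 1 / ((\<Sum>i<n. K (X s i) w * G s (X s i)) / n)) \<in> borel_measurable (N \<Otimes>\<^sub>M Rd d)"
    by (intro measurable_cong) (auto simp: space_pair_measure)
  also have "\<dots>" by measurable
  finally show ?thesis .
qed

lemma entropic_problem_empirical:
  assumes c: "case_prod c \<in> borel_measurable (Rd d \<Otimes>\<^sub>M Rd d)" and M: "\<And>x y. \<bar>c x y\<bar> \<le> M"
    and eps: "\<epsilon> > 0" and n: "n \<ge> 1"
    and "x \<in> space (Pi\<^sub>M {..<n} (\<lambda>_. Rd d))" "y \<in> space (Pi\<^sub>M {..<n} (\<lambda>_. Rd d))"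
  shows "entropic_problem (empirical d n x) (empirical d n y) c M \<epsilon>"
proof -
  interpret P: prob_space "empirical d n x" using assms(5) n by (rule prob_space_empirical)
  interpret Q: prob_space "empirical d n y" using assms(6) n by (rule prob_space_empirical)
  have [measurable]: "case_prod c \<in> borel_measurable (Rd d \<Otimes>\<^sub>M Rd d)" by (rule c)
  show ?thesis by unfold_locales (use M eps in auto)
qed

text \<open>The potentials are evaluated at points that are themselves random, so measurability is
  needed jointly in sample and point. The iterates have it by induction, and pointwise limits
  preserve it.\<close>

lemma measurable_entropic_OT_empirical_bounded:
  assumes c: "case_prod c \<in> borel_measurable (Rd d \<Otimes>\<^sub>M Rd d)" and M: "\<And>x y. \<bar>c x y\<bar> \<le> M"
    and eps: "\<epsilon> > 0" and n: "n \<ge> 1"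
  shows "(\<lambda>s. entropic_OT c \<epsilon> (empirical d n (fst s)) (empirical d n (snd s)))
    \<in> borel_measurable (Pi\<^sub>M {..<n} (\<lambda>_. Rd d) \<Otimes>\<^sub>M Pi\<^sub>M {..<n} (\<lambda>_. Rd d))"
proof -
  let ?N = "Pi\<^sub>M {..<n} (\<lambda>_. Rd d) \<Otimes>\<^sub>M Pi\<^sub>M {..<n} (\<lambda>_. Rd d)"
  define K where "K x y = exp (- c x y / \<epsilon>)" for x y
  \<comment> \<open>The base point only has to lie in the space, not in the sample, so one choice,
    the origin, serves all samples at once.\<close>
  define x0 :: "nat \<Rightarrow> real" where "x0 = (\<lambda>i\<in>{..<d}. 0)"
  have x0 [measurable]: "x0 \<in> space (Rd d)" by (auto simp: x0_def Rd_def space_PiM)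
  note [measurable (raw)] = borel_measurable_kernel_compose[OF c]
  have K: "case_prod K \<in> borel_measurable (Rd d \<Otimes>\<^sub>M Rd d)"
    "(\<lambda>(y, x). K x y) \<in> borel_measurable (Rd d \<Otimes>\<^sub>M Rd d)"
    unfolding K_def by measurable
  define u where "u k s = sinkhorn (empirical d n (fst s)) (empirical d n (snd s)) K x0 k" for k s
  define U where "U s = kernel.potential_u (empirical d n (fst s)) (empirical d n (snd s)) K x0" for s
  define V where "V s = kernel.potential_v (empirical d n (fst s)) (empirical d n (snd s)) K x0" for s
  have ep: "entropic_problem (empirical d n (fst s)) (empirical d n (snd s)) c M \<epsilon>" if "s \<in> space ?N" for s
    using that by (intro entropic_problem_empirical c M eps n) (auto simp: space_pair_measure)
  have kernel: "kernel (empirical d n (fst s)) (empirical d n (snd s)) K (exp (- M / \<epsilon>))" if "s \<in> space ?N" for s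
  proof -
    interpret entropic_problem "empirical d n (fst s)" "empirical d n (snd s)" c M \<epsilon>
      by (rule ep[OF that])
    show ?thesis unfolding K_def[abs_def] by (rule kernel_axioms)
  qed
  have u: "case_prod (u k) \<in> borel_measurable (?N \<Otimes>\<^sub>M Rd d)" for k
  proof (induction k)
    case (Suc k)
    define v where "v s = half_step (empirical d n (fst s)) K (u k s)" for s
    define w where "w s = half_step (empirical d n (snd s)) (\<lambda>y x. K x y) (v s)" for s
    have "case_prod v \<in> borel_measurable (?N \<Otimes>\<^sub>M Rd d)"
      unfolding v_def by (rule measurable_half_step_empirical[OF K(1) n _ Suc]) measurable
    then have "case_prod w \<in> borel_measurable (?N \<Otimes>\<^sub>M Rd d)"
      unfolding w_def by (rule measurable_half_step_empirical[OF K(2) n measurable_snd])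
    note [measurable (raw)] = borel_measurable_kernel_compose[OF this]
    have "(\<lambda>(s, x). w s x / w s x0) \<in> borel_measurable (?N \<Otimes>\<^sub>M Rd d)" by measurable
    then show ?case by (simp add: u_def Let_def w_def v_def)
  qed (simp add: u_def)
  have U: "case_prod U \<in> borel_measurable (?N \<Otimes>\<^sub>M Rd d)"
  proof (rule borel_measurable_LIMSEQ_real[OF _ u])
    fix z assume z: "z \<in> space (?N \<Otimes>\<^sub>M Rd d)"
    then obtain s x where sx: "z = (s, x)" "s \<in> space ?N" "x \<in> space (Rd d)" by (auto simp: space_pair_measure)
    interpret kernel "empirical d n (fst s)" "empirical d n (snd s)" K "exp (- M / \<epsilon>)"
      by (rule kernel[OF sx(2)])
    show "(\<lambda>k. case z of (s, x) \<Rightarrow> u k s x) \<longlonglongrightarrow> (case z of (s, x) \<Rightarrow> U s x)"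
      using sinkhorn_tendsto[of x0 x] x0 sx by (simp add: u_def U_def)
  qed
  have "V s = half_step (empirical d n (fst s)) K (U s)" if "s \<in> space ?N" for s
  proof -
    interpret kernel "empirical d n (fst s)" "empirical d n (snd s)" K "exp (- M / \<epsilon>)"
      by (rule kernel[OF that])
    show ?thesis by (simp add: V_def U_def potential_v_def)
  qed
  then have "case_prod V \<in> borel_measurable (?N \<Otimes>\<^sub>M Rd d) \<longleftrightarrow>
      (\<lambda>(s, w). half_step (empirical d n (fst s)) K (U s) w) \<in> borel_measurable (?N \<Otimes>\<^sub>M Rd d)"
    by (intro measurable_cong) (auto simp: space_pair_measure)
  also have "\<dots>" by (rule measurable_half_step_empirical[OF K(1) n _ U]) measurable
  finally have V: "case_prod V \<in> borel_measurable (?N \<Otimes>\<^sub>M Rd d)" .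
  have "entropic_OT c \<epsilon> (empirical d n (fst s)) (empirical d n (snd s))
      = ereal ((\<Sum>i<n. \<epsilon> * ln (U s (fst s i))) / n + (\<Sum>i<n. \<epsilon> * ln (V s (snd s i))) / n)"
    if s: "s \<in> space ?N" for s
  proof -
    have s': "fst s \<in> space (Pi\<^sub>M {..<n} (\<lambda>_. Rd d))" "snd s \<in> space (Pi\<^sub>M {..<n} (\<lambda>_. Rd d))"
      using s by (auto simp: space_pair_measure)
    interpret entropic_problem "empirical d n (fst s)" "empirical d n (snd s)" c M \<epsilon>
      by (rule ep[OF s])
    have pot: "potential_f x0 = (\<lambda>x. \<epsilon> * ln (U s x))" "potential_g x0 = (\<lambda>x. \<epsilon> * ln (V s x))"
      by (auto simp: fun_eq_iff potential_f_def potential_g_def U_def V_def K_def[abs_def])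
    have meas: "potential_f x0 \<in> borel_measurable (Rd d)" "potential_g x0 \<in> borel_measurable (Rd d)"
      using measurable_potentials[of x0] x0 by (simp_all cong: measurable_cong_sets)
    then show ?thesis
      using entropic_OT_eq_potentials[of x0] x0 integral_empirical[OF s'(1) n meas(1)]
        integral_empirical[OF s'(2) n meas(2)]
      by (simp only: pot space_empirical)
  qed
  then have "(\<lambda>s. entropic_OT c \<epsilon> (empirical d n (fst s)) (empirical d n (snd s))) \<in> borel_measurable ?N \<longleftrightarrow>
    (\<lambda>s. ereal ((\<Sum>i<n. \<epsilon> * ln (U s (fst s i))) / n + (\<Sum>i<n. \<epsilon> * ln (V s (snd s i))) / n)) \<in> borel_measurable ?N"
    by (rule measurable_cong)
  also have "\<dots>"
  proof -
    note [measurable (raw)] = borel_measurable_kernel_compose[OF U] borel_measurable_kernel_compose[OF V]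
    have [measurable]: "(\<lambda>s. fst s i) \<in> measurable ?N (Rd d)" "(\<lambda>s. snd s i) \<in> measurable ?N (Rd d)" if "i < n" for i
      using measurable_compose[OF measurable_fst measurable_component_singleton[of i]]
        measurable_compose[OF measurable_snd measurable_component_singleton[of i]] that by auto
    show ?thesis by measurable
  qed
  finally show ?thesis .
qed

text \<open>The product of the empirical measures charges only the sampled pairs, so agreement there
  is agreement almost everywhere.\<close>

lemma entropic_OT_empirical_cong:
  assumes [measurable]: "case_prod c \<in> borel_measurable (Rd d \<Otimes>\<^sub>M Rd d)" "case_prod c' \<in> borel_measurable (Rd d \<Otimes>\<^sub>M Rd d)"
    and x: "x \<in> space (Pi\<^sub>M {..<n} (\<lambda>_. Rd d))" and y: "y \<in> space (Pi\<^sub>M {..<n} (\<lambda>_. Rd d))"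
    and n: "n \<ge> 1" and eps: "\<epsilon> > 0"
    and eq: "\<And>i j. i < n \<Longrightarrow> j < n \<Longrightarrow> c (x i) (y j) = c' (x i) (y j)"
  shows "entropic_OT c \<epsilon> (empirical d n x) (empirical d n y) = entropic_OT c' \<epsilon> (empirical d n x) (empirical d n y)"
proof (rule entropic_OT_cong_AE)
  interpret P: prob_space "empirical d n x" by (rule prob_space_empirical[OF x n])
  interpret Q: prob_space "empirical d n y" by (rule prob_space_empirical[OF y n])
  interpret PQ: pair_prob_space "empirical d n x" "empirical d n y" ..
  note [measurable (raw)] = borel_measurable_kernel_compose[OF assms(1)] borel_measurable_kernel_compose[OF assms(2)]
  show "AE z in empirical d n x \<Otimes>\<^sub>M empirical d n y. case_prod c z = case_prod c' z"
  proof (rule PQ.AE_pair_measure)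
    show "{z \<in> space (empirical d n x \<Otimes>\<^sub>M empirical d n y). case_prod c z = case_prod c' z}
        \<in> sets (empirical d n x \<Otimes>\<^sub>M empirical d n y)"
      by measurable
    \<comment> \<open>Testing the second variable only at the finitely many \<open>y j\<close> keeps
      the set of good \<open>x'\<close> measurable; \<open>AE_empirical\<close> is then used again
      for the inner quantifier.\<close>
    have "AE x' in empirical d n x. \<forall>j<n. c x' (y j) = c' x' (y j)"
    proof (rule AE_empirical[OF x n])
      have eq_sets: "{z \<in> space (Rd d). c z (y j) = c' z (y j)} \<in> sets (Rd d)" if "j \<in> {..<n}" for j
      proof -
        have [measurable]: "y j \<in> space (Rd d)" using y that by (auto simp: space_PiM)
        show ?thesis by measurable
      qed
      show "{z \<in> space (Rd d). \<forall>j<n. c z (y j) = c' z (y j)} \<in> sets (Rd d)"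
        using sets.sets_Collect_finite_All[OF eq_sets finite_lessThan] by (simp only: Ball_def lessThan_iff)
    qed (use eq in auto)
    with AE_space show "AE x' in empirical d n x. AE y' in empirical d n y. case_prod c (x', y') = case_prod c' (x', y')"
    proof eventually_elim
      case (elim x')
      have [measurable]: "x' \<in> space (Rd d)" using elim(1) by simp
      have "{z \<in> space (Rd d). c x' z = c' x' z} \<in> sets (Rd d)" by measurable
      from AE_empirical[OF y n this] elim show ?case by simp
    qed
  qed
qed (use eps in measurable)

text \<open>Projection onto an interval is 1-Lipschitz, so truncation creates a bound at every pair
  without spoiling the Lipschitz conditions.\<close>

definition clamp_cost :: "real \<Rightarrow> ('a \<Rightarrow> 'b \<Rightarrow> real) \<Rightarrow> 'a \<Rightarrow> 'b \<Rightarrow> real" where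
  "clamp_cost M c x y = max (- M) (min M (c x y))"

lemma clamp_cost_le: "0 \<le> M \<Longrightarrow> \<bar>clamp_cost M c x y\<bar> \<le> M"
  by (auto simp: clamp_cost_def)

lemma clamp_cost_eq: "\<bar>c x y\<bar> \<le> M \<Longrightarrow> clamp_cost M c x y = c x y"
  by (auto simp: clamp_cost_def abs_le_iff max_def min_def)

lemma measurable_clamp_cost:
  assumes [measurable]: "case_prod c \<in> borel_measurable N"
  shows "case_prod (clamp_cost M c) \<in> borel_measurable N"
proof -
  have "(\<lambda>z. max (- M) (min M (case_prod c z))) \<in> borel_measurable N" by measurable
  then show ?thesis by (simp add: clamp_cost_def[abs_def] split_beta')
qed

text \<open>A sample involves only finitely many costs, so truncation at a high enough level changes
  nothing: the value is the limit of an eventually constant sequence of values for bounded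
  costs.\<close>

lemma measurable_entropic_OT_empirical:
  assumes c: "case_prod c \<in> borel_measurable (Rd d \<Otimes>\<^sub>M Rd d)" and eps: "\<epsilon> > 0" and n: "n \<ge> 1"
  shows "(\<lambda>s. entropic_OT c \<epsilon> (empirical d n (fst s)) (empirical d n (snd s)))
    \<in> borel_measurable (Pi\<^sub>M {..<n} (\<lambda>_. Rd d) \<Otimes>\<^sub>M Pi\<^sub>M {..<n} (\<lambda>_. Rd d))"
proof (rule borel_measurable_LIMSEQ_order)
  show "(\<lambda>s. entropic_OT (clamp_cost (real k) c) \<epsilon> (empirical d n (fst s)) (empirical d n (snd s)))
      \<in> borel_measurable (Pi\<^sub>M {..<n} (\<lambda>_. Rd d) \<Otimes>\<^sub>M Pi\<^sub>M {..<n} (\<lambda>_. Rd d))" for k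
    by (intro measurable_entropic_OT_empirical_bounded[where M="real k"] measurable_clamp_cost c eps n clamp_cost_le) simp
next
  fix s assume s: "s \<in> space (Pi\<^sub>M {..<n} (\<lambda>_. Rd d) \<Otimes>\<^sub>M Pi\<^sub>M {..<n} (\<lambda>_. Rd d))"
  define m where "m = (\<Sum>i<n. \<Sum>j<n. \<bar>c (fst s i) (snd s j)\<bar>)"
  have m: "\<bar>c (fst s i) (snd s j)\<bar> \<le> m" if "i < n" "j < n" for i j
  proof -
    have "\<bar>c (fst s i) (snd s j)\<bar> \<le> (\<Sum>j<n. \<bar>c (fst s i) (snd s j)\<bar>)"
      using that by (intro member_le_sum) auto
    also have "\<dots> \<le> m" unfolding m_def using that
      by (intro member_le_sum[of i "{..<n}" "\<lambda>i. \<Sum>j<n. \<bar>c (fst s i) (snd s j)\<bar>"]) (auto intro: sum_nonneg)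
    finally show ?thesis .
  qed
  obtain k0 :: nat where k0: "m \<le> real k0" using real_arch_simple by blast
  have "entropic_OT (clamp_cost (real k) c) \<epsilon> (empirical d n (fst s)) (empirical d n (snd s))
     = entropic_OT c \<epsilon> (empirical d n (fst s)) (empirical d n (snd s))" if k: "k \<ge> k0" for k
  proof (rule entropic_OT_empirical_cong)
    fix i j assume "i < n" "j < n"
    then have "\<bar>c (fst s i) (snd s j)\<bar> \<le> real k" using m[of i j] k0 k by simp
    then show "clamp_cost (real k) c (fst s i) (snd s j) = c (fst s i) (snd s j)" by (rule clamp_cost_eq[where c=c])
  qed (use s eps n c in \<open>auto simp: space_pair_measure intro: measurable_clamp_cost\<close>)
  then show "(\<lambda>k. entropic_OT (clamp_cost (real k) c) \<epsilon> (empirical d n (fst s)) (empirical d n (snd s)))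
      \<longlonglongrightarrow> entropic_OT c \<epsilon> (empirical d n (fst s)) (empirical d n (snd s))"
    by (intro tendsto_eventually) (auto simp: eventually_sequentially)
qed

section \<open>The estimation error\<close>

lemma euclid_dist_le_diameter:
  assumes "euclid_dist d a x \<le> r" "euclid_dist d a x' \<le> r"
  shows "euclid_dist d x x' \<le> 2 * r"
  using euclid_dist_triangle[of d x x' a] euclid_dist_commute[of d x a] assms by simp

locale lipschitz_problem = entropic_problem \<mu> \<nu> c 1 \<epsilon>
  for \<mu> \<nu> :: "(nat \<Rightarrow> real) measure" and c \<epsilon> +
  fixes d N n :: nat and L :: real and x0 :: "nat \<Rightarrow> real"
  assumes \<mu>: "borel_prob d \<mu>" and \<nu>: "borel_prob d \<nu>" and x0: "x0 \<in> space \<mu>" and L: "L > 0" and n: "n \<ge> 1"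
    and Lipschitz1: "\<And>x x' y. x \<in> supp d \<mu> \<Longrightarrow> x' \<in> supp d \<mu> \<Longrightarrow> y \<in> supp d \<nu> \<Longrightarrow>
      \<bar>c x y - c x' y\<bar> \<le> L * euclid_dist d x x'"
    and Lipschitz2: "\<And>x y y'. x \<in> supp d \<mu> \<Longrightarrow> y \<in> supp d \<nu> \<Longrightarrow> y' \<in> supp d \<nu> \<Longrightarrow>
      \<bar>c x y - c x y'\<bar> \<le> L * euclid_dist d y y'"
    and N: "min (covering_number d \<mu> (\<epsilon> / L)) (covering_number d \<nu> (\<epsilon> / L)) = enat N"
begin

lemma sets_eq [measurable_cong]: "sets \<mu> = sets (Rd d)" "sets \<nu> = sets (Rd d)"
  using \<mu> \<nu> by (auto simp: borel_prob_def)

lemma space_eq: "space \<mu> = space (Rd d)" "space \<nu> = space (Rd d)"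
  by (intro sets_eq_imp_space_eq sets_eq)+

lemma supp_space: "x \<in> supp d P \<Longrightarrow> x \<in> space (Rd d)"
  by (simp add: supp_def)

abbreviation "f \<equiv> potential_f x0"
abbreviation "g \<equiv> potential_g x0"
definition "p = gibbs f g"

lemma measurable_p: "case_prod p \<in> borel_measurable (\<mu> \<Otimes>\<^sub>M \<nu>)"
  unfolding p_def by (intro measurable_gibbs measurable_potentials x0)

lemma measurable_p_Rd: "case_prod p \<in> borel_measurable (Rd d \<Otimes>\<^sub>M Rd d)"
  using measurable_p by (simp cong: measurable_cong_sets sets_pair_measure_cong add: sets_eq)

lemma p_nonneg: "0 \<le> p x y" by (simp add: p_def gibbs_def)

text \<open>The exponent adds the bounds 2, 3 and 1 on \<open>f\<close>, \<open>g\<close> and the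
  cost. This quantity blows up as \<epsilon> tends to 0, but it serves integrability only and does
  not enter the final estimate.\<close>

definition "gibbs_bound = exp ((2 * 1 + 3 * 1 + 1) / \<epsilon>)"

lemma p_le: "x \<in> space \<mu> \<Longrightarrow> y \<in> space \<nu> \<Longrightarrow> p x y \<le> gibbs_bound"
  unfolding p_def gibbs_bound_def by (intro gibbs_le potential_f_bound potential_g_bound x0)

lemma p_abs_le: "x \<in> space \<mu> \<Longrightarrow> y \<in> space \<nu> \<Longrightarrow> \<bar>p x y\<bar> \<le> gibbs_bound"
  using p_le p_nonneg by (simp add: abs_of_nonneg)

lemma p_marginals:
  "y \<in> space \<nu> \<Longrightarrow> (\<integral>x. p x y \<partial>\<mu>) = 1" "x \<in> space \<mu> \<Longrightarrow> (\<integral>y. p x y \<partial>\<nu>) = 1"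
  unfolding p_def by (intro gibbs_potentials_marginals x0; assumption)+

text \<open>Two points of a ball of radius \<open>\<epsilon> / L\<close> are at distance at most
  \<open>2 * \<epsilon> / L\<close>, so the cost changes by at most \<open>2 * \<epsilon>\<close>;
  kernel and potential contribute \<open>exp 2\<close> each.\<close>

lemma p_ratio_left:
  assumes "x \<in> supp d \<mu> \<inter> {x \<in> space (Rd d). euclid_dist d a x \<le> \<epsilon> / L}"
    "x' \<in> supp d \<mu> \<inter> {x \<in> space (Rd d). euclid_dist d a x \<le> \<epsilon> / L}" "y \<in> supp d \<nu>"
  shows "p x y \<le> exp 4 * p x' y"
proof -
  have "L * euclid_dist d x x' \<le> L * (2 * (\<epsilon> / L))"
    using assms L by (intro mult_left_mono euclid_dist_le_diameter[of d a]) auto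
  then have *: "\<bar>c x y - c x' y\<bar> \<le> 2 * \<epsilon>" if "y \<in> supp d \<nu>" for y
    using Lipschitz1[of x x' y] assms that L by simp
  have "p x y \<le> exp (2 * (2 * \<epsilon>) / \<epsilon>) * p x' y"
    unfolding p_def
  proof (rule gibbs_potentials_le_left[OF x0])
    show "AE y in \<nu>. \<bar>c x y - c x' y\<bar> \<le> 2 * \<epsilon>"
      by (rule eventually_mono[OF AE_supp[OF \<nu>] *])
  qed (use assms * in \<open>auto simp: space_eq supp_space\<close>)
  then show ?thesis using eps_pos by simp
qed

lemma p_ratio_right:
  assumes "y \<in> supp d \<nu> \<inter> {x \<in> space (Rd d). euclid_dist d a x \<le> \<epsilon> / L}"
    "y' \<in> supp d \<nu> \<inter> {x \<in> space (Rd d). euclid_dist d a x \<le> \<epsilon> / L}" "x \<in> supp d \<mu>"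
  shows "p x y \<le> exp 4 * p x y'"
proof -
  have "L * euclid_dist d y y' \<le> L * (2 * (\<epsilon> / L))"
    using assms L by (intro mult_left_mono euclid_dist_le_diameter[of d a]) auto
  then have *: "\<bar>c x y - c x y'\<bar> \<le> 2 * \<epsilon>" if "x \<in> supp d \<mu>" for x
    using Lipschitz2[of x y y'] assms that L by simp
  have "p x y \<le> exp (2 * (2 * \<epsilon>) / \<epsilon>) * p x y'"
    unfolding p_def
  proof (rule gibbs_potentials_le_right[OF x0])
    show "AE x in \<mu>. \<bar>c x y - c x y'\<bar> \<le> 2 * \<epsilon>"
      by (rule eventually_mono[OF AE_supp[OF \<mu>] *])
  qed (use assms * in \<open>auto simp: space_eq supp_space\<close>)
  then show ?thesis using eps_pos by simp
qed

lemma sets_ball: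
  assumes [measurable]: "a \<in> space (Rd d)"
  shows "{x \<in> space (Rd d). euclid_dist d a x \<le> r} \<in> sets (Rd d)"
  by measurable

lemma p_square_integral_swap:
  "(\<integral>y. \<integral>x. (p x y)\<^sup>2 \<partial>\<mu> \<partial>\<nu>) = (\<integral>x. \<integral>y. (p x y)\<^sup>2 \<partial>\<nu> \<partial>\<mu>)"
proof (rule PQ.Fubini_integral)
  show "integrable (\<mu> \<Otimes>\<^sub>M \<nu>) (\<lambda>(x, y). (p x y)\<^sup>2)"
  proof (rule PQ.integrable_bounded[where B="gibbs_bound\<^sup>2"])
    note [measurable (raw)] = borel_measurable_kernel_compose[OF measurable_p]
    show "(\<lambda>(x, y). (p x y)\<^sup>2) \<in> borel_measurable (\<mu> \<Otimes>\<^sub>M \<nu>)" by measurable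
  qed (use p_le p_nonneg in \<open>auto simp: space_pair_measure intro!: power_mono\<close>)
qed

text \<open>The double integral is symmetric in the two measures, so the support with the smaller
  cover may be used; the second case is the first one transposed.\<close>

lemma p_square_integral_le: "(\<integral>x. \<integral>y. (p x y)\<^sup>2 \<partial>\<nu> \<partial>\<mu>) \<le> exp 4 * N"
proof (cases "covering_number d \<mu> (\<epsilon> / L) = enat N")
  case True
  obtain F where F: "finite F" "F \<subseteq> space (Rd d)"
    "supp d \<mu> \<subseteq> (\<Union>a\<in>F. {x \<in> space (Rd d). euclid_dist d a x \<le> \<epsilon> / L})" "card F = N"
    by (rule covering_number_attained[of d \<mu> "\<epsilon> / L"]) (use True in auto)
  have AE: "AE x in \<mu>. x \<in> supp d \<mu> \<and> (\<exists>a\<in>F. x \<in> {x \<in> space (Rd d). euclid_dist d a x \<le> \<epsilon> / L})"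
    using AE_supp[OF \<mu>] by (rule eventually_mono) (use F(3) in blast)
  have "(\<integral>x. \<integral>y. (p x y)\<^sup>2 \<partial>\<nu> \<partial>\<mu>) \<le> exp 4 * card F"
  proof (rule PQ.integral_square_le_cover[OF measurable_p p_nonneg p_le p_marginals F(1) _ AE AE_supp[OF \<nu>]])
    show "{x \<in> space (Rd d). euclid_dist d a x \<le> \<epsilon> / L} \<in> sets \<mu>" if "a \<in> F" for a
      unfolding sets_eq by (rule sets_ball) (use F(2) that in blast)
  qed (assumption | rule p_ratio_left | simp)+
  then show ?thesis using F(4) by simp
next
  case False
  then have cov: "covering_number d \<nu> (\<epsilon> / L) = enat N" using N by (auto simp: min_def split: if_splits)
  obtain F where F: "finite F" "F \<subseteq> space (Rd d)"
    "supp d \<nu> \<subseteq> (\<Union>a\<in>F. {x \<in> space (Rd d). euclid_dist d a x \<le> \<epsilon> / L})" "card F = N"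
    by (rule covering_number_attained[of d \<nu> "\<epsilon> / L"]) (use cov in auto)
  interpret QP: pair_prob_space \<nu> \<mu> ..
  have AE: "AE x in \<nu>. x \<in> supp d \<nu> \<and> (\<exists>a\<in>F. x \<in> {x \<in> space (Rd d). euclid_dist d a x \<le> \<epsilon> / L})"
    using AE_supp[OF \<nu>] by (rule eventually_mono) (use F(3) in blast)
  note [measurable (raw)] = borel_measurable_kernel_compose[OF measurable_p]
  have "(\<lambda>(y, x). p x y) \<in> borel_measurable (\<nu> \<Otimes>\<^sub>M \<mu>)" by measurable
  then have "(\<integral>y. \<integral>x. (p x y)\<^sup>2 \<partial>\<mu> \<partial>\<nu>) \<le> exp 4 * card F"
  proof (rule QP.integral_square_le_cover[OF _ p_nonneg p_le p_marginals(2,1) F(1) _ AE AE_supp[OF \<mu>]])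
    show "{x \<in> space (Rd d). euclid_dist d a x \<le> \<epsilon> / L} \<in> sets \<nu>" if "a \<in> F" for a
      unfolding sets_eq by (rule sets_ball) (use F(2) that in blast)
  qed (assumption | rule p_ratio_right | simp)+
  then show ?thesis using F(4) by (simp add: p_square_integral_swap)
qed

lemma N_pos: "N \<ge> 1"
  using N covering_number_pos[OF \<mu>, of "\<epsilon> / L" N] covering_number_pos[OF \<nu>, of "\<epsilon> / L" N]
  by (auto simp: min_def split: if_splits)

section \<open>Expectations of the four error terms\<close>

definition "left_error s t = (\<Sum>i<n. \<bar>(\<Sum>j<n. p (s i) (t j)) / n - 1\<bar>) / n"
definition "right_error s t = (\<Sum>j<n. \<bar>(\<Sum>i<n. p (s i) (t j)) / n - 1\<bar>) / n"
definition "mean_error_f s = \<bar>(\<Sum>i<n. f (s i)) / n - (\<integral>x. f x \<partial>\<mu>)\<bar>"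
definition "mean_error_g t = \<bar>(\<Sum>j<n. g (t j)) / n - (\<integral>y. g y \<partial>\<nu>)\<bar>"
abbreviation "S \<equiv> Pi\<^sub>M {..<n} (\<lambda>_. \<mu>)"
abbreviation "T \<equiv> Pi\<^sub>M {..<n} (\<lambda>_. \<nu>)"

sublocale S: prob_space S by (intro prob_space_PiM P.prob_space_axioms)
sublocale T: prob_space T by (intro prob_space_PiM Q.prob_space_axioms)
sublocale ST: pair_prob_space S T ..

lemma measurable_sample_components [measurable (raw)]:
  "i \<in> {..<n} \<Longrightarrow> h \<in> measurable K S \<Longrightarrow> (\<lambda>z. h z i) \<in> measurable K \<mu>"
  "i \<in> {..<n} \<Longrightarrow> h' \<in> measurable K T \<Longrightarrow> (\<lambda>z. h' z i) \<in> measurable K \<nu>"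
  by (auto intro: measurable_PiM_component_rev)

lemma measurable_terms:
  "(\<lambda>z. left_error (fst z) (snd z)) \<in> borel_measurable (S \<Otimes>\<^sub>M T)"
  "(\<lambda>z. right_error (fst z) (snd z)) \<in> borel_measurable (S \<Otimes>\<^sub>M T)"
  "mean_error_f \<in> borel_measurable S" "mean_error_g \<in> borel_measurable T"
proof -
  note [measurable (raw)] = borel_measurable_kernel_compose[OF measurable_p]
  have [measurable]: "f \<in> borel_measurable \<mu>" "g \<in> borel_measurable \<nu>"
    by (intro measurable_potentials x0)+
  show "(\<lambda>z. left_error (fst z) (snd z)) \<in> borel_measurable (S \<Otimes>\<^sub>M T)"
    "(\<lambda>z. right_error (fst z) (snd z)) \<in> borel_measurable (S \<Otimes>\<^sub>M T)"
    "mean_error_f \<in> borel_measurable S" "mean_error_g \<in> borel_measurable T"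
    unfolding left_error_def right_error_def mean_error_f_def mean_error_g_def by measurable
qed

lemma mean_abs_le:
  assumes "\<And>i. i < n \<Longrightarrow> \<bar>h i\<bar> \<le> (b::real)"
  shows "\<bar>(\<Sum>i<n. h i) / n\<bar> \<le> b"
proof -
  have "\<bar>\<Sum>i<n. h i\<bar> \<le> (\<Sum>i<n. b)" using assms by (intro order_trans[OF sum_abs] sum_mono) auto
  then show ?thesis using n by (simp add: field_simps)
qed

lemma sample_mem:
  "s \<in> space S \<Longrightarrow> i < n \<Longrightarrow> s i \<in> space \<mu>" "t \<in> space T \<Longrightarrow> i < n \<Longrightarrow> t i \<in> space \<nu>"
  by (auto simp: space_PiM PiE_iff)

lemma marginal_errors_le:
  assumes "s \<in> space S" "t \<in> space T"
  shows "\<bar>left_error s t\<bar> \<le> gibbs_bound + 1" "\<bar>right_error s t\<bar> \<le> gibbs_bound + 1"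
proof -
  have *: "\<bar>(\<Sum>j<n. p (s i) (t j)) / n\<bar> \<le> gibbs_bound" if "i < n" for i
    using that assms by (intro mean_abs_le p_abs_le sample_mem) auto
  have "\<bar>\<bar>(\<Sum>j<n. p (s i) (t j)) / n - 1\<bar>\<bar> \<le> gibbs_bound + 1" if "i < n" for i
    using *[OF that] by linarith
  then show "\<bar>left_error s t\<bar> \<le> gibbs_bound + 1" unfolding left_error_def by (rule mean_abs_le)
  have *: "\<bar>(\<Sum>i<n. p (s i) (t j)) / n\<bar> \<le> gibbs_bound" if "j < n" for j
    using that assms by (intro mean_abs_le p_abs_le sample_mem) auto
  have "\<bar>\<bar>(\<Sum>i<n. p (s i) (t j)) / n - 1\<bar>\<bar> \<le> gibbs_bound + 1" if "j < n" for j
    using *[OF that] by linarith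
  then show "\<bar>right_error s t\<bar> \<le> gibbs_bound + 1" unfolding right_error_def by (rule mean_abs_le)
qed

lemma mean_error_f_le: "s \<in> space S \<Longrightarrow> \<bar>mean_error_f s\<bar> \<le> 4"
  using mean_abs_le[of "\<lambda>i. f (s i)" 2] P.integral_abs_le[of f 2] potential_f_bound[OF x0] sample_mem(1)
    measurable_potentials(1)[OF x0] unfolding mean_error_f_def by (smt (verit))

lemma mean_error_g_le: "t \<in> space T \<Longrightarrow> \<bar>mean_error_g t\<bar> \<le> 6"
  using mean_abs_le[of "\<lambda>i. g (t i)" 3] Q.integral_abs_le[of g 3] potential_g_bound[OF x0] sample_mem(2)
    measurable_potentials(2)[OF x0] unfolding mean_error_g_def by (smt (verit))

lemma integrable_terms:
  "integrable (S \<Otimes>\<^sub>M T) (\<lambda>(s, t). left_error s t)" "integrable (S \<Otimes>\<^sub>M T) (\<lambda>(s, t). right_error s t)"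
  "integrable (S \<Otimes>\<^sub>M T) (\<lambda>(s, t). mean_error_f s)" "integrable (S \<Otimes>\<^sub>M T) (\<lambda>(s, t). mean_error_g t)"
proof -
  have [measurable]: "(\<lambda>z. mean_error_f (fst z)) \<in> borel_measurable (S \<Otimes>\<^sub>M T)" "(\<lambda>z. mean_error_g (snd z)) \<in> borel_measurable (S \<Otimes>\<^sub>M T)"
    using measurable_compose[OF measurable_fst measurable_terms(3)]
      measurable_compose[OF measurable_snd measurable_terms(4)] by auto
  note [measurable] = measurable_terms(1,2)
  show "integrable (S \<Otimes>\<^sub>M T) (\<lambda>(s, t). left_error s t)" "integrable (S \<Otimes>\<^sub>M T) (\<lambda>(s, t). right_error s t)"
    unfolding split_beta'
    by (rule ST.integrable_bounded[where B="gibbs_bound + 1"]; auto simp: space_pair_measure intro: marginal_errors_le)+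
  show "integrable (S \<Otimes>\<^sub>M T) (\<lambda>(s, t). mean_error_f s)" unfolding split_beta'
    by (rule ST.integrable_bounded[where B=4]) (auto simp: space_pair_measure intro: mean_error_f_le)
  show "integrable (S \<Otimes>\<^sub>M T) (\<lambda>(s, t). mean_error_g t)" unfolding split_beta'
    by (rule ST.integrable_bounded[where B=6]) (auto simp: space_pair_measure intro: mean_error_g_le)
qed

lemma integral_left_error_le: "(\<integral>(s, t). left_error s t \<partial>(S \<Otimes>\<^sub>M T)) \<le> sqrt (exp 4 * N / n)"
proof -
  have "(\<integral>(s, t). left_error s t \<partial>(S \<Otimes>\<^sub>M T)) = (\<integral>s. \<integral>t. left_error s t \<partial>T \<partial>S)"
    using ST.integral_fst[OF integrable_terms(1)] by simp
  also have "\<dots> \<le> sqrt (exp 4 * N / n)"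
    unfolding left_error_def using N_pos
    by (intro PQ.sample_marginal_error[OF measurable_p p_abs_le p_marginals(2) p_square_integral_le _ n]) auto
  finally show ?thesis .
qed

lemma integral_right_error_le: "(\<integral>(s, t). right_error s t \<partial>(S \<Otimes>\<^sub>M T)) \<le> sqrt (exp 4 * N / n)"
proof -
  interpret QP: pair_prob_space \<nu> \<mu> ..
  note [measurable (raw)] = borel_measurable_kernel_compose[OF measurable_p]
  have m: "(\<lambda>(y, x). p x y) \<in> borel_measurable (\<nu> \<Otimes>\<^sub>M \<mu>)" by measurable
  have "(\<integral>(s, t). right_error s t \<partial>(S \<Otimes>\<^sub>M T)) = (\<integral>t. \<integral>s. right_error s t \<partial>S \<partial>T)"
    using ST.integral_snd[OF integrable_terms(2)] by simp
  also have "\<dots> \<le> sqrt (exp 4 * N / n)"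
    unfolding right_error_def using N_pos p_square_integral_le
    by (intro QP.sample_marginal_error[OF m p_abs_le p_marginals(1) _ _ n])
      (auto simp: p_square_integral_swap)
  finally show ?thesis .
qed

text \<open>A fixed function bounded by 2 has second moment at most 4, and
  \<open>t = 2 / sqrt n\<close> balances the two terms. No covering number enters.\<close>

lemma integral_mean_error_f_le: "(\<integral>(s, t). mean_error_f s \<partial>(S \<Otimes>\<^sub>M T)) \<le> 2 / sqrt n"
proof -
  have "(\<integral>(s, t). mean_error_f s \<partial>(S \<Otimes>\<^sub>M T)) = (\<integral>s. mean_error_f s \<partial>S)"
    using ST.integral_fst[OF integrable_terms(3)] by (simp add: T.prob_space)
  also have "\<dots> \<le> ((\<integral>x. (f x)\<^sup>2 \<partial>\<mu>) / n / (2 / sqrt n) + 2 / sqrt n) / 2"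
    unfolding mean_error_f_def using n potential_f_bound[OF x0]
    by (intro P.sample_mean_abs_deviation[where B=2] measurable_potentials x0) auto
  also have "\<dots> \<le> (4 / n / (2 / sqrt n) + 2 / sqrt n) / 2"
  proof -
    have [measurable]: "f \<in> borel_measurable \<mu>" by (intro measurable_potentials x0)
    have "\<bar>f x\<bar> ^ 2 \<le> 2 ^ 2" if "x \<in> space \<mu>" for x
      using potential_f_bound[OF x0 that] by (intro power_mono) auto
    then have "(\<integral>x. (f x)\<^sup>2 \<partial>\<mu>) \<le> 4"
      by (intro P.integral_bounds(2)[where l=0]) auto
    then show ?thesis by (intro divide_right_mono add_right_mono) auto
  qed
  also have "\<dots> = 2 / sqrt n"
    using n real_sqrt_mult_self[of n] by (simp add: field_simps del: real_sqrt_mult_self)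
  finally show ?thesis .
qed

lemma integral_mean_error_g_le: "(\<integral>(s, t). mean_error_g t \<partial>(S \<Otimes>\<^sub>M T)) \<le> 3 / sqrt n"
proof -
  have "(\<integral>(s, t). mean_error_g t \<partial>(S \<Otimes>\<^sub>M T)) = (\<integral>t. mean_error_g t \<partial>T)"
    using ST.integral_snd[OF integrable_terms(4)] by (simp add: S.prob_space)
  also have "\<dots> \<le> ((\<integral>x. (g x)\<^sup>2 \<partial>\<nu>) / n / (3 / sqrt n) + 3 / sqrt n) / 2"
    unfolding mean_error_g_def using n potential_g_bound[OF x0]
    by (intro Q.sample_mean_abs_deviation[where B=3] measurable_potentials x0) auto
  also have "\<dots> \<le> (9 / n / (3 / sqrt n) + 3 / sqrt n) / 2"
  proof -
    have [measurable]: "g \<in> borel_measurable \<nu>" by (intro measurable_potentials x0)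
    have "\<bar>g x\<bar> ^ 2 \<le> 3 ^ 2" if "x \<in> space \<nu>" for x
      using potential_g_bound[OF x0 that] by (intro power_mono) auto
    then have "(\<integral>x. (g x)\<^sup>2 \<partial>\<nu>) \<le> 9"
      by (intro Q.integral_bounds(2)[where l=0]) auto
    then show ?thesis by (intro divide_right_mono add_right_mono) auto
  qed
  also have "\<dots> = 3 / sqrt n"
    using n real_sqrt_mult_self[of n] by (simp add: field_simps del: real_sqrt_mult_self)
  finally show ?thesis .
qed

text \<open>The coefficients are those of \<open>entropic_OT_stability\<close> at
  \<open>M = 1\<close>.\<close>

definition "total_error s t = mean_error_f s + mean_error_g t + (4 + \<epsilon>) * left_error s t + 6 * right_error s t"

lemma total_error_nonneg: "0 \<le> total_error s t"
  unfolding total_error_def left_error_def right_error_def mean_error_f_def mean_error_g_def using eps_pos by (auto intro!: add_nonneg_nonneg mult_nonneg_nonneg divide_nonneg_nonneg sum_nonneg)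

text \<open>The constant: \<open>2 + 3\<close> from the means of \<open>f\<close> and
  \<open>g\<close>, absorbed into \<open>sqrt (N / n)\<close> because \<open>N\<close> is at least
  1, plus \<open>4 + 6\<close> from the marginal errors, makes 15; the factor \<open>exp 2\<close>
  is the square root of \<open>exp 4\<close> in the second moment.\<close>

lemma nn_integral_total_error_le: "(\<integral>\<^sup>+z. total_error (fst z) (snd z) \<partial>(S \<Otimes>\<^sub>M T)) \<le> ennreal (15 * exp 2 * (1 + \<epsilon>) * sqrt (N / n))"
proof -
  let ?q = "sqrt (N / n)"
  note int = integrable_terms[unfolded split_beta']
  have iR: "integrable (S \<Otimes>\<^sub>M T) (\<lambda>(s, t). total_error s t)"
    unfolding total_error_def split_beta' using int by simp
  have sq: "sqrt (exp 4 * N / n) = exp 2 * ?q"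
  proof -
    have "exp 4 = (exp 2 :: real)\<^sup>2" by (simp add: power2_eq_square exp_add[symmetric])
    then show ?thesis by (simp only: times_divide_eq_right[symmetric] real_sqrt_mult real_sqrt_abs abs_exp_cancel)
  qed
  have q0: "0 \<le> ?q" by simp
  have qn: "1 / sqrt n \<le> ?q"
    using N_pos by (simp add: real_sqrt_divide divide_right_mono)
  have e2: "1 \<le> exp (2::real)" by simp
  have "?q \<le> exp 2 * ?q" using mult_right_mono[OF e2 q0] by simp
  then have n5: "5 / sqrt n \<le> 5 * (exp 2 * ?q)" using qn by simp
  have "(\<integral>(s, t). total_error s t \<partial>(S \<Otimes>\<^sub>M T)) = (\<integral>(s, t). mean_error_f s \<partial>(S \<Otimes>\<^sub>M T)) + (\<integral>(s, t). mean_error_g t \<partial>(S \<Otimes>\<^sub>M T))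
      + (4 + \<epsilon>) * (\<integral>(s, t). left_error s t \<partial>(S \<Otimes>\<^sub>M T)) + 6 * (\<integral>(s, t). right_error s t \<partial>(S \<Otimes>\<^sub>M T))"
    unfolding total_error_def split_beta' using int by simp
  also have "\<dots> \<le> 2 / sqrt n + 3 / sqrt n + (4 + \<epsilon>) * (exp 2 * ?q) + 6 * (exp 2 * ?q)"
    using integral_mean_error_f_le integral_mean_error_g_le integral_left_error_le integral_right_error_le eps_pos unfolding sq
    by (intro add_mono mult_left_mono) auto
  also have "\<dots> \<le> (15 + \<epsilon>) * (exp 2 * ?q)"
    using n5 by (simp add: algebra_simps)
  also have "\<dots> \<le> (15 * (1 + \<epsilon>)) * (exp 2 * ?q)"
    using eps_pos by (intro mult_right_mono) auto
  finally have "(\<integral>(s, t). total_error s t \<partial>(S \<Otimes>\<^sub>M T)) \<le> 15 * exp 2 * (1 + \<epsilon>) * ?q" by (simp only: mult_ac)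
  moreover have "(\<integral>\<^sup>+z. total_error (fst z) (snd z) \<partial>(S \<Otimes>\<^sub>M T)) = ennreal (\<integral>(s, t). total_error s t \<partial>(S \<Otimes>\<^sub>M T))"
    using nn_integral_eq_integral[OF iR] total_error_nonneg by (simp add: split_beta')
  ultimately show ?thesis by (simp add: ennreal_leI)
qed

text \<open>A deterministic bound for every pair of samples: stability for the empirical pair at the
  population potentials compares the empirical value with the empirical means of \<open>f\<close>
  and \<open>g\<close>, and the triangle inequality moves on to the population means.\<close>

lemma estimation_error_le:
  assumes s: "s \<in> space S" and t: "t \<in> space T"
  shows "estimation_error d n c \<epsilon> \<mu> \<nu> (s, t) \<le> ennreal (total_error s t)"
proof -
  have sp: "s \<in> space (Pi\<^sub>M {..<n} (\<lambda>_. Rd d))" "t \<in> space (Pi\<^sub>M {..<n} (\<lambda>_. Rd d))"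
    using s t by (auto simp: space_PiM space_eq)
  have c_Rd: "case_prod c \<in> borel_measurable (Rd d \<Otimes>\<^sub>M Rd d)"
    using measurable_c by (simp cong: measurable_cong_sets sets_pair_measure_cong add: sets_eq)
  interpret E: entropic_problem "empirical d n s" "empirical d n t" c 1 \<epsilon>
    by (intro entropic_problem_empirical c_Rd c_le eps_pos n sp)
  have fg: "f \<in> borel_measurable (Rd d)" "g \<in> borel_measurable (Rd d)"
    using measurable_potentials[OF x0] by (simp_all cong: measurable_cong_sets add: sets_eq)
  note iS = integral_empirical[OF sp(1) n] and iT = integral_empirical[OF sp(2) n]
  have pm: "(\<lambda>x. p x y) \<in> borel_measurable (Rd d)" "p y \<in> borel_measurable (Rd d)" if "y \<in> space (Rd d)" for y
    using borel_measurable_kernel_compose[OF measurable_p_Rd measurable_ident_sets[OF refl] measurable_const[OF that]]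
      borel_measurable_kernel_compose[OF measurable_p_Rd measurable_const[OF that] measurable_ident_sets[OF refl]]
    by simp_all
  have mem: "s i \<in> space (Rd d)" "t i \<in> space (Rd d)" if "i < n" for i
    using sample_mem s t that by (auto simp: space_eq)
  have "(\<integral>x. \<bar>(\<integral>y. p x y \<partial>empirical d n t) - 1\<bar> \<partial>empirical d n s)
      = (\<integral>x. \<bar>(\<Sum>j<n. p x (t j)) / n - 1\<bar> \<partial>empirical d n s)"
    by (intro Bochner_Integration.integral_cong refl) (simp add: iT pm)
  also have "\<dots> = left_error s t"
    unfolding left_error_def using mem
    by (intro iS borel_measurable_abs borel_measurable_diff borel_measurable_divide borel_measurable_sum pm) auto
  finally have eA: "(\<integral>x. \<bar>(\<integral>y. p x y \<partial>empirical d n t) - 1\<bar> \<partial>empirical d n s) = left_error s t" .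
  have "(\<integral>y. \<bar>(\<integral>x. p x y \<partial>empirical d n s) - 1\<bar> \<partial>empirical d n t)
      = (\<integral>y. \<bar>(\<Sum>i<n. p (s i) y) / n - 1\<bar> \<partial>empirical d n t)"
    by (intro Bochner_Integration.integral_cong refl) (simp add: iS pm)
  also have "\<dots> = right_error s t"
    unfolding right_error_def using mem
    by (intro iT borel_measurable_abs borel_measurable_diff borel_measurable_divide borel_measurable_sum pm) auto
  finally have eB: "(\<integral>y. \<bar>(\<integral>x. p x y \<partial>empirical d n s) - 1\<bar> \<partial>empirical d n t) = right_error s t" .
  obtain V where V: "entropic_OT c \<epsilon> (empirical d n s) (empirical d n t) = ereal V"
    "\<bar>V - ((\<integral>x. f x \<partial>empirical d n s) + (\<integral>y. g y \<partial>empirical d n t))\<bar>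
      \<le> (4 * 1 + \<epsilon>) * (\<integral>x. \<bar>(\<integral>y. gibbs f g x y \<partial>empirical d n t) - 1\<bar> \<partial>empirical d n s)
        + 6 * 1 * (\<integral>y. \<bar>(\<integral>x. gibbs f g x y \<partial>empirical d n s) - 1\<bar> \<partial>empirical d n t)"
  proof (rule E.entropic_OT_stability[of f g])
    show "f \<in> borel_measurable (empirical d n s)" "g \<in> borel_measurable (empirical d n t)"
      using fg by (simp_all cong: measurable_cong_sets)
    show "\<bar>f x\<bar> \<le> 2 * 1" if "x \<in> space (empirical d n s)" for x
      using potential_f_bound[OF x0, of x] that by (simp add: space_eq)
    show "\<bar>g x\<bar> \<le> 3 * 1" if "x \<in> space (empirical d n t)" for x
      using potential_g_bound[OF x0, of x] that by (simp add: space_eq)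
  qed (rule that)
  have "\<bar>V - ((\<integral>x. f x \<partial>\<mu>) + (\<integral>y. g y \<partial>\<nu>))\<bar> \<le> total_error s t"
    using V(2) unfolding p_def[symmetric] eA eB iS[OF fg(1)] iT[OF fg(2)] total_error_def mean_error_f_def mean_error_g_def mult_1_right
    by linarith
  then show ?thesis
    unfolding estimation_error_def prod.case V(1) entropic_OT_eq_potentials[OF x0] by (simp add: ennreal_leI)
qed

end

text \<open>Each pair of an \<open>s i\<close> and a \<open>t j\<close> has law
  \<open>\<mu> \<Otimes> \<nu>\<close>, so it avoids a given null set almost surely, and there are
  only finitely many pairs. This carries the agreement of a cost with its truncation over to the
  samples.\<close>

lemma AE_samples:
  fixes \<mu> :: "'a measure" and \<nu> :: "'b measure"
  assumes "prob_space \<mu>" "prob_space \<nu>" and meas: "{z \<in> space (\<mu> \<Otimes>\<^sub>M \<nu>). \<Phi> (fst z) (snd z)} \<in> sets (\<mu> \<Otimes>\<^sub>M \<nu>)"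
    and AE: "AE z in \<mu> \<Otimes>\<^sub>M \<nu>. \<Phi> (fst z) (snd z)"
  shows "AE z in Pi\<^sub>M {..<n::nat} (\<lambda>_. \<mu>) \<Otimes>\<^sub>M Pi\<^sub>M {..<n} (\<lambda>_. \<nu>). \<forall>i<n. \<forall>j<n. \<Phi> (fst z i) (snd z j)"
proof -
  let ?S = "Pi\<^sub>M {..<n} (\<lambda>_. \<mu>)" and ?T = "Pi\<^sub>M {..<n} (\<lambda>_. \<nu>)"
  interpret M: prob_space \<mu> by fact
  interpret N: prob_space \<nu> by fact
  interpret MN: pair_prob_space \<mu> \<nu> ..
  interpret S: prob_space ?S by (intro prob_space_PiM M.prob_space_axioms)
  interpret T: prob_space ?T by (intro prob_space_PiM N.prob_space_axioms)
  interpret ST: pair_prob_space ?S ?T ..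
  have "AE z in ?S \<Otimes>\<^sub>M ?T. \<Phi> (fst z i) (snd z j)" if ij: "i \<in> {..<n}" "j \<in> {..<n}" for i j
  proof (rule ST.AE_pair_measure)
    have m: "(\<lambda>z. (fst z i, snd z j)) \<in> measurable (?S \<Otimes>\<^sub>M ?T) (\<mu> \<Otimes>\<^sub>M \<nu>)"
      using ij by (intro measurable_Pair measurable_compose[OF measurable_fst] measurable_compose[OF measurable_snd]
          measurable_component_singleton)
    from measurable_sets[OF m meas]
    have "(\<lambda>z. (fst z i, snd z j)) -` {z \<in> space (\<mu> \<Otimes>\<^sub>M \<nu>). \<Phi> (fst z) (snd z)} \<inter> space (?S \<Otimes>\<^sub>M ?T)
        \<in> sets (?S \<Otimes>\<^sub>M ?T)" .
    also have "(\<lambda>z. (fst z i, snd z j)) -` {z \<in> space (\<mu> \<Otimes>\<^sub>M \<nu>). \<Phi> (fst z) (snd z)} \<inter> space (?S \<Otimes>\<^sub>M ?T)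
        = {z \<in> space (?S \<Otimes>\<^sub>M ?T). \<Phi> (fst z i) (snd z j)}"
      using measurable_space[OF m] by fastforce
    finally show "{z \<in> space (?S \<Otimes>\<^sub>M ?T). \<Phi> (fst z i) (snd z j)} \<in> sets (?S \<Otimes>\<^sub>M ?T)" .
    have "AE x in \<mu>. AE y in \<nu>. \<Phi> x y" using MN.AE_pair[OF AE] by simp
    then have "AE s in ?S. AE y in \<nu>. \<Phi> (s i) y"
      by (rule AE_PiM_component[where M="\<lambda>_. \<mu>" and P="\<lambda>x. AE y in \<nu>. \<Phi> x y", OF M.prob_space_axioms ij(1)])
    then show "AE s in ?S. AE t in ?T. \<Phi> (fst (s, t) i) (snd (s, t) j)"
    proof (rule eventually_mono)
      fix s assume "AE y in \<nu>. \<Phi> (s i) y"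
      then have "AE t in ?T. \<Phi> (s i) (t j)"
        by (rule AE_PiM_component[where M="\<lambda>_. \<nu>" and P="\<Phi> (s i)", OF N.prob_space_axioms ij(2)])
      then show "AE t in ?T. \<Phi> (fst (s, t) i) (snd (s, t) j)" by simp
    qed
  qed
  then have "AE z in ?S \<Otimes>\<^sub>M ?T. \<forall>i\<in>{..<n}. \<forall>j\<in>{..<n}. \<Phi> (fst z i) (snd z j)"
    by (intro AE_finite_allI finite_lessThan)
  then show ?thesis by (rule eventually_mono) auto
qed

lemma expected_estimation_error_le:
  assumes \<mu>: "borel_prob d \<mu>" and \<nu>: "borel_prob d \<nu>" and L: "L > 0" and cost: "cost_assumption d \<mu> \<nu> c L"
    and eps: "\<epsilon> > 0" and n: "n \<ge> 1"
    and N: "min (covering_number d \<mu> (\<epsilon> / L)) (covering_number d \<nu> (\<epsilon> / L)) = enat N"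
  shows "(\<integral>\<^sup>+ s. estimation_error d n c \<epsilon> \<mu> \<nu> s \<partial>samples n \<mu> \<nu>) \<le> ennreal (15 * exp 2 * (1 + \<epsilon>) * sqrt (N / n))"
proof -
  have [measurable_cong]: "sets \<mu> = sets (Rd d)" "sets \<nu> = sets (Rd d)" using \<mu> \<nu> by (auto simp: borel_prob_def)
  then have sp: "space \<mu> = space (Rd d)" "space \<nu> = space (Rd d)" by (auto dest: sets_eq_imp_space_eq)
  interpret M: prob_space \<mu> using \<mu> by (simp add: borel_prob_def)
  interpret N: prob_space \<nu> using \<nu> by (simp add: borel_prob_def)
  define c' where "c' = clamp_cost 1 c"
  have c_Rd: "case_prod c \<in> borel_measurable (Rd d \<Otimes>\<^sub>M Rd d)"
    using cost by (simp add: cost_assumption_def)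
  then have c'_Rd: "case_prod c' \<in> borel_measurable (Rd d \<Otimes>\<^sub>M Rd d)"
    unfolding c'_def by (rule measurable_clamp_cost)
  have [measurable]: "case_prod c \<in> borel_measurable (\<mu> \<Otimes>\<^sub>M \<nu>)" "case_prod c' \<in> borel_measurable (\<mu> \<Otimes>\<^sub>M \<nu>)"
    using c_Rd c'_Rd by measurable
  have "AE z in \<mu> \<Otimes>\<^sub>M \<nu>. (case z of (x, y) \<Rightarrow> ereal \<bar>c x y\<bar>) \<le> 1"
    using esssup_AE[of "\<lambda>(x, y). ereal \<bar>c x y\<bar>" "\<mu> \<Otimes>\<^sub>M \<nu>"] cost
    by (auto simp: cost_assumption_def elim!: eventually_mono intro: order_trans)
  then have eq: "AE z in \<mu> \<Otimes>\<^sub>M \<nu>. c (fst z) (snd z) = c' (fst z) (snd z)"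
    by (rule eventually_mono) (auto simp: c'_def clamp_cost_eq)
  have clamp_diff: "\<bar>c' x y - c' x' y'\<bar> \<le> \<bar>c x y - c x' y'\<bar>" for x y x' y'
    by (auto simp: c'_def clamp_cost_def max_def min_def)
  obtain x0 where x0: "x0 \<in> space \<mu>" using M.not_empty by auto
  interpret lipschitz_problem \<mu> \<nu> c' \<epsilon> d N n L x0
  proof unfold_locales
    show "case_prod c' \<in> borel_measurable (\<mu> \<Otimes>\<^sub>M \<nu>)" by measurable
    show "\<bar>c' x y\<bar> \<le> 1" for x y unfolding c'_def by (rule clamp_cost_le) simp
    show "\<bar>c' x y - c' x' y\<bar> \<le> L * euclid_dist d x x'"
      if "x \<in> supp d \<mu>" "x' \<in> supp d \<mu>" "y \<in> supp d \<nu>" for x x' y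
      using cost that by (intro order_trans[OF clamp_diff]) (auto simp: cost_assumption_def)
    show "\<bar>c' x y - c' x y'\<bar> \<le> L * euclid_dist d y y'"
      if "x \<in> supp d \<mu>" "y \<in> supp d \<nu>" "y' \<in> supp d \<nu>" for x y y'
      using cost that by (intro order_trans[OF clamp_diff]) (auto simp: cost_assumption_def)
  qed (use \<mu> \<nu> L n N eps x0 in auto)
  have pop: "entropic_OT c \<epsilon> \<mu> \<nu> = entropic_OT c' \<epsilon> \<mu> \<nu>"
    using eq eps by (intro entropic_OT_cong_AE) (auto simp: split_beta')
  have "AE z in S \<Otimes>\<^sub>M T. \<forall>i<n. \<forall>j<n. c (fst z i) (snd z j) = c' (fst z i) (snd z j)"
    by (rule AE_samples[OF M.prob_space_axioms N.prob_space_axioms _ eq]) measurable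
  then have "AE z in S \<Otimes>\<^sub>M T. estimation_error d n c \<epsilon> \<mu> \<nu> z \<le> ennreal (total_error (fst z) (snd z))"
    using AE_space
  proof eventually_elim
    case (elim z)
    obtain s t where z: "z = (s, t)" "s \<in> space S" "t \<in> space T"
      using elim(2) by (auto simp: space_pair_measure)
    have "entropic_OT c \<epsilon> (empirical d n s) (empirical d n t) = entropic_OT c' \<epsilon> (empirical d n s) (empirical d n t)"
      using z elim(1) by (intro entropic_OT_empirical_cong c_Rd c'_Rd n eps) (auto simp: space_PiM sp)
    then have "estimation_error d n c \<epsilon> \<mu> \<nu> z = estimation_error d n c' \<epsilon> \<mu> \<nu> z"
      unfolding z(1) estimation_error_def prod.case pop by simp
    then show ?case using estimation_error_le[OF z(2,3)] by (simp add: z(1))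
  qed
  then have "(\<integral>\<^sup>+ s. estimation_error d n c \<epsilon> \<mu> \<nu> s \<partial>samples n \<mu> \<nu>) \<le> (\<integral>\<^sup>+z. total_error (fst z) (snd z) \<partial>(S \<Otimes>\<^sub>M T))"
    unfolding samples_def by (rule nn_integral_mono_AE)
  also note nn_integral_total_error_le
  finally show ?thesis .
qed

lemma measurable_estimation_error:
  assumes \<mu>: "borel_prob d \<mu>" and \<nu>: "borel_prob d \<nu>" and c: "case_prod c \<in> borel_measurable (Rd d \<Otimes>\<^sub>M Rd d)"
    and eps: "\<epsilon> > 0" and n: "n \<ge> 1"
  shows "estimation_error d n c \<epsilon> \<mu> \<nu> \<in> borel_measurable (samples n \<mu> \<nu>)"
proof -
  have "sets (samples n \<mu> \<nu>) = sets (Pi\<^sub>M {..<n} (\<lambda>_. Rd d) \<Otimes>\<^sub>M Pi\<^sub>M {..<n} (\<lambda>_. Rd d))"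
    unfolding samples_def using \<mu> \<nu> by (intro sets_pair_measure_cong sets_PiM_cong) (auto simp: borel_prob_def)
  then have [measurable]: "(\<lambda>s. entropic_OT c \<epsilon> (empirical d n (fst s)) (empirical d n (snd s))) \<in> borel_measurable (samples n \<mu> \<nu>)"
    using measurable_entropic_OT_empirical[OF c eps n] by (simp cong: measurable_cong_sets)
  show ?thesis
    unfolding estimation_error_def split_beta' by measurable
qed

text \<open>The measurability conjunct makes the nonnegative integral a genuine expectation; for a
  nonmeasurable integrand it would only be a lower integral.\<close>

theorem theorem2:
  shows "\<exists>C::real. C > 0 \<and>
    (\<forall>(d::nat) (\<mu> :: (nat \<Rightarrow> real) measure) (\<nu> :: (nat \<Rightarrow> real) measure)
      (c :: (nat \<Rightarrow> real) \<Rightarrow> (nat \<Rightarrow> real) \<Rightarrow> real) (L::real) (\<epsilon>::real) (n::nat).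
      d \<ge> 1 \<longrightarrow> borel_prob d \<mu> \<longrightarrow> borel_prob d \<nu> \<longrightarrow>
      L > 0 \<longrightarrow> cost_assumption d \<mu> \<nu> c L \<longrightarrow> \<epsilon> > 0 \<longrightarrow> n \<ge> 1 \<longrightarrow>
      estimation_error d n c \<epsilon> \<mu> \<nu> \<in> borel_measurable (samples n \<mu> \<nu>) \<and>
      (\<integral>\<^sup>+ s. estimation_error d n c \<epsilon> \<mu> \<nu> s \<partial>samples n \<mu> \<nu>)
        \<le> ennreal (C * (1 + \<epsilon>)) *
          ennreal_sqrt (ennreal_of_enat (min (covering_number d \<mu> (\<epsilon> / L)) (covering_number d \<nu> (\<epsilon> / L)))
                        / of_nat n))"
proof (intro exI[of _ "15 * exp 2"] conjI allI impI)
  fix d \<mu> \<nu> c and L \<epsilon> :: real and n :: nat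
  assume asm: "borel_prob d \<mu>" "borel_prob d \<nu>" "L > 0" "cost_assumption d \<mu> \<nu> c L" "\<epsilon> > 0" "n \<ge> 1"
  show "estimation_error d n c \<epsilon> \<mu> \<nu> \<in> borel_measurable (samples n \<mu> \<nu>)"
    using asm by (intro measurable_estimation_error) (auto simp: cost_assumption_def)
  show "(\<integral>\<^sup>+ s. estimation_error d n c \<epsilon> \<mu> \<nu> s \<partial>samples n \<mu> \<nu>)
        \<le> ennreal (15 * exp 2 * (1 + \<epsilon>)) *
          ennreal_sqrt (ennreal_of_enat (min (covering_number d \<mu> (\<epsilon> / L)) (covering_number d \<nu> (\<epsilon> / L)))
                        / of_nat n)"
  proof (cases "min (covering_number d \<mu> (\<epsilon> / L)) (covering_number d \<nu> (\<epsilon> / L))")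
    case (enat N)
    have "of_nat N / of_nat n = ennreal (N / n)"
      using asm(6) by (simp add: ennreal_of_nat_eq_real_of_nat divide_ennreal)
    then have "ennreal_sqrt (of_nat N / of_nat n) = ennreal (sqrt (N / n))"
      by (simp add: ennreal_sqrt_def)
    then show ?thesis
      using expected_estimation_error_le[OF asm enat] asm(5)
      unfolding enat by (simp add: ennreal_mult)
  next
    case infinity
    \<comment> \<open>If neither support has a finite cover, the right-hand side is infinite. The
      factor in front must be shown nonzero, since 0 times infinity is 0.\<close>
    have inf: "(\<infinity> :: ennreal) / of_nat n = \<infinity>"
      using asm(6) by (simp add: ennreal_top_divide ennreal_of_nat_eq_real_of_nat)
    have "0 < 15 * exp 2 * (1 + \<epsilon>)" using asm(5) by simp
    then have "ennreal (15 * exp 2 * (1 + \<epsilon>)) \<noteq> 0" by (simp only: ennreal_eq_0_iff not_le)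
    then have "ennreal (15 * exp 2 * (1 + \<epsilon>)) * \<infinity> = \<infinity>"
      by (simp only: infinity_ennreal_def ennreal_mult_eq_top_iff) simp
    then show ?thesis
      unfolding infinity ennreal_of_enat_infty inf ennreal_sqrt_def by simp
  qed
qed simp

end
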